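(* Let $(M,\varphi,\xi_\alpha,\eta^\alpha,g)$ be a $(2n+s)$-dimensional indefinite $\mathcal{S}$-manifold, with $n\geqslant2$ and $s\geqslant1$, having pointwise constant $\varphi$-sectional curvature $c$, where $c$ is a smooth function on $M$. Then $M$ is $\eta$-Einstein.
   Context: All manifolds are connected, and all manifolds, tensor fields and maps are smooth. A globally framed $f$-manifold ($g.f.f$-manifold) $(M,\varphi,\xi_\alpha,\eta^\alpha)$, $\alpha\in\{1,\ldots,s\}$, $s\geqslant1$, is a $(2n+s)$-dimensional manifold with a $(1,1)$-tensor field $\varphi$ of constant rank $2n$ satisfying $\varphi^3+\varphi=0$, together with $s$ linearly independent global vector fields $\xi_\alpha$ and $s$ one-forms $\eta^\alpha$ such that $\varphi^2=-I+\sum_{\alpha=1}^s\eta^\alpha\otimes\xi_\alpha$ and $\eta^\alpha(\xi_\beta)=\delta^\alpha_\beta$. It is normal if $[\varphi,\varphi]+2\sum_{\alpha=1}^s d\eta^\alpha\otimes\xi_\alpha=0$, where $[\varphi,\varphi](X,Y)=\varphi^2[X,Y]+[\varphi X,\varphi Y]-\varphi[\varphi X,Y]-\varphi[X,\varphi Y]$. The convention for the exterior derivative of a 1-form is $2\,d\eta(X,Y)=X(\eta(Y))-Y(\eta(X))-\eta([X,Y])$. An indefinite (metric) $g.f.f$-manifold is a $g.f.f$-manifold with a semi-Riemannian metric $g$ such that $g(\varphi X,\varphi Y)=g(X,Y)-\sum_{\alpha=1}^s\varepsilon_\alpha\eta^\alpha(X)\eta^\alpha(Y)$ for all vector fields $X,Y$,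 where $\varepsilon_\alpha=g(\xi_\alpha,\xi_\alpha)=\pm1$. Its fundamental 2-form is $\Phi(X,Y)=g(X,\varphi Y)$. An indefinite $\mathcal{S}$-manifold is a normal indefinite $g.f.f$-manifold such that $\Phi=d\eta^\alpha$ for every $\alpha\in\{1,\ldots,s\}$. With $\nabla$ the Levi-Civita connection of $g$, the curvature tensor is $R(X,Y,Z,W)=g(R(Z,W)Y,X)=g(([\nabla_Z,\nabla_W]-\nabla_{[Z,W]})Y,X)$, and the Ricci tensor is $\mathrm{Ric}(X,Y)=\sum_i g(E_i,E_i)R(X,E_i,Y,E_i)$ for any local orthonormal frame $(E_i)$. The sectional curvature of a non-degenerate plane $\pi=\mathrm{span}(x,y)\subset T_pM$ is $k_p(\pi)=R_p(x,y,x,y)/(g_p(x,x)g_p(y,y)-g_p(x,y)^2)$. $\Gamma(TM)$ denotes the smooth vector fields on $M$. For a non-lightlike unit vector $x\in\mathrm{Im}(\varphi_p)$, the $\varphi$-sectional curvature at $p$ with respect to the $\varphi$-plane $\pi=\mathrm{span}\{x,\varphi x\}$ is $k_p(\pi)$. $M$ has pointwise constant $\varphi$-sectional curvature $c$ if, at every point $p\in M$, the $\varphi$-sectional curvature at $p$ is independent of the choice of the $\varphi$-plane and equals $c(p)$. An indefinite $g.f.f$-manifold is $\eta$-Einstein if there exist smooth functions $h,k$ on $M$ such that $\mathrm{Ric}(X,Y)=h\,g(\varphi X,\varphi Y)+k\,\bar\eta(X)\bar\eta(Y)$ for any $X,Y\in\Gamma(TM)$, where $\bar\eta=\sum_{\alpha=1}^s\varepsilon_\alpha\eta^\alpha$.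 *)

theory Defs
  imports "HOL-Analysis.Analysis" "HOL-Library.Function_Algebras"
begin

text \<open>Tangent vectors are derivations on real-valued functions, so that function types carry the
  pointwise vector space structure. The additive part is in \<open>HOL-Library.Function_Algebras\<close>.\<close>

instantiation "fun" :: (type, real_vector) real_vector
begin

definition scaleR_fun :: "real \<Rightarrow> ('a \<Rightarrow> 'b) \<Rightarrow> 'a \<Rightarrow> 'b"
  where "scaleR_fun c f = (\<lambda>x. c *\<^sub>R f x)"

instance
  by standard (auto simp: scaleR_fun_def fun_eq_iff scaleR_add_right scaleR_add_left)

end


subsection \<open>Smooth manifolds\<close>

text \<open>Used for open \<open>S\<close> only: \<open>f\<close> is of class \<open>C^k\<close> on \<open>S\<close>.\<close>

primrec Ck_on :: "nat \<Rightarrow> ('e::euclidean_space \<Rightarrow> 'b::real_normed_vector) \<Rightarrow> 'e set \<Rightarrow> bool"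
  where
    "Ck_on 0 f S \<longleftrightarrow> continuous_on S f"
  | "Ck_on (Suc k) f S \<longleftrightarrow>
       (\<forall>x\<in>S. f differentiable (at x)) \<and>
       (\<forall>v. Ck_on k (\<lambda>x. frechet_derivative f (at x) v) S)"

definition smooth_on :: "('e::euclidean_space \<Rightarrow> 'b::real_normed_vector) \<Rightarrow> 'e set \<Rightarrow> bool"
  where "smooth_on f S \<longleftrightarrow> (\<forall>k. Ck_on k f S)"

text \<open>The underlying set of a manifold is the whole type \<open>'a\<close>; the chart \<open>(U, x)\<close> maps the open
  set \<open>U\<close> to an open set of the model space \<open>'e\<close>, whose dimension is that of the manifold.
  The values of \<open>x\<close> outside \<open>U\<close> are irrelevant. The Hausdorff property and second countability
  are class constraints on \<open>'a\<close>. An atlas need not be maximal.\<close>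

type_synonym ('a, 'e) atlas = "('a set \<times> ('a \<Rightarrow> 'e)) set"

definition connected_smooth_manifold ::
    "('a::{t2_space,second_countable_topology}, 'e::euclidean_space) atlas \<Rightarrow> bool"
  where "connected_smooth_manifold A \<longleftrightarrow>
    connected (UNIV :: 'a set) \<and>
    (\<Union>(U, x)\<in>A. U) = UNIV \<and>
    (\<forall>(U, x)\<in>A. open U \<and> open (x ` U) \<and> homeomorphism U (x ` U) x (inv_into U x)) \<and>
    (\<forall>(U, x)\<in>A. \<forall>(V, y)\<in>A. smooth_on (y \<circ> inv_into U x) (x ` (U \<inter> V)))"

definition smooth_fun :: "('a, 'e::euclidean_space) atlas \<Rightarrow> ('a \<Rightarrow> real) \<Rightarrow> bool"
  where "smooth_fun A f \<longleftrightarrow> (\<forall>(U, x)\<in>A. smooth_on (f \<circ> inv_into U x) (x ` U))"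


subsection \<open>Tangent vectors, vector fields and tensor fields\<close>

type_synonym 'a tvec = "('a \<Rightarrow> real) \<Rightarrow> real"
type_synonym 'a vfield = "'a \<Rightarrow> 'a tvec"

text \<open>Tangent vectors at \<open>p\<close> are the derivations at \<open>p\<close> of the algebra of smooth functions. The
  last conjunct fixes the irrelevant values on non-smooth functions, so that equality of tangent
  vectors is equality of derivations.\<close>

definition tangent_space :: "('a, 'e::euclidean_space) atlas \<Rightarrow> 'a \<Rightarrow> 'a tvec set"
  where "tangent_space A p = {v.
    (\<forall>f g. smooth_fun A f \<longrightarrow> smooth_fun A g \<longrightarrow>
       v (\<lambda>q. f q + g q) = v f + v g \<and> v (\<lambda>q. f q * g q) = v f * g p + f p * v g) \<and>
    (\<forall>a f. smooth_fun A f \<longrightarrow> v (\<lambda>q. a * f q) = a * v f) \<and>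
    (\<forall>f. \<not> smooth_fun A f \<longrightarrow> v f = 0)}"

definition vector_field :: "('a, 'e::euclidean_space) atlas \<Rightarrow> 'a vfield \<Rightarrow> bool"
  where "vector_field A X \<longleftrightarrow>
    (\<forall>p. X p \<in> tangent_space A p) \<and> (\<forall>f. smooth_fun A f \<longrightarrow> smooth_fun A (\<lambda>p. X p f))"

definition lie_bracket :: "'a vfield \<Rightarrow> 'a vfield \<Rightarrow> 'a vfield"
  where "lie_bracket X Y = (\<lambda>p f. X p (\<lambda>q. Y q f) - Y p (\<lambda>q. X q f))"

definition linear_on :: "'v::real_vector set \<Rightarrow> ('v \<Rightarrow> 'w::real_vector) \<Rightarrow> bool"
  where "linear_on T L \<longleftrightarrow>
    (\<forall>v\<in>T. \<forall>w\<in>T. L (v + w) = L v + L w) \<and> (\<forall>a. \<forall>v\<in>T. L (a *\<^sub>R v) = a *\<^sub>R L v)"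

definition one_form :: "('a, 'e::euclidean_space) atlas \<Rightarrow> ('a \<Rightarrow> 'a tvec \<Rightarrow> real) \<Rightarrow> bool"
  where "one_form A \<omega> \<longleftrightarrow>
    (\<forall>p. linear_on (tangent_space A p) (\<omega> p)) \<and>
    (\<forall>X. vector_field A X \<longrightarrow> smooth_fun A (\<lambda>p. \<omega> p (X p)))"

definition tensor_field_1_1 ::
    "('a, 'e::euclidean_space) atlas \<Rightarrow> ('a \<Rightarrow> 'a tvec \<Rightarrow> 'a tvec) \<Rightarrow> bool"
  where "tensor_field_1_1 A \<phi> \<longleftrightarrow>
    (\<forall>p. linear_on (tangent_space A p) (\<phi> p) \<and>
         \<phi> p ` tangent_space A p \<subseteq> tangent_space A p) \<and>
    (\<forall>X. vector_field A X \<longrightarrow> vector_field A (\<lambda>p. \<phi> p (X p)))"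

text \<open>On a connected manifold the index of \<open>g\<close> is automatically constant.\<close>

definition semi_riemannian_metric ::
    "('a, 'e::euclidean_space) atlas \<Rightarrow> ('a \<Rightarrow> 'a tvec \<Rightarrow> 'a tvec \<Rightarrow> real) \<Rightarrow> bool"
  where "semi_riemannian_metric A g \<longleftrightarrow>
    (\<forall>p. \<forall>v\<in>tangent_space A p.
       linear_on (tangent_space A p) (g p v) \<and>
       (\<forall>w\<in>tangent_space A p. g p v w = g p w v) \<and>
       ((\<forall>w\<in>tangent_space A p. g p v w = 0) \<longrightarrow> v = 0)) \<and>
    (\<forall>X Y. vector_field A X \<longrightarrow> vector_field A Y \<longrightarrow> smooth_fun A (\<lambda>p. g p (X p) (Y p)))"

text \<open>The convention is \<open>2 d\<omega>(X,Y) = X(\<omega>(Y)) - Y(\<omega>(X)) - \<omega>([X,Y])\<close>.\<close>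

definition ext_deriv :: "('a \<Rightarrow> 'a tvec \<Rightarrow> real) \<Rightarrow> 'a vfield \<Rightarrow> 'a vfield \<Rightarrow> 'a \<Rightarrow> real"
  where "ext_deriv \<omega> X Y p =
    (X p (\<lambda>q. \<omega> q (Y q)) - Y p (\<lambda>q. \<omega> q (X q)) - \<omega> p (lie_bracket X Y p)) / 2"


subsection \<open>Levi-Civita connection and curvature\<close>

definition is_levi_civita ::
    "('a, 'e::euclidean_space) atlas \<Rightarrow> ('a \<Rightarrow> 'a tvec \<Rightarrow> 'a tvec \<Rightarrow> real) \<Rightarrow>
     ('a vfield \<Rightarrow> 'a vfield \<Rightarrow> 'a vfield) \<Rightarrow> bool"
  where "is_levi_civita A g D \<longleftrightarrow>
    (\<forall>X Y. vector_field A X \<longrightarrow> vector_field A Y \<longrightarrow> vector_field A (D X Y)) \<and>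
    (\<forall>X Y Z. vector_field A X \<longrightarrow> vector_field A Y \<longrightarrow> vector_field A Z \<longrightarrow>
       D (X + Y) Z = D X Z + D Y Z \<and>
       D X (Y + Z) = D X Y + D X Z \<and>
       (\<forall>p. X p (\<lambda>q. g q (Y q) (Z q)) = g p (D X Y p) (Z p) + g p (Y p) (D X Z p))) \<and>
    (\<forall>f X Y. smooth_fun A f \<longrightarrow> vector_field A X \<longrightarrow> vector_field A Y \<longrightarrow>
       D (\<lambda>p. f p *\<^sub>R X p) Y = (\<lambda>p. f p *\<^sub>R D X Y p) \<and>
       D X (\<lambda>p. f p *\<^sub>R Y p) = (\<lambda>p. X p f *\<^sub>R Y p + f p *\<^sub>R D X Y p)) \<and>
    (\<forall>X Y. vector_field A X \<longrightarrow> vector_field A Y \<longrightarrow> D X Y - D Y X = lie_bracket X Y)"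

text \<open>The Levi-Civita connection exists and its values on smooth vector fields are unique; \<open>SOME\<close>
  only chooses the irrelevant values on other arguments.\<close>

definition levi_civita ::
    "('a, 'e::euclidean_space) atlas \<Rightarrow> ('a \<Rightarrow> 'a tvec \<Rightarrow> 'a tvec \<Rightarrow> real) \<Rightarrow>
     'a vfield \<Rightarrow> 'a vfield \<Rightarrow> 'a vfield"
  where "levi_civita A g = (SOME D. is_levi_civita A g D)"

definition curvature_op ::
    "('a, 'e::euclidean_space) atlas \<Rightarrow> ('a \<Rightarrow> 'a tvec \<Rightarrow> 'a tvec \<Rightarrow> real) \<Rightarrow>
     'a vfield \<Rightarrow> 'a vfield \<Rightarrow> 'a vfield \<Rightarrow> 'a vfield"
  where "curvature_op A g X Y Z =
    (let D = levi_civita A g in D X (D Y Z) - D Y (D X Z) - D (lie_bracket X Y) Z)"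

text \<open>\<open>R(X,Y,Z,W) = g(R(Z,W)Y, X)\<close>; note the order of the arguments.\<close>

definition curvature ::
    "('a, 'e::euclidean_space) atlas \<Rightarrow> ('a \<Rightarrow> 'a tvec \<Rightarrow> 'a tvec \<Rightarrow> real) \<Rightarrow>
     'a vfield \<Rightarrow> 'a vfield \<Rightarrow> 'a vfield \<Rightarrow> 'a vfield \<Rightarrow> 'a \<Rightarrow> real"
  where "curvature A g X Y Z W p = g p (curvature_op A g Z W Y p) (X p)"

text \<open>The value of the curvature tensor on tangent vectors at \<open>p\<close>, through arbitrary smooth
  extensions to vector fields.\<close>

definition curvature_at ::
    "('a, 'e::euclidean_space) atlas \<Rightarrow> ('a \<Rightarrow> 'a tvec \<Rightarrow> 'a tvec \<Rightarrow> real) \<Rightarrow> 'a \<Rightarrow>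
     'a tvec \<Rightarrow> 'a tvec \<Rightarrow> 'a tvec \<Rightarrow> 'a tvec \<Rightarrow> real"
  where "curvature_at A g p x y z w =
    (THE r. \<exists>X Y Z W. vector_field A X \<and> vector_field A Y \<and> vector_field A Z \<and> vector_field A W \<and>
       X p = x \<and> Y p = y \<and> Z p = z \<and> W p = w \<and> r = curvature A g X Y Z W p)"

text \<open>The sectional curvature of the plane spanned by \<open>x\<close> and \<open>y\<close>.\<close>

definition sectional_curvature ::
    "('a, 'e::euclidean_space) atlas \<Rightarrow> ('a \<Rightarrow> 'a tvec \<Rightarrow> 'a tvec \<Rightarrow> real) \<Rightarrow> 'a \<Rightarrow>
     'a tvec \<Rightarrow> 'a tvec \<Rightarrow> real"
  where "sectional_curvature A g p x y =
    curvature_at A g p x y x y / (g p x x * g p y y - (g p x y)\<^sup>2)"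

definition orthonormal_basis ::
    "('a, 'e::euclidean_space) atlas \<Rightarrow> ('a \<Rightarrow> 'a tvec \<Rightarrow> 'a tvec \<Rightarrow> real) \<Rightarrow> 'a \<Rightarrow>
     'a tvec set \<Rightarrow> bool"
  where "orthonormal_basis A g p B \<longleftrightarrow>
    finite B \<and> B \<subseteq> tangent_space A p \<and> tangent_space A p \<subseteq> span B \<and>
    (\<forall>b\<in>B. g p b b \<in> {1, -1}) \<and> (\<forall>b\<in>B. \<forall>b'\<in>B. b \<noteq> b' \<longrightarrow> g p b b' = 0)"

text \<open>The trace is pointwise, so an orthonormal basis of the tangent space stands for the values
  of a local orthonormal frame.\<close>

definition ricci_at ::
    "('a, 'e::euclidean_space) atlas \<Rightarrow> ('a \<Rightarrow> 'a tvec \<Rightarrow> 'a tvec \<Rightarrow> real) \<Rightarrow> 'a \<Rightarrow>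
     'a tvec \<Rightarrow> 'a tvec \<Rightarrow> real"
  where "ricci_at A g p x y =
    (THE r. \<exists>B. orthonormal_basis A g p B \<and>
       r = (\<Sum>b\<in>B. g p b b * curvature_at A g p x b y b))"


subsection \<open>Globally framed f-manifolds\<close>

definition gff_manifold ::
    "nat \<Rightarrow> nat \<Rightarrow> ('a::{t2_space,second_countable_topology}, 'e::euclidean_space) atlas \<Rightarrow>
     ('a \<Rightarrow> 'a tvec \<Rightarrow> 'a tvec) \<Rightarrow> (nat \<Rightarrow> 'a vfield) \<Rightarrow> (nat \<Rightarrow> 'a \<Rightarrow> 'a tvec \<Rightarrow> real) \<Rightarrow> bool"
  where "gff_manifold n s A \<phi> \<xi> \<eta> \<longleftrightarrow>
    s \<ge> 1 \<and> connected_smooth_manifold A \<and> DIM('e) = 2 * n + s \<and>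
    tensor_field_1_1 A \<phi> \<and>
    (\<forall>p. dim (\<phi> p ` tangent_space A p) = 2 * n) \<and>
    (\<forall>p. \<forall>v\<in>tangent_space A p. \<phi> p (\<phi> p (\<phi> p v)) + \<phi> p v = 0) \<and>
    (\<forall>\<alpha>\<in>{1..s}. vector_field A (\<xi> \<alpha>) \<and> one_form A (\<eta> \<alpha>)) \<and>
    (\<forall>p. inj_on (\<lambda>\<alpha>. \<xi> \<alpha> p) {1..s} \<and> independent ((\<lambda>\<alpha>. \<xi> \<alpha> p) ` {1..s})) \<and>
    (\<forall>p. \<forall>v\<in>tangent_space A p. \<phi> p (\<phi> p v) = - v + (\<Sum>\<alpha>\<in>{1..s}. \<eta> \<alpha> p v *\<^sub>R \<xi> \<alpha> p)) \<and>
    (\<forall>p. \<forall>\<alpha>\<in>{1..s}. \<forall>\<beta>\<in>{1..s}. \<eta> \<alpha> p (\<xi> \<beta> p) = (if \<alpha> = \<beta> then 1 else 0))"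

definition nijenhuis :: "('a \<Rightarrow> 'a tvec \<Rightarrow> 'a tvec) \<Rightarrow> 'a vfield \<Rightarrow> 'a vfield \<Rightarrow> 'a vfield"
  where "nijenhuis \<phi> X Y = (\<lambda>p.
    let \<phi>X = (\<lambda>q. \<phi> q (X q)); \<phi>Y = (\<lambda>q. \<phi> q (Y q)) in
    \<phi> p (\<phi> p (lie_bracket X Y p)) + lie_bracket \<phi>X \<phi>Y p
      - \<phi> p (lie_bracket \<phi>X Y p) - \<phi> p (lie_bracket X \<phi>Y p))"

definition normal_gff ::
    "nat \<Rightarrow> ('a, 'e::euclidean_space) atlas \<Rightarrow> ('a \<Rightarrow> 'a tvec \<Rightarrow> 'a tvec) \<Rightarrow>
     (nat \<Rightarrow> 'a vfield) \<Rightarrow> (nat \<Rightarrow> 'a \<Rightarrow> 'a tvec \<Rightarrow> real) \<Rightarrow> bool"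
  where "normal_gff s A \<phi> \<xi> \<eta> \<longleftrightarrow>
    (\<forall>X Y p. vector_field A X \<longrightarrow> vector_field A Y \<longrightarrow>
       nijenhuis \<phi> X Y p + 2 *\<^sub>R (\<Sum>\<alpha>\<in>{1..s}. ext_deriv (\<eta> \<alpha>) X Y p *\<^sub>R \<xi> \<alpha> p) = 0)"

definition eps ::
    "('a \<Rightarrow> 'a tvec \<Rightarrow> 'a tvec \<Rightarrow> real) \<Rightarrow> (nat \<Rightarrow> 'a vfield) \<Rightarrow> nat \<Rightarrow> 'a \<Rightarrow> real"
  where "eps g \<xi> \<alpha> p = g p (\<xi> \<alpha> p) (\<xi> \<alpha> p)"

definition indefinite_gff_manifold ::
    "nat \<Rightarrow> nat \<Rightarrow> ('a::{t2_space,second_countable_topology}, 'e::euclidean_space) atlas \<Rightarrow>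
     ('a \<Rightarrow> 'a tvec \<Rightarrow> 'a tvec) \<Rightarrow> (nat \<Rightarrow> 'a vfield) \<Rightarrow> (nat \<Rightarrow> 'a \<Rightarrow> 'a tvec \<Rightarrow> real) \<Rightarrow>
     ('a \<Rightarrow> 'a tvec \<Rightarrow> 'a tvec \<Rightarrow> real) \<Rightarrow> bool"
  where "indefinite_gff_manifold n s A \<phi> \<xi> \<eta> g \<longleftrightarrow>
    gff_manifold n s A \<phi> \<xi> \<eta> \<and> semi_riemannian_metric A g \<and>
    (\<forall>\<alpha>\<in>{1..s}. \<forall>p. eps g \<xi> \<alpha> p \<in> {1, -1}) \<and>
    (\<forall>X Y p. vector_field A X \<longrightarrow> vector_field A Y \<longrightarrow>
       g p (\<phi> p (X p)) (\<phi> p (Y p)) =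
         g p (X p) (Y p) - (\<Sum>\<alpha>\<in>{1..s}. eps g \<xi> \<alpha> p * \<eta> \<alpha> p (X p) * \<eta> \<alpha> p (Y p)))"

definition fundamental_form ::
    "('a \<Rightarrow> 'a tvec \<Rightarrow> 'a tvec) \<Rightarrow> ('a \<Rightarrow> 'a tvec \<Rightarrow> 'a tvec \<Rightarrow> real) \<Rightarrow>
     'a vfield \<Rightarrow> 'a vfield \<Rightarrow> 'a \<Rightarrow> real"
  where "fundamental_form \<phi> g X Y p = g p (X p) (\<phi> p (Y p))"

definition indefinite_S_manifold ::
    "nat \<Rightarrow> nat \<Rightarrow> ('a::{t2_space,second_countable_topology}, 'e::euclidean_space) atlas \<Rightarrow>
     ('a \<Rightarrow> 'a tvec \<Rightarrow> 'a tvec) \<Rightarrow> (nat \<Rightarrow> 'a vfield) \<Rightarrow> (nat \<Rightarrow> 'a \<Rightarrow> 'a tvec \<Rightarrow> real) \<Rightarrow>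
     ('a \<Rightarrow> 'a tvec \<Rightarrow> 'a tvec \<Rightarrow> real) \<Rightarrow> bool"
  where "indefinite_S_manifold n s A \<phi> \<xi> \<eta> g \<longleftrightarrow>
    indefinite_gff_manifold n s A \<phi> \<xi> \<eta> g \<and> normal_gff s A \<phi> \<xi> \<eta> \<and>
    (\<forall>\<alpha>\<in>{1..s}. \<forall>X Y p. vector_field A X \<longrightarrow> vector_field A Y \<longrightarrow>
       fundamental_form \<phi> g X Y p = ext_deriv (\<eta> \<alpha>) X Y p)"

definition pointwise_constant_phi_sectional_curvature ::
    "('a, 'e::euclidean_space) atlas \<Rightarrow> ('a \<Rightarrow> 'a tvec \<Rightarrow> 'a tvec) \<Rightarrow>
     ('a \<Rightarrow> 'a tvec \<Rightarrow> 'a tvec \<Rightarrow> real) \<Rightarrow> ('a \<Rightarrow> real) \<Rightarrow> bool"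
  where "pointwise_constant_phi_sectional_curvature A \<phi> g c \<longleftrightarrow>
    (\<forall>p. \<forall>x\<in>\<phi> p ` tangent_space A p. g p x x \<in> {1, -1} \<longrightarrow>
       sectional_curvature A g p x (\<phi> p x) = c p)"

definition eta_bar ::
    "nat \<Rightarrow> (nat \<Rightarrow> 'a vfield) \<Rightarrow> (nat \<Rightarrow> 'a \<Rightarrow> 'a tvec \<Rightarrow> real) \<Rightarrow>
     ('a \<Rightarrow> 'a tvec \<Rightarrow> 'a tvec \<Rightarrow> real) \<Rightarrow> 'a \<Rightarrow> 'a tvec \<Rightarrow> real"
  where "eta_bar s \<xi> \<eta> g p v = (\<Sum>\<alpha>\<in>{1..s}. eps g \<xi> \<alpha> p * \<eta> \<alpha> p v)"

definition eta_Einstein ::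
    "nat \<Rightarrow> ('a, 'e::euclidean_space) atlas \<Rightarrow> ('a \<Rightarrow> 'a tvec \<Rightarrow> 'a tvec) \<Rightarrow>
     (nat \<Rightarrow> 'a vfield) \<Rightarrow> (nat \<Rightarrow> 'a \<Rightarrow> 'a tvec \<Rightarrow> real) \<Rightarrow>
     ('a \<Rightarrow> 'a tvec \<Rightarrow> 'a tvec \<Rightarrow> real) \<Rightarrow> bool"
  where "eta_Einstein s A \<phi> \<xi> \<eta> g \<longleftrightarrow>
    (\<exists>h k. smooth_fun A h \<and> smooth_fun A k \<and>
       (\<forall>X Y p. vector_field A X \<longrightarrow> vector_field A Y \<longrightarrow>
          ricci_at A g p (X p) (Y p) =
            h p * g p (\<phi> p (X p)) (\<phi> p (Y p)) +
            k p * eta_bar s \<xi> \<eta> g p (X p) * eta_bar s \<xi> \<eta> g p (Y p)))"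

end

theory Submission
  imports Defs
begin

text \<open>On an indefinite S-manifold normality and \<open>\<Phi> = d\<eta>\<^sup>\<alpha>\<close> make every \<open>\<xi>\<^sub>\<alpha>\<close> a Killing field with
  \<open>\<nabla>\<^sub>X \<xi>\<^sub>\<alpha> = - \<epsilon>\<^sub>\<alpha> \<phi> X\<close>, and together with \<open>d\<Phi> = 0\<close> they determine \<open>\<nabla>\<phi>\<close> algebraically. Hence the
  curvature components with an argument \<open>\<xi>\<^sub>\<alpha>\<close> are explicit, and the Ricci identity for \<open>\<phi>\<close> shows that
  on \<open>Im \<phi>\<close> the curvature tensor minus \<open>\<Sum>\<^sub>\<alpha> \<epsilon>\<^sub>\<alpha>\<close> times the tensor of constant curvature 1 has the
  symmetries of a Kaehler curvature tensor. Polarizing the constancy of its holomorphic sectional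
  curvature gives all its sectional curvatures, hence \<open>R(X,Y,X,Y)\<close> in closed form, and the trace over
  an orthonormal basis is of the required shape.

  Vector fields are global and tensors are treated as \<open>C\<^sup>\<infinity>\<close>-linear maps: local frames are replaced
  by global fields \<open>F\<^sub>b\<close>, \<open>G\<^sub>b\<close> and a function \<open>w\<close> that does not vanish at the given point, with
  \<open>w v = \<Sum> g(v, G\<^sub>b) F\<^sub>b\<close> everywhere. This yields pointwise dependence of tensors and the
  Levi-Civita connection from the Koszul formula.\<close>

subsection \<open>Functions of class \<open>C\<^sup>k\<close> and bump functions\<close>

text \<open>The objects in the claim are given by descriptions: the connection by
  \<open>SOME\<close>, curvature and Ricci tensor at a point by \<open>THE\<close>, tangent spaces
  as sets of derivations. So a connection has to be constructed, curvature shown independent of the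
  extensions and the trace independent of the basis. The tangent dimension is squeezed: cut-off
  coordinate fields give \<open>DIM('e)\<close> independent derivations at each point, and the image
  of \<phi> together with the framing spans with at most that many.

  Indefiniteness brings null vectors, which can be neither normalized nor divided by. Orthonormal
  bases therefore come from maximality, and the curvature hypothesis, which speaks of unit vectors
  only, reaches null vectors by continuity.

  The forms enter the result only through \<eta>-bar because all exterior derivatives of the
  \<eta>'s agree: normality and the derivative of \<phi> see the characteristic fields only through
  their sum \<open>xb\<close>. With \<open>E\<close> the sum of the signs, the Kaehler part has
  holomorphic sectional curvature c - E, whence the coefficient (c - E)/4 + E = (c + 3E)/4.\<close>

lemma Ck_on_cong:
  assumes "open S" "\<And>x. x \<in> S \<Longrightarrow> f x = g x" "Ck_on k f S"
  shows "Ck_on k g S"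
  using assms(2,3)
proof (induction k arbitrary: f g)
  case 0
  then show ?case using continuous_on_cong[of S S f g] by simp
next
  case (Suc k)
  have d: "(g has_derivative frechet_derivative f (at x)) (at x)" if x: "x \<in> S" for x
  proof -
    have "(f has_derivative frechet_derivative f (at x)) (at x)"
      using Suc.prems(2) x by (simp add: frechet_derivative_works)
    then show ?thesis
      using has_derivative_transform_within_open[OF _ assms(1) x] Suc.prems(1) by blast
  qed
  then have "Ck_on k (\<lambda>x. frechet_derivative g (at x) v) S" for v
    using Suc.IH[of "\<lambda>x. frechet_derivative f (at x) v" "\<lambda>x. frechet_derivative g (at x) v"] Suc.prems(2)
      frechet_derivative_at by fastforce
  then show ?case using d by (auto simp: differentiable_def)
qed

text \<open>Derivatives are unique, so an explicit derivative may stand for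
  \<open>frechet_derivative\<close>; the product, chain and reciprocal rules below enter through
  this.\<close>

lemma Ck_on_Suc_derivI:
  assumes "\<And>x. x \<in> S \<Longrightarrow> (f has_derivative f' x) (at x)" "\<And>v. Ck_on k (\<lambda>x. f' x v) S" "open S"
  shows "Ck_on (Suc k) f S"
proof -
  have "Ck_on k (\<lambda>x. frechet_derivative f (at x) v) S" for v
    using Ck_on_cong[OF assms(3) _ assms(2)[of v], of "\<lambda>x. frechet_derivative f (at x) v"]
      frechet_derivative_at[OF assms(1)] by metis
  then show ?thesis using assms(1) by (auto simp: differentiable_def)
qed

lemma Ck_on_subset: "Ck_on k f T \<Longrightarrow> S \<subseteq> T \<Longrightarrow> Ck_on k f S"
  by (induction k arbitrary: f) (auto intro: continuous_on_subset)

lemma Ck_on_locally: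
  assumes "\<And>x. x \<in> S \<Longrightarrow> \<exists>T. open T \<and> x \<in> T \<and> Ck_on k f T"
  shows "Ck_on k f S"
  using assms
proof (induction k arbitrary: f)
  case 0
  then show ?case
    by (metis Ck_on.simps(1) continuous_at_imp_continuous_on continuous_on_eq_continuous_at)
next
  case (Suc k)
  have "Ck_on k (\<lambda>x. frechet_derivative f (at x) v) S" for v
    by (rule Suc.IH) (use Suc.prems in fastforce)
  then show ?case using Suc.prems by fastforce
qed

lemma Ck_on_SucD: "Ck_on (Suc k) f S \<Longrightarrow> Ck_on k f S"
proof (induction k arbitrary: f)
  case 0
  then show ?case by (auto intro: continuous_at_imp_continuous_on differentiable_imp_continuous_within)
next
  case (Suc k)
  then show ?case by (metis Ck_on.simps(2))
qed

lemma Ck_on_has_derivative: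
  "Ck_on (Suc k) f S \<Longrightarrow> x \<in> S \<Longrightarrow> (f has_derivative frechet_derivative f (at x)) (at x)"
  unfolding Ck_on.simps by (blast intro: frechet_derivative_works[THEN iffD1])

lemma Ck_on_const: "open S \<Longrightarrow> Ck_on k (\<lambda>x. c) S"
  by (induction k arbitrary: c) (auto intro: Ck_on_Suc_derivI has_derivative_const)

lemma Ck_on_bounded_linear:
  assumes "bounded_linear h" "open S" "Ck_on k f S"
  shows "Ck_on k (\<lambda>x. h (f x)) S"
  using assms(3)
proof (induction k arbitrary: f)
  case 0
  then show ?case using bounded_linear.continuous_on[OF assms(1)] by simp
next
  case (Suc k)
  show ?case
    by (rule Ck_on_Suc_derivI[OF bounded_linear.has_derivative[OF assms(1) Ck_on_has_derivative[OF Suc.prems]]])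
       (use Suc assms in auto)
qed

lemma Ck_on_add:
  assumes "open S" "Ck_on k f S" "Ck_on k g S"
  shows "Ck_on k (\<lambda>x. f x + g x) S"
  using assms(2,3)
proof (induction k arbitrary: f g)
  case 0
  then show ?case by (auto intro: continuous_on_add)
next
  case (Suc k)
  show ?case
    by (rule Ck_on_Suc_derivI[OF has_derivative_add[OF Ck_on_has_derivative[OF Suc.prems(1)] Ck_on_has_derivative[OF Suc.prems(2)]]])
       (use Suc assms in auto)
qed

lemma Ck_on_bilinear:
  assumes "bounded_bilinear B" "open S" "Ck_on k f S" "Ck_on k g S"
  shows "Ck_on k (\<lambda>x. B (f x) (g x)) S"
  using assms(3,4)
proof (induction k arbitrary: f g)
  case 0
  then show ?case by (auto intro: bounded_bilinear.continuous_on[OF assms(1)])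
next
  case (Suc k)
  have "Ck_on k f S" "Ck_on k g S" using Suc.prems Ck_on_SucD by blast+
  then show ?case
    by (intro Ck_on_Suc_derivI[OF bounded_bilinear.FDERIV[OF assms(1) Ck_on_has_derivative[OF Suc.prems(1)] Ck_on_has_derivative[OF Suc.prems(2)]]])
       (use Suc assms in \<open>auto intro!: Ck_on_add[OF assms(2)]\<close>)
qed

lemma Ck_on_sum:
  assumes "open S" "\<And>i. i \<in> I \<Longrightarrow> Ck_on k (f i) S"
  shows "Ck_on k (\<lambda>x. \<Sum>i\<in>I. f i x) S"
  using assms(2)
  by (induction I rule: infinite_finite_induct) (auto intro: Ck_on_add Ck_on_const assms(1))

lemma Ck_on_compose:
  fixes f :: "'f::euclidean_space \<Rightarrow> 'b::real_normed_vector" and y :: "'e::euclidean_space \<Rightarrow> 'f"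
  assumes "open S" "open T" "y ` S \<subseteq> T" "Ck_on k f T" "Ck_on k y S"
  shows "Ck_on k (\<lambda>x. f (y x)) S"
  using assms(4,5)
proof (induction k arbitrary: f)
  case 0
  then show ?case using assms(3) by (auto intro: continuous_on_compose2)
next
  case (Suc k)
  \<comment> \<open>The direction \<open>frechet_derivative y (at x) v\<close> varies with
    \<open>x\<close>, while the induction hypothesis covers derivatives of \<open>f\<close> in fixed
    directions only; hence the expansion over \<open>Basis\<close>.\<close>
  let ?D = "\<lambda>x v. \<Sum>b\<in>Basis. (frechet_derivative y (at x) v \<bullet> b) *\<^sub>R frechet_derivative f (at (y x)) b"
  have y: "Ck_on k y S" using Suc.prems Ck_on_SucD by blast
  show ?case
  proof (rule Ck_on_Suc_derivI)
    fix x assume x: "x \<in> S"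
    let ?f' = "frechet_derivative f (at (y x))"
    have f': "(f has_derivative ?f') (at (y x))"
      using Ck_on_has_derivative[OF Suc.prems(1)] x assms(3) by blast
    have "((\<lambda>x. f (y x)) has_derivative (\<lambda>v. ?f' (frechet_derivative y (at x) v))) (at x)"
      by (rule has_derivative_compose[OF Ck_on_has_derivative[OF Suc.prems(2) x] f'])
    moreover have "?f' w = (\<Sum>b\<in>Basis. (w \<bullet> b) *\<^sub>R ?f' b)" for w
    proof -
      have "?f' (\<Sum>b\<in>Basis. (w \<bullet> b) *\<^sub>R b) = (\<Sum>b\<in>Basis. (w \<bullet> b) *\<^sub>R ?f' b)"
        using has_derivative_linear[OF f'] by (simp add: linear_sum linear_scale)
      then show ?thesis by (simp add: euclidean_representation)
    qed
    then have "(\<lambda>v. ?f' (frechet_derivative y (at x) v)) = ?D x" by (intro ext)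
    ultimately show "((\<lambda>x. f (y x)) has_derivative ?D x) (at x)" by metis
  next
    fix v
    show "Ck_on k (\<lambda>x. ?D x v) S"
      by (intro Ck_on_sum Ck_on_bilinear[OF bounded_bilinear_scaleR] assms(1)
          Ck_on_bounded_linear[OF bounded_linear_inner_left] Suc.IH[OF _ y])
         (use Suc.prems in auto)
  qed (use assms in auto)
qed

lemma Ck_on_inverse:
  fixes f :: "'e::euclidean_space \<Rightarrow> real"
  assumes "open S" "Ck_on k f S" "\<And>x. x \<in> S \<Longrightarrow> f x \<noteq> 0"
  shows "Ck_on k (\<lambda>x. inverse (f x)) S"
  using assms(2)
proof (induction k)
  case 0
  then show ?case using assms(3) by (auto intro: continuous_on_inverse)
next
  case (Suc k)
  let ?D = "\<lambda>x v. - (inverse (f x) * frechet_derivative f (at x) v * inverse (f x))"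
  have i: "Ck_on k (\<lambda>x. inverse (f x)) S" using Suc Ck_on_SucD by blast
  show ?case
  proof (rule Ck_on_Suc_derivI)
    show "((\<lambda>x. inverse (f x)) has_derivative ?D x) (at x)" if "x \<in> S" for x
      using Deriv.has_derivative_inverse[OF assms(3)[OF that] Ck_on_has_derivative[OF Suc.prems that]] .
    show "Ck_on k (\<lambda>x. ?D x v) S" for v
      by (intro Ck_on_bounded_linear[OF bounded_linear_minus[OF bounded_linear_ident]]
            Ck_on_bilinear[OF bounded_bilinear_mult] i assms(1)) (use Suc.prems in auto)
  qed (use assms in auto)
qed

lemma Ck_on_ident: "open S \<Longrightarrow> Ck_on k (\<lambda>x. x) S"
  by (cases k) (auto intro!: Ck_on_Suc_derivI[OF has_derivative_ident] Ck_on_const)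

text \<open>The family \<open>flat_exp m\<close> is closed under differentiation up to linear combinations, so that
  smoothness of every member follows by one induction on the order.\<close>

definition flat_exp :: "nat \<Rightarrow> real \<Rightarrow> real" where
  "flat_exp m t = (if t > 0 then exp (- inverse t) * inverse t ^ m else 0)"

lemma flat_exp_tendsto_0: "(flat_exp m \<longlongrightarrow> 0) (at 0)"
proof -
  have "((\<lambda>t. inverse t ^ m / exp (inverse t)) \<longlongrightarrow> 0) (at_right (0::real))"
    by (rule filterlim_compose[OF tendsto_power_div_exp_0 filterlim_inverse_at_top_right])
  then have "(flat_exp m \<longlongrightarrow> 0) (at_right 0)"
    by (rule Lim_transform_eventually)
       (auto simp: flat_exp_def eventually_at_right_less exp_minus field_simps
             intro!: eventually_mono[OF eventually_at_right_less])
  moreover have "(flat_exp m \<longlongrightarrow> 0) (at_left 0)"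
    by (rule Lim_transform_eventually[OF tendsto_const])
       (auto simp: flat_exp_def eventually_at_filter)
  ultimately show ?thesis by (simp add: filterlim_split_at)
qed

lemma flat_exp_DERIV:
  "(flat_exp m has_field_derivative flat_exp (m+2) t - real m * flat_exp (m+1) t) (at t)"
proof -
  consider "t > 0" | "t = 0" | "t < 0" by linarith
  then show ?thesis
  proof cases
    case 1
    have "((\<lambda>t. inverse t ^ m) has_field_derivative - (real m * inverse t ^ (m + 1))) (at t)"
      using DERIV_power[OF DERIV_inverse[of t UNIV], of m] 1 by (cases m) (auto simp: algebra_simps)
    moreover have "((\<lambda>t. exp (- inverse t)) has_field_derivative exp (- inverse t) * inverse t ^ 2) (at t)"
      using 1 by (auto intro!: derivative_eq_intros simp: power2_eq_square)
    ultimately have "((\<lambda>t. exp (- inverse t) * inverse t ^ m) has_field_derivative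
        exp (- inverse t) * inverse t ^ 2 * inverse t ^ m + - (real m * inverse t ^ (m + 1)) * exp (- inverse t)) (at t)"
      by (rule DERIV_mult[rotated])
    then have "((\<lambda>t. exp (- inverse t) * inverse t ^ m) has_field_derivative
        flat_exp (m+2) t - real m * flat_exp (m+1) t) (at t)"
      by (rule DERIV_cong) (simp add: 1 flat_exp_def power_add power2_eq_square)
    then show ?thesis
      by (rule has_field_derivative_transform_within_open[of _ _ _ "{0<..}"]) (use 1 in \<open>auto simp: flat_exp_def\<close>)
  next
    case 2
    \<comment> \<open>At 0 the difference quotient of \<open>flat_exp m\<close> is
      \<open>flat_exp (Suc m)\<close>, whose limit is already known.\<close>
    have "((\<lambda>h. (flat_exp m (0 + h) - flat_exp m 0) / h) \<longlongrightarrow> 0) (at 0)"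
      by (rule tendsto_cong[THEN iffD2, OF _ flat_exp_tendsto_0[of "Suc m"]])
         (auto simp: flat_exp_def eventually_at_filter field_simps)
    then show ?thesis using 2 by (simp add: DERIV_def flat_exp_def)
  next
    case 3
    have "((\<lambda>t. 0) has_field_derivative flat_exp (m+2) t - real m * flat_exp (m+1) t) (at t)"
      using 3 by (simp add: flat_exp_def)
    then show ?thesis
      by (rule has_field_derivative_transform_within_open[of _ _ _ "{..<0}"]) (use 3 in \<open>auto simp: flat_exp_def\<close>)
  qed
qed

lemma Ck_on_flat_exp: "Ck_on k (flat_exp m) UNIV"
proof (induction k arbitrary: m)
  case 0
  show ?case
    by (simp add: continuous_at_imp_continuous_on DERIV_isCont[OF flat_exp_DERIV])
next
  case (Suc k)
  show ?case
  proof (rule Ck_on_Suc_derivI)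
    show "(flat_exp m has_derivative (\<lambda>v. (flat_exp (m+2) t + (- real m) * flat_exp (m+1) t) * v)) (at t)" for t
      using flat_exp_DERIV[of m t] by (simp add: has_field_derivative_def)
    show "Ck_on k (\<lambda>t. (flat_exp (m+2) t + (- real m) * flat_exp (m+1) t) * v) UNIV" for v
      by (intro Ck_on_bilinear[OF bounded_bilinear_mult] Ck_on_add Ck_on_const Suc.IH open_UNIV)
  qed auto
qed

text \<open>The value 1 is asked for at the centre only, without a plateau: the bump will multiply
  either something of which only the value at \<open>z\<close> counts, or a function that vanishes
  at \<open>z\<close>.\<close>

lemma smooth_bump:
  fixes z :: "'e::euclidean_space"
  assumes "r > 0"
  shows "\<exists>b::'e \<Rightarrow> real. smooth_on b UNIV \<and> b z = 1 \<and> (\<forall>w. w \<notin> cball z r \<longrightarrow> b w = 0)"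
proof -
  define q where "q = (\<lambda>w. r\<^sup>2 + (-1) * ((w + - z) \<bullet> (w + -z)))"
  have q: "Ck_on k q UNIV" for k unfolding q_def
    by (intro Ck_on_add Ck_on_bilinear[OF bounded_bilinear_mult] Ck_on_bilinear[OF bounded_bilinear_inner]
        Ck_on_const Ck_on_ident open_UNIV)
  define b where "b = (\<lambda>w. flat_exp 0 (q w) * inverse (flat_exp 0 (q z)))"
  have "smooth_on b UNIV" unfolding b_def smooth_on_def
    by (intro allI Ck_on_bilinear[OF bounded_bilinear_mult] Ck_on_const open_UNIV
        Ck_on_compose[OF open_UNIV open_UNIV _ Ck_on_flat_exp q]) auto
  moreover have "b z = 1" using assms by (simp add: b_def q_def flat_exp_def)
  moreover have "b w = 0" if "w \<notin> cball z r" for w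
  proof -
    have "r < norm (w - z)" using that by (simp add: dist_norm norm_minus_commute)
    then have "r\<^sup>2 < (norm (w - z))\<^sup>2" using assms by (intro power_strict_mono) auto
    then show ?thesis by (simp add: b_def q_def flat_exp_def power2_norm_eq_inner)
  qed
  ultimately show ?thesis by blast
qed

section \<open>Smoothness, all orders at once\<close>

lemma smooth_on_cong: "open S \<Longrightarrow> (\<And>x. x \<in> S \<Longrightarrow> f x = g x) \<Longrightarrow> smooth_on f S \<Longrightarrow> smooth_on g S"
  unfolding smooth_on_def using Ck_on_cong by blast

lemma smooth_on_subset: "smooth_on f T \<Longrightarrow> S \<subseteq> T \<Longrightarrow> smooth_on f S"
  unfolding smooth_on_def using Ck_on_subset by blast

lemma smooth_on_locally:
  assumes "\<And>x. x \<in> S \<Longrightarrow> \<exists>T. open T \<and> x \<in> T \<and> smooth_on f T"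
  shows "smooth_on f S"
  unfolding smooth_on_def
proof
  show "Ck_on k f S" for k
    by (rule Ck_on_locally) (use assms in \<open>auto simp: smooth_on_def\<close>)
qed

lemma smooth_on_const: "open S \<Longrightarrow> smooth_on (\<lambda>x. c) S"
  by (simp add: smooth_on_def Ck_on_const)

lemma smooth_on_ident: "open S \<Longrightarrow> smooth_on (\<lambda>x. x) S"
  by (simp add: smooth_on_def Ck_on_ident)

lemma smooth_on_add: "open S \<Longrightarrow> smooth_on f S \<Longrightarrow> smooth_on g S \<Longrightarrow> smooth_on (\<lambda>x. f x + g x) S"
  by (simp add: smooth_on_def Ck_on_add)

lemma smooth_on_bounded_linear:
  "bounded_linear h \<Longrightarrow> open S \<Longrightarrow> smooth_on f S \<Longrightarrow> smooth_on (\<lambda>x. h (f x)) S"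
  by (simp add: smooth_on_def Ck_on_bounded_linear)

lemma smooth_on_mult:
  fixes f g :: "'e::euclidean_space \<Rightarrow> real"
  shows "open S \<Longrightarrow> smooth_on f S \<Longrightarrow> smooth_on g S \<Longrightarrow> smooth_on (\<lambda>x. f x * g x) S"
  by (simp add: smooth_on_def Ck_on_bilinear[OF bounded_bilinear_mult])

lemma smooth_on_compose:
  fixes f :: "'f::euclidean_space \<Rightarrow> 'b::real_normed_vector" and y :: "'e::euclidean_space \<Rightarrow> 'f"
  shows "open S \<Longrightarrow> open T \<Longrightarrow> y ` S \<subseteq> T \<Longrightarrow> smooth_on f T \<Longrightarrow> smooth_on y S \<Longrightarrow> smooth_on (\<lambda>x. f (y x)) S"
  by (simp add: smooth_on_def Ck_on_compose)

lemma smooth_on_inverse: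
  fixes f :: "'e::euclidean_space \<Rightarrow> real"
  shows "open S \<Longrightarrow> smooth_on f S \<Longrightarrow> (\<And>x. x \<in> S \<Longrightarrow> f x \<noteq> 0) \<Longrightarrow> smooth_on (\<lambda>x. inverse (f x)) S"
  by (simp add: smooth_on_def Ck_on_inverse)

lemma smooth_on_continuous_on: "smooth_on f S \<Longrightarrow> continuous_on S f"
proof -
  assume "smooth_on f S"
  then have "Ck_on 0 f S" unfolding smooth_on_def by blast
  then show ?thesis by simp
qed

lemma smooth_on_differentiable: "smooth_on f S \<Longrightarrow> x \<in> S \<Longrightarrow> f differentiable (at x)"
proof -
  assume "smooth_on f S" "x \<in> S"
  then have "Ck_on (Suc 0) f S" unfolding smooth_on_def by blast
  then show ?thesis using \<open>x \<in> S\<close> by simp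
qed

lemma smooth_on_frechet_derivative:
  "smooth_on f S \<Longrightarrow> smooth_on (\<lambda>x. frechet_derivative f (at x) v) S"
  unfolding smooth_on_def
proof
  fix k
  assume "\<forall>k. Ck_on k f S"
  then have "Ck_on (Suc k) f S" by blast
  then show "Ck_on k (\<lambda>x. frechet_derivative f (at x) v) S" by simp
qed

lemma sum_fun_apply: "(\<Sum>i\<in>I. f i) x = (\<Sum>i\<in>I. f i x)"
  by (induction I rule: infinite_finite_induct) auto

lemma scaleR_fun_apply [simp]: "(a *\<^sub>R f) x = a *\<^sub>R f x"
  by (simp add: scaleR_fun_def)

subsection \<open>Smooth functions and vector fields\<close>

locale smooth_manifold =
  fixes A :: "('a::{t2_space,second_countable_topology}, 'e::euclidean_space) atlas"
  assumes manifold: "connected_smooth_manifold A"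
begin

abbreviation SF where "SF \<equiv> smooth_fun A"
abbreviation VF where "VF \<equiv> vector_field A"
abbreviation T where "T \<equiv> tangent_space A"

lemma chart_open: "(U, x) \<in> A \<Longrightarrow> open U" "(U, x) \<in> A \<Longrightarrow> open (x ` U)"
  using manifold by (auto simp: connected_smooth_manifold_def)

lemma chart_homeomorphism: "(U, x) \<in> A \<Longrightarrow> homeomorphism U (x ` U) x (inv_into U x)"
  using manifold by (auto simp: connected_smooth_manifold_def)

lemma chart_inv [simp]: "(U, x) \<in> A \<Longrightarrow> q \<in> U \<Longrightarrow> inv_into U x (x q) = q"
  using chart_homeomorphism by (meson homeomorphism_apply1)

lemma chart_open_image:
  assumes "(U, x) \<in> A" "open W"
  shows "open (x ` (U \<inter> W))"
proof -
  have "openin (top_of_set (x ` U)) (x ` (U \<inter> W))"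
    by (rule homeomorphism_imp_open_map[OF chart_homeomorphism[OF assms(1)]]) (use assms(2) in auto)
  then show ?thesis using chart_open(2)[OF assms(1)] openin_open_eq by blast
qed

lemma ex_chart: "\<exists>U x. (U, x) \<in> A \<and> p \<in> U"
  using manifold by (force simp: connected_smooth_manifold_def)

lemma transition_smooth:
  "(U, x) \<in> A \<Longrightarrow> (V, y) \<in> A \<Longrightarrow> smooth_on (\<lambda>z. y (inv_into U x z)) (x ` (U \<inter> V))"
  using manifold by (fastforce simp: connected_smooth_manifold_def o_def)

lemma SF_chart: "SF f \<Longrightarrow> (U, x) \<in> A \<Longrightarrow> smooth_on (\<lambda>z. f (inv_into U x z)) (x ` U)"
  by (auto simp: smooth_fun_def o_def)

lemma SF_chartI: "(\<And>U x. (U, x) \<in> A \<Longrightarrow> smooth_on (\<lambda>z. f (inv_into U x z)) (x ` U)) \<Longrightarrow> SF f"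
  by (auto simp: smooth_fun_def o_def)

lemma SF_const [simp]: "SF (\<lambda>_. c)"
  using manifold by (fastforce simp: connected_smooth_manifold_def smooth_fun_def o_def intro: smooth_on_const)

lemma SF_add [simp]: "SF f \<Longrightarrow> SF g \<Longrightarrow> SF (\<lambda>q. f q + g q)"
  by (rule SF_chartI, rule smooth_on_add) (blast intro: SF_chart chart_open)+

lemma SF_mult [simp]: "SF f \<Longrightarrow> SF g \<Longrightarrow> SF (\<lambda>q. f q * g q)"
  by (rule SF_chartI, rule smooth_on_mult) (blast intro: SF_chart chart_open)+

lemma SF_minus [simp]: "SF f \<Longrightarrow> SF (\<lambda>q. - f q)"
  using SF_mult[OF SF_const[of "-1"]] by simp

lemma SF_diff [simp]: "SF f \<Longrightarrow> SF g \<Longrightarrow> SF (\<lambda>q. f q - g q)"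
  using SF_add[OF _ SF_minus, of f g] by simp

lemma SF_sum [simp]: "(\<And>i. i \<in> I \<Longrightarrow> SF (f i)) \<Longrightarrow> SF (\<lambda>q. \<Sum>i\<in>I. f i q)"
  by (induction I rule: infinite_finite_induct) auto

lemma SF_prod [simp]: "(\<And>i. i \<in> I \<Longrightarrow> SF (f i)) \<Longrightarrow> SF (\<lambda>q. \<Prod>i\<in>I. f i q)"
  by (induction I rule: infinite_finite_induct) auto

text \<open>Multiplying by a function that does not vanish at the point localizes the question, so that
  no partition of unity is needed below.\<close>

lemma SF_localI:
  assumes "\<And>p. \<exists>w. SF w \<and> w p \<noteq> 0 \<and> SF (\<lambda>q. w q * f q)"
  shows "SF f"
proof (rule SF_chartI, rule smooth_on_locally)
  fix U x z assume U: "(U, x) \<in> A" and z: "z \<in> x ` U"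
  let ?i = "inv_into U x"
  obtain w where w: "SF w" "w (?i z) \<noteq> 0" "SF (\<lambda>q. w q * f q)" using assms by blast
  define S where "S = x ` U \<inter> (\<lambda>z. w (?i z)) -` (- {0})"
  note w1 = SF_chart[OF w(1) U] and w3 = SF_chart[OF w(3) U]
  have "open (- {0::real})" by (intro open_Compl closed_singleton)
  then have S: "open S" unfolding S_def
    by (rule continuous_open_preimage[OF smooth_on_continuous_on[OF w1] chart_open(2)[OF U]])
  have S_nz: "w (?i z) \<noteq> 0" if "z \<in> S" for z
    using that unfolding S_def by simp
  have "smooth_on (\<lambda>z. inverse (w (?i z)) * (w (?i z) * f (?i z))) S"
    using smooth_on_mult[OF S smooth_on_inverse[OF S smooth_on_subset[OF w1] S_nz] smooth_on_subset[OF w3]]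
    by (simp add: S_def)
  then have "smooth_on (\<lambda>z. f (?i z)) S"
    by (rule smooth_on_cong[OF S, rotated]) (simp add: S_nz)
  then show "\<exists>S. open S \<and> z \<in> S \<and> smooth_on (\<lambda>z. f (?i z)) S"
    using S z w(2) by (intro exI[of _ S]) (simp add: S_def)
qed

text \<open>Two open sets cover the manifold: \<open>U\<close>, where the formula is smooth, and the
  complement of the image \<open>K\<close> of the ball, where the function is 0. \<open>K\<close> is
  compact, hence closed by the Hausdorff property.\<close>

lemma SF_chart_extension:
  assumes U: "(U, x) \<in> A" and b: "smooth_on b UNIV" "\<And>w. w \<notin> cball z r \<Longrightarrow> b w = 0"
    and r: "cball z r \<subseteq> x ` U" and u: "smooth_on u (x ` U)"
  shows "SF (\<lambda>q. if q \<in> U then b (x q) * u (x q) else 0)" (is "SF ?f")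
proof (rule SF_chartI, rule smooth_on_locally)
  fix V y w assume V: "(V, y) \<in> A" and w: "w \<in> y ` V"
  let ?j = "inv_into V y"
  define K where "K = inv_into U x ` cball z r"
  have "continuous_on (x ` U) (inv_into U x)"
    using chart_homeomorphism[OF U] by (auto simp: homeomorphism_def)
  then have "compact K" unfolding K_def
    by (intro compact_continuous_image continuous_on_subset[OF _ r]) auto
  then have K: "closed K" by (rule compact_imp_closed)
  show "\<exists>S. open S \<and> w \<in> S \<and> smooth_on (\<lambda>w. ?f (?j w)) S"
  proof (cases "?j w \<in> U")
    case True
    let ?S = "y ` (V \<inter> U)"
    have S: "open ?S" using chart_open_image[OF V] chart_open(1)[OF U] by blast
    have "smooth_on (\<lambda>w. b (x (?j w)) * u (x (?j w))) ?S"
      by (intro smooth_on_mult S smooth_on_compose[OF S _ _ b(1) transition_smooth[OF V U]]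
          smooth_on_compose[OF S _ _ u transition_smooth[OF V U]] chart_open[OF U]) (use V in auto)
    then have "smooth_on (\<lambda>w. ?f (?j w)) ?S"
      by (rule smooth_on_cong[OF S, rotated]) (use V in auto)
    then show ?thesis using S True w V by (intro exI[of _ ?S]) (auto simp: image_iff)
  next
    case False
    let ?S = "y ` (V \<inter> - K)"
    have S: "open ?S" using chart_open_image[OF V] K by blast
    have "?j w \<notin> K"
    proof
      assume "?j w \<in> K"
      then have "?j w \<in> U" using r by (auto simp: K_def inv_into_into)
      then show False using False by simp
    qed
    moreover have "smooth_on (\<lambda>w. ?f (?j w)) ?S"
    proof (rule smooth_on_cong[OF S _ smooth_on_const[OF S, of 0]])
      fix t assume "t \<in> ?S"
      then obtain q where q: "q \<in> V" "q \<notin> K" "t = y q" by auto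
      have "x q \<notin> cball z r" if "q \<in> U"
      proof
        assume "x q \<in> cball z r"
        then have "inv_into U x (x q) \<in> K" unfolding K_def by blast
        then show False using that q U by simp
      qed
      then show "0 = ?f (?j t)" using q V b(2) by auto
    qed
    ultimately show ?thesis using S w V by (intro exI[of _ ?S]) (auto simp: image_iff)
  qed
qed

section \<open>Tangent vectors as derivations, vector fields and their bracket\<close>

lemma tangent_add: "v \<in> T p \<Longrightarrow> SF f \<Longrightarrow> SF g \<Longrightarrow> v (\<lambda>q. f q + g q) = v f + v g"
  and tangent_mult: "v \<in> T p \<Longrightarrow> SF f \<Longrightarrow> SF g \<Longrightarrow> v (\<lambda>q. f q * g q) = v f * g p + f p * v g"
  and tangent_scale: "v \<in> T p \<Longrightarrow> SF f \<Longrightarrow> v (\<lambda>q. a * f q) = a * v f"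
  and tangent_nonsmooth: "v \<in> T p \<Longrightarrow> \<not> SF f \<Longrightarrow> v f = 0"
  unfolding tangent_space_def mem_Collect_eq by blast+

lemma tangentI:
  assumes "\<And>f g. SF f \<Longrightarrow> SF g \<Longrightarrow> v (\<lambda>q. f q + g q) = v f + v g"
    "\<And>f g. SF f \<Longrightarrow> SF g \<Longrightarrow> v (\<lambda>q. f q * g q) = v f * g p + f p * v g"
    "\<And>a f. SF f \<Longrightarrow> v (\<lambda>q. a * f q) = a * v f" "\<And>f. \<not> SF f \<Longrightarrow> v f = 0"
  shows "v \<in> T p"
  unfolding tangent_space_def mem_Collect_eq using assms by blast

lemma tangent_const: "v \<in> T p \<Longrightarrow> v (\<lambda>q. a) = 0"
  using tangent_mult[of v p "\<lambda>_. 1" "\<lambda>_. 1"] tangent_scale[of v p "\<lambda>_. 1" a] by simp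

lemma tangent_minus: "v \<in> T p \<Longrightarrow> SF f \<Longrightarrow> v (\<lambda>q. - f q) = - v f"
  using tangent_scale[of v p f "-1"] by simp

lemma tangent_diff: "v \<in> T p \<Longrightarrow> SF f \<Longrightarrow> SF g \<Longrightarrow> v (\<lambda>q. f q - g q) = v f - v g"
  using tangent_add[of v p f "\<lambda>q. - g q"] tangent_minus[of v p g] by simp

lemma subspace_tangent: "subspace (T p)"
  unfolding subspace_def
  by (auto intro!: tangentI simp: tangent_add tangent_mult tangent_scale tangent_nonsmooth algebra_simps)

lemma tangent_space_closed [simp]:
  "0 \<in> T p" "v \<in> T p \<Longrightarrow> w \<in> T p \<Longrightarrow> v + w \<in> T p" "v \<in> T p \<Longrightarrow> a *\<^sub>R v \<in> T p"
  "v \<in> T p \<Longrightarrow> w \<in> T p \<Longrightarrow> v - w \<in> T p" "v \<in> T p \<Longrightarrow> - v \<in> T p"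
  "(\<And>i. i \<in> I \<Longrightarrow> h i \<in> T p) \<Longrightarrow> (\<Sum>i\<in>I. h i) \<in> T p"
  using subspace_tangent
  by (auto simp: subspace_0 subspace_add subspace_scale subspace_diff subspace_neg subspace_sum)

lemma VF_tangent [simp]: "VF X \<Longrightarrow> X p \<in> T p"
  by (simp add: vector_field_def)

lemma VF_smooth [simp]: "VF X \<Longrightarrow> SF f \<Longrightarrow> SF (\<lambda>p. X p f)"
  by (simp add: vector_field_def)

lemma VF_I: "(\<And>p. X p \<in> T p) \<Longrightarrow> (\<And>f. SF f \<Longrightarrow> SF (\<lambda>p. X p f)) \<Longrightarrow> VF X"
  unfolding vector_field_def by blast

lemma VF_add' [simp]: "VF X \<Longrightarrow> VF Y \<Longrightarrow> VF (\<lambda>p. X p + Y p)"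
  by (rule VF_I) (simp_all only: tangent_space_closed VF_tangent plus_fun_apply SF_add VF_smooth)

lemma VF_scale [simp]: "SF f \<Longrightarrow> VF X \<Longrightarrow> VF (\<lambda>p. f p *\<^sub>R X p)"
  by (rule VF_I) (simp_all only: tangent_space_closed VF_tangent scaleR_fun_apply real_scaleR_def SF_mult VF_smooth)

lemma VF_zero' [simp]: "VF (\<lambda>p. 0)"
  by (rule VF_I) (simp_all only: tangent_space_closed zero_fun_apply SF_const)

lemma VF_sum [simp]: "(\<And>i. i \<in> I \<Longrightarrow> VF (X i)) \<Longrightarrow> VF (\<lambda>p. \<Sum>i\<in>I. X i p)"
  by (rule VF_I) (simp_all only: tangent_space_closed VF_tangent sum_fun_apply SF_sum VF_smooth)

lemma VF_minus' [simp]: "VF X \<Longrightarrow> VF (\<lambda>p. - X p)"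
  using VF_scale[OF SF_const, of X "-1"] by simp

lemma VF_diff' [simp]: "VF X \<Longrightarrow> VF Y \<Longrightarrow> VF (\<lambda>p. X p - Y p)"
  using VF_add'[OF _ VF_minus'] by simp

lemma VF_zero [simp]: "VF 0"
  using VF_zero' by (simp only: zero_fun_def)

lemma VF_add [simp]: "VF X \<Longrightarrow> VF Y \<Longrightarrow> VF (X + Y)"
  unfolding func_plus[of X Y] by (rule VF_add')

lemma VF_minus [simp]: "VF X \<Longrightarrow> VF (- X)"
  unfolding fun_Compl_def[of X] by (rule VF_minus')

lemma VF_diff [simp]: "VF X \<Longrightarrow> VF Y \<Longrightarrow> VF (X - Y)"
  unfolding fun_diff_def[of X Y] by (rule VF_diff')

lemma VF_lie_bracket [simp]:
  assumes "VF X" "VF Y"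
  shows "VF (lie_bracket X Y)"
proof (rule VF_I)
  fix p
  note X = VF_tangent[OF assms(1)] and Y = VF_tangent[OF assms(2)]
  have s: "SF (\<lambda>q. X q f)" "SF (\<lambda>q. Y q f)" if "SF f" for f
    using that assms by (blast intro: VF_smooth)+
  show "lie_bracket X Y p \<in> T p"
  proof (rule tangentI)
    \<comment> \<open>On a nonsmooth \<open>f\<close> both inner functions are constantly 0, and
      derivations kill constants, so the bracket respects the convention for nonsmooth
      arguments.\<close>
    fix f assume f: "\<not> SF f"
    have "X q f = 0" "Y q f = 0" for q
      using f assms by (blast intro: tangent_nonsmooth VF_tangent)+
    then show "lie_bracket X Y p f = 0"
      by (simp only: lie_bracket_def tangent_const[OF X] tangent_const[OF Y])
  next
    fix f g assume fg: "SF f" "SF g"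
    note sf = s[OF fg(1)] and sg = s[OF fg(2)]
    show "lie_bracket X Y p (\<lambda>q. f q + g q) = lie_bracket X Y p f + lie_bracket X Y p g"
      by (simp only: lie_bracket_def tangent_add[OF X fg] tangent_add[OF Y fg] tangent_add[OF X sf(2) sg(2)]
          tangent_add[OF Y sf(1) sg(1)] add_diff_add)
    show "lie_bracket X Y p (\<lambda>q. f q * g q) = lie_bracket X Y p f * g p + f p * lie_bracket X Y p g"
      by (simp only: lie_bracket_def tangent_mult[OF X fg] tangent_mult[OF Y fg] SF_mult fg sf sg
          tangent_add[OF X SF_mult[OF sf(2) fg(2)] SF_mult[OF fg(1) sg(2)]]
          tangent_add[OF Y SF_mult[OF sf(1) fg(2)] SF_mult[OF fg(1) sg(1)]]
          tangent_mult[OF X sf(2) fg(2)] tangent_mult[OF Y sf(1) fg(2)]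
          tangent_mult[OF X fg(1) sg(2)] tangent_mult[OF Y fg(1) sg(1)]) algebra
  next
    fix a f assume f: "SF f"
    show "lie_bracket X Y p (\<lambda>q. a * f q) = a * lie_bracket X Y p f"
      by (simp only: lie_bracket_def tangent_scale[OF X f] tangent_scale[OF Y f]
          tangent_scale[OF X s(2)[OF f]] tangent_scale[OF Y s(1)[OF f]] right_diff_distrib)
  qed
next
  fix f assume "SF f"
  then show "SF (\<lambda>p. lie_bracket X Y p f)"
    unfolding lie_bracket_def
    using SF_diff[OF VF_smooth[OF assms(1) VF_smooth[OF assms(2)]] VF_smooth[OF assms(2) VF_smooth[OF assms(1)]]]
    by blast
qed

text \<open>The coordinate fields cut off by a bump function are already independent at the centre.\<close>

lemma ex_independent_fields:
  "\<exists>B. finite B \<and> card B = DIM('e) \<and> independent B \<and> (\<forall>v\<in>B. \<exists>X. VF X \<and> X p = v)"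
proof -
  obtain U x where U: "(U, x) \<in> A" "p \<in> U" using ex_chart[of p] by blast
  obtain r where r: "r > 0" "cball (x p) r \<subseteq> x ` U"
    using open_contains_cball[of "x ` U"] chart_open(2)[OF U(1)] U(2) by blast
  obtain b :: "'e \<Rightarrow> real" where b: "smooth_on b UNIV" "b (x p) = 1" "\<And>w. w \<notin> cball (x p) r \<Longrightarrow> b w = 0"
    using smooth_bump[OF r(1), of "x p"] by blast
  let ?i = "inv_into U x"
  let ?d = "\<lambda>f w v. frechet_derivative (\<lambda>z. f (?i z)) (at w) v"
  \<comment> \<open>The bump makes the coordinate field global; the test \<open>SF f\<close> keeps
    the convention that tangent vectors vanish on nonsmooth functions.\<close>
  define E where "E = (\<lambda>v q f. if q \<in> U \<and> SF f then b (x q) * ?d f (x q) v else 0)"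
  \<comment> \<open>The coordinates are shifted to vanish at \<open>p\<close>, so that the
    derivative of \<open>b\<close> contributes nothing there and \<open>E v p (h i)\<close> is
    \<open>v \<bullet> i\<close>.\<close>
  define h where "h = (\<lambda>i q. if q \<in> U then b (x q) * ((x q - x p) \<bullet> i) else 0)"
  have D: "((\<lambda>z. f (?i z)) has_derivative ?d f (x q)) (at (x q))" if "SF f" "q \<in> U" for f q
    using frechet_derivative_works[THEN iffD1, OF smooth_on_differentiable[OF SF_chart[OF that(1) U(1)] imageI[OF that(2)]]] .
  have E: "VF (E v)" for v
  proof (rule VF_I)
    fix q
    show "E v q \<in> T q"
    proof (cases "q \<in> U")
      case True
      note D' = D[OF _ True]
      show ?thesis
      proof (rule tangentI)
        fix f g assume f: "SF f" and g: "SF g"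
        show "E v q (\<lambda>q. f q + g q) = E v q f + E v q g"
          using fun_cong[OF frechet_derivative_at[OF has_derivative_add[OF D'[OF f] D'[OF g]], symmetric], of v] f g True
          by (simp add: E_def distrib_left)
        show "E v q (\<lambda>q. f q * g q) = E v q f * g q + f q * E v q g"
          using fun_cong[OF frechet_derivative_at[OF has_derivative_mult[OF D'[OF f] D'[OF g]], symmetric], of v] f g True U(1)
          by (simp add: E_def distrib_left)
      next
        fix a f assume f: "SF f"
        then show "E v q (\<lambda>q. a * f q) = a * E v q f"
          using fun_cong[OF frechet_derivative_at[OF has_derivative_mult_right[OF D'[OF f], of a], symmetric], of v] True
          by (simp add: E_def)
      qed (simp add: E_def)
    next
      case False
      then have "E v q = 0" by (auto simp: E_def)
      then show ?thesis by simp
    qed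
  next
    fix f assume "SF f"
    then show "SF (\<lambda>q. E v q f)"
      using SF_chart_extension[OF U(1) b(1,3) r(2) smooth_on_frechet_derivative[OF SF_chart[OF _ U(1)]], of f v]
      by (simp add: E_def)
  qed
  have h: "SF (h i)" for i
    unfolding h_def
  proof (rule SF_chart_extension[OF U(1) b(1,3) r(2)])
    have "smooth_on (\<lambda>w. (w + - x p) \<bullet> i) (x ` U)"
      by (intro smooth_on_bounded_linear[OF bounded_linear_inner_left] smooth_on_add smooth_on_ident
          smooth_on_const chart_open[OF U(1)])
    then show "smooth_on (\<lambda>w. (w - x p) \<bullet> i) (x ` U)" by simp
  qed
  have Eh: "E v p (h i) = v \<bullet> i" for v i
  proof -
    have "b differentiable (at (x p))" using smooth_on_differentiable[OF b(1)] by simp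
    then obtain b' where b': "(b has_derivative b') (at (x p))" by (auto simp: differentiable_def)
    have "((\<lambda>w. b w * ((w - x p) \<bullet> i)) has_derivative (\<lambda>v. v \<bullet> i)) (at (x p))"
      by (rule has_derivative_eq_rhs[OF has_derivative_mult[OF b'], of _ "\<lambda>v. v \<bullet> i"])
         (auto intro!: derivative_eq_intros simp: b(2))
    then have "((\<lambda>z. h i (?i z)) has_derivative (\<lambda>v. v \<bullet> i)) (at (x p))"
      by (rule has_derivative_transform_within_open[OF _ chart_open(2)[OF U(1)]])
         (use U in \<open>auto simp: h_def\<close>)
    then show ?thesis
      using frechet_derivative_at[symmetric] U h b(2) by (fastforce simp: E_def)
  qed
  have inj: "inj_on (\<lambda>i. E i p) Basis"
  proof
    fix i j :: 'e assume ij: "i \<in> Basis" "j \<in> Basis" "E i p = E j p"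
    then have "i \<bullet> j = j \<bullet> j" using Eh by metis
    then show "i = j" using ij by (simp add: inner_Basis split: if_splits)
  qed
  let ?B = "(\<lambda>i. E i p) ` Basis"
  have "independent ?B"
  proof -
    have "u v = 0" if u: "(\<Sum>v\<in>?B. u v *\<^sub>R v) = 0" and v: "v \<in> ?B" for u v
    proof -
      obtain j where j: "j \<in> Basis" "v = E j p" using v by blast
      have "0 = (\<Sum>i\<in>Basis. u (E i p) *\<^sub>R E i p) (h j)"
        using u by (simp add: sum.reindex[OF inj] o_def)
      also have "\<dots> = (\<Sum>i\<in>Basis. u (E i p) * (i \<bullet> j))"
        by (simp add: sum_fun_apply Eh)
      also have "\<dots> = (\<Sum>i\<in>Basis. if i = j then u (E i p) else 0)"
        by (rule sum.cong) (use j in \<open>auto simp: inner_Basis\<close>)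
      also have "\<dots> = u v" using j by simp
      finally show ?thesis by simp
    qed
    then show ?thesis by (auto simp: dependent_finite)
  qed
  then show ?thesis using E inj by (intro exI[of _ ?B]) (auto simp: card_image)
qed

end

subsection \<open>Nondegenerate symmetric forms\<close>

text \<open>The carrier is a set because tangent spaces are subspaces of a much larger function
  type. Dimension enters as a bound on a spanning set that need not lie in \<open>T\<close>;
  \<open>N\<close> independent vectors of \<open>T\<close> then span it.\<close>

locale nondegenerate_form =
  fixes T :: "'v::real_vector set" and g :: "'v \<Rightarrow> 'v \<Rightarrow> real" and N :: nat
  assumes subspace_T: "subspace T"
    and form_add: "\<And>u v w. u \<in> T \<Longrightarrow> v \<in> T \<Longrightarrow> w \<in> T \<Longrightarrow> g u (v + w) = g u v + g u w"
    and form_scale: "\<And>u v a. u \<in> T \<Longrightarrow> v \<in> T \<Longrightarrow> g u (a *\<^sub>R v) = a * g u v"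
    and form_sym: "\<And>u v. u \<in> T \<Longrightarrow> v \<in> T \<Longrightarrow> g u v = g v u"
    and nondeg: "\<And>u. u \<in> T \<Longrightarrow> (\<And>v. v \<in> T \<Longrightarrow> g u v = 0) \<Longrightarrow> u = 0"
    and fin: "\<exists>C. finite C \<and> card C \<le> N \<and> T \<subseteq> span C"
begin

lemma T_closed:
  "0 \<in> T" "u \<in> T \<Longrightarrow> v \<in> T \<Longrightarrow> u + v \<in> T" "u \<in> T \<Longrightarrow> a *\<^sub>R u \<in> T"
  "u \<in> T \<Longrightarrow> v \<in> T \<Longrightarrow> u - v \<in> T" "u \<in> T \<Longrightarrow> - u \<in> T"
  "(\<And>i. i \<in> I \<Longrightarrow> h i \<in> T) \<Longrightarrow> (\<Sum>i\<in>I. h i) \<in> T"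
  using subspace_T
  by (auto simp: subspace_0 subspace_add subspace_scale subspace_diff subspace_neg subspace_sum)

lemma form_add_left: "u \<in> T \<Longrightarrow> v \<in> T \<Longrightarrow> w \<in> T \<Longrightarrow> g (u + v) w = g u w + g v w"
  using form_add[of w u v] form_sym T_closed by simp

lemma form_scale_left: "u \<in> T \<Longrightarrow> v \<in> T \<Longrightarrow> g (a *\<^sub>R u) v = a * g u v"
  using form_scale[of v u a] form_sym T_closed by simp

lemma form_zero: "u \<in> T \<Longrightarrow> g u 0 = 0" "u \<in> T \<Longrightarrow> g 0 u = 0"
  using form_scale[of u u 0] form_scale_left[of u u 0] by simp_all

lemma form_minus: "u \<in> T \<Longrightarrow> v \<in> T \<Longrightarrow> g u (- v) = - g u v" "u \<in> T \<Longrightarrow> v \<in> T \<Longrightarrow> g (- u) v = - g u v"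
  using form_scale[of u v "-1"] form_scale_left[of u v "-1"] by simp_all

lemma form_diff:
  "u \<in> T \<Longrightarrow> v \<in> T \<Longrightarrow> w \<in> T \<Longrightarrow> g u (v - w) = g u v - g u w"
  "u \<in> T \<Longrightarrow> v \<in> T \<Longrightarrow> w \<in> T \<Longrightarrow> g (v - w) u = g v u - g w u"
  using form_add[of u v "- w"] form_add_left[of v "- w" u] form_minus T_closed by simp_all

lemma form_sum: "u \<in> T \<Longrightarrow> (\<And>i. i \<in> I \<Longrightarrow> h i \<in> T) \<Longrightarrow> g u (\<Sum>i\<in>I. h i) = (\<Sum>i\<in>I. g u (h i))"
  by (induction I rule: infinite_finite_induct) (simp_all add: form_zero form_add T_closed)

lemma form_sum_left: "u \<in> T \<Longrightarrow> (\<And>i. i \<in> I \<Longrightarrow> h i \<in> T) \<Longrightarrow> g (\<Sum>i\<in>I. h i) u = (\<Sum>i\<in>I. g (h i) u)"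
  by (induction I rule: infinite_finite_induct) (simp_all add: form_zero form_add_left T_closed)

lemma form_ext: "u \<in> T \<Longrightarrow> v \<in> T \<Longrightarrow> (\<And>w. w \<in> T \<Longrightarrow> g u w = g v w) \<Longrightarrow> u = v"
  using nondeg[of "u - v"] T_closed by (simp add: form_diff)

text \<open>In an indefinite space orthogonality alone does not give independence: a null vector is
  orthogonal to its own multiples. Hence the condition on \<open>g b b\<close>.\<close>

definition orthogonal_set :: "'v set \<Rightarrow> bool" where
  "orthogonal_set B \<longleftrightarrow> B \<subseteq> T \<and> (\<forall>b\<in>B. g b b \<noteq> 0) \<and> (\<forall>b\<in>B. \<forall>c\<in>B. b \<noteq> c \<longrightarrow> g b c = 0)"

lemma orthogonal_coefficient:
  assumes B: "orthogonal_set B" "finite S" "S \<subseteq> B" "b \<in> B"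
  shows "g (\<Sum>v\<in>S. u v *\<^sub>R v) b = (if b \<in> S then u b * g b b else 0)"
proof -
  have "g (\<Sum>v\<in>S. u v *\<^sub>R v) b = (\<Sum>v\<in>S. u v * g v b)"
    using B by (subst form_sum_left) (auto simp: orthogonal_set_def form_scale_left subset_iff T_closed intro!: sum.cong)
  also have "\<dots> = (\<Sum>v\<in>S. if v = b then u b * g b b else 0)"
    using B by (intro sum.cong) (auto simp: orthogonal_set_def subset_iff)
  finally show ?thesis using B by simp
qed

lemma orthogonal_independent:
  assumes "orthogonal_set B"
  shows "independent B"
proof -
  have "u v = 0" if S: "finite S" "S \<subseteq> B" "(\<Sum>v\<in>S. u v *\<^sub>R v) = 0" "v \<in> S" for S u v
  proof -
    have v: "v \<in> B" using S by blast
    have "g (\<Sum>v\<in>S. u v *\<^sub>R v) v = 0" using S(3) assms v by (auto simp: orthogonal_set_def form_zero)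
    then show ?thesis
      using orthogonal_coefficient[OF assms S(1,2) v, of u] S(4) assms v by (simp add: orthogonal_set_def)
  qed
  then show ?thesis unfolding dependent_explicit by blast
qed

lemma independent_card_le: "independent S \<Longrightarrow> S \<subseteq> T \<Longrightarrow> finite S \<and> card S \<le> N"
  using fin independent_span_bound by (meson order_trans)

lemma independent_spans:
  assumes "independent S" "S \<subseteq> T" "card S = N"
  shows "T \<subseteq> span S"
proof
  fix v assume v: "v \<in> T"
  show "v \<in> span S"
  proof (rule ccontr)
    assume "v \<notin> span S"
    then have "independent (insert v S)" "v \<notin> S"
      using assms(1) independent_insertI span_base by blast+
    then show False
      using independent_card_le[of "insert v S"] independent_card_le[OF assms(1,2)] v assms by simp
  qed
qed

text \<open>The remainder lies in the span of \<open>B\<close> and is orthogonal to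
  \<open>B\<close>, so its coefficients vanish.\<close>

lemma orthogonal_expansion:
  assumes B: "orthogonal_set B" "finite B" "T \<subseteq> span B" and v: "v \<in> T"
  shows "v = (\<Sum>b\<in>B. (g v b / g b b) *\<^sub>R b)"
proof -
  let ?w = "\<Sum>b\<in>B. (g v b / g b b) *\<^sub>R b"
  have T: "B \<subseteq> T" using B by (simp add: orthogonal_set_def)
  have w: "?w \<in> T" using T by (intro T_closed) auto
  obtain u where u: "v - ?w = (\<Sum>b\<in>B. u b *\<^sub>R b)"
    using T_closed(4)[OF v w] B(2,3) by (auto simp: span_finite)
  have "u b = 0" if b: "b \<in> B" for b
  proof -
    have "g (v - ?w) b = 0"
      using orthogonal_coefficient[OF B(1,2) order_refl b, of "\<lambda>b. g v b / g b b"] b B(1) T v w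
      by (auto simp: form_diff orthogonal_set_def subset_iff)
    then show ?thesis
      using orthogonal_coefficient[OF B(1,2) order_refl b, of u] b B(1) unfolding u
      by (simp add: orthogonal_set_def)
  qed
  then show ?thesis using u by simp
qed

definition orthonormal_set :: "'v set \<Rightarrow> bool" where
  "orthonormal_set B \<longleftrightarrow> B \<subseteq> T \<and> (\<forall>b\<in>B. g b b \<in> {1, -1}) \<and> (\<forall>b\<in>B. \<forall>c\<in>B. b \<noteq> c \<longrightarrow> g b c = 0)"

lemma orthonormal_imp_orthogonal: "orthonormal_set B \<Longrightarrow> orthogonal_set B"
  by (auto simp: orthonormal_set_def orthogonal_set_def)

text \<open>Take an orthonormal set of maximal size. A vector orthogonal to it must be null, since
  otherwise it could be normalized and added. By polarization the form then vanishes on the whole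
  orthogonal complement, and as \<open>?P\<close> maps into that complement, nondegeneracy forces
  \<open>?P v = 0\<close>.\<close>

lemma ex_orthonormal_basis: "\<exists>B. finite B \<and> orthonormal_set B \<and> T \<subseteq> span B"
proof -
  have bound: "finite B \<and> card B \<le> N" if "orthonormal_set B" for B
    using independent_card_le[OF orthogonal_independent] that orthonormal_imp_orthogonal
    by (auto simp: orthonormal_set_def)
  have "orthonormal_set {}" by (simp add: orthonormal_set_def)
  then obtain B where B: "orthonormal_set B" and max: "\<And>B'. orthonormal_set B' \<Longrightarrow> card B' \<le> card B"
    using ex_has_greatest_nat[of orthonormal_set "{}" card "Suc N"] bound by (meson less_Suc_eq_le)
  have fB: "finite B" and T: "B \<subseteq> T" and n: "\<And>b. b \<in> B \<Longrightarrow> g b b \<in> {1,-1}"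
    using bound B by (auto simp: orthonormal_set_def)
  let ?P = "\<lambda>v. v - (\<Sum>b\<in>B. (g v b / g b b) *\<^sub>R b)"
  have PT: "?P v \<in> T" if "v \<in> T" for v using that T by (intro T_closed) auto
  have P: "g (?P v) b = 0" if v: "v \<in> T" and b: "b \<in> B" for v b
  proof -
    have "(\<Sum>b\<in>B. (g v b / g b b) *\<^sub>R b) \<in> T" using T by (intro T_closed) auto
    then show ?thesis
      using orthogonal_coefficient[OF orthonormal_imp_orthogonal[OF B] fB order_refl b, of "\<lambda>b. g v b / g b b"] b n[OF b] T v
      by (auto simp: form_diff subset_iff)
  qed
  have null: "g u u = 0" if u: "u \<in> T" "\<And>b. b \<in> B \<Longrightarrow> g u b = 0" for u
  proof (rule ccontr)
    assume nz: "g u u \<noteq> 0"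
    define c where "c = inverse (sqrt \<bar>g u u\<bar>)"
    have "(c * c) * \<bar>g u u\<bar> = 1"
      using nz real_sqrt_mult_self[of "\<bar>g u u\<bar>"] by (simp add: c_def field_simps)
    then have "c * c * g u u \<in> {1, -1}" by (cases "g u u > 0") auto
    moreover have c: "c *\<^sub>R u \<in> T" using u(1) by (rule T_closed)
    moreover have "g (c *\<^sub>R u) (c *\<^sub>R u) = c * c * g u u"
      using u(1) c by (simp add: form_scale form_scale_left)
    moreover have "g (c *\<^sub>R u) b = 0" "g b (c *\<^sub>R u) = 0" if "b \<in> B" for b
      using that u T form_sym[of b u] by (auto simp: form_scale form_scale_left subset_iff)
    ultimately have "orthonormal_set (insert (c *\<^sub>R u) B)"
      using B by (auto simp: orthonormal_set_def)
    moreover have "c *\<^sub>R u \<notin> B"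
      using \<open>\<And>b. b \<in> B \<Longrightarrow> g (c *\<^sub>R u) b = 0\<close> n by fastforce
    ultimately show False using max[of "insert (c *\<^sub>R u) B"] fB by simp
  qed
  have "v \<in> span B" if v: "v \<in> T" for v
  proof -
    have "g (?P v) w = 0" if w: "w \<in> T" for w
    proof -
      have Pv: "?P v \<in> T" and Pw: "?P w \<in> T" using PT v w by blast+
      have orth: "g (?P v) b = 0" "g (?P w) b = 0" if "b \<in> B" for b using P v w that by blast+
      have "g (?P v + ?P w) (?P v + ?P w) = 0"
        by (rule null) (use Pv Pw orth T in \<open>auto simp: T_closed form_add_left subset_iff\<close>)
      then have "2 * g (?P v) (?P w) = 0"
        using null[OF Pv orth(1)] null[OF Pw orth(2)] Pv Pw form_sym[OF Pw Pv]
        by (simp add: form_add form_add_left T_closed)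
      moreover have "g (?P v) (\<Sum>b\<in>B. (g w b / g b b) *\<^sub>R b) = 0"
        using orth(1) Pv T by (subst form_sum) (auto simp: form_scale subset_iff T_closed)
      ultimately show ?thesis
        using form_add[OF Pv Pw, of "\<Sum>b\<in>B. (g w b / g b b) *\<^sub>R b"] T
        by (auto simp: T_closed subset_iff)
    qed
    then have "?P v = 0" using nondeg PT v by blast
    then have "v = (\<Sum>b\<in>B. (g v b / g b b) *\<^sub>R b)" by simp
    then show ?thesis by (metis (no_types, lifting) span_sum span_scale span_base)
  qed
  then show ?thesis using fB B by blast
qed

lemma parseval:
  assumes B: "finite B" "orthonormal_set B" "T \<subseteq> span B" and uv: "u \<in> T" "v \<in> T"
  shows "(\<Sum>b\<in>B. g b b * (g u b * g v b)) = g u v"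
proof -
  have T: "B \<subseteq> T" and n: "\<And>b. b \<in> B \<Longrightarrow> g b b \<in> {1,-1}" using B by (auto simp: orthonormal_set_def)
  have "g u v = g u (\<Sum>b\<in>B. (g v b / g b b) *\<^sub>R b)"
    using orthogonal_expansion[OF orthonormal_imp_orthogonal B(1,3) uv(2)] B(2) by simp
  also have "\<dots> = (\<Sum>b\<in>B. g v b / g b b * g u b)"
    using T uv by (subst form_sum) (auto simp: form_scale subset_iff T_closed intro!: sum.cong)
  also have "\<dots> = (\<Sum>b\<in>B. g b b * (g u b * g v b))"
    by (rule sum.cong) (use n in force)+
  finally show ?thesis by simp
qed

end

text \<open>The bound on the dimension of the tangent spaces follows in general from Hadamard's lemma; it
  is an assumption here because for the manifolds of interest the framing provides it.\<close>

locale semi_riemannian = smooth_manifold A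
  for A :: "('a::{t2_space,second_countable_topology}, 'e::euclidean_space) atlas" +
  fixes g :: "'a \<Rightarrow> 'a tvec \<Rightarrow> 'a tvec \<Rightarrow> real"
  assumes metric: "semi_riemannian_metric A g"
    and tangent_dim: "\<And>p. \<exists>C. finite C \<and> card C \<le> DIM('e) \<and> tangent_space A p \<subseteq> span C"
begin

sublocale nondegenerate_form "T p" "g p" "DIM('e)" for p
proof
  show "subspace (T p)" by (rule subspace_tangent)
  show "\<exists>C. finite C \<and> card C \<le> DIM('e) \<and> T p \<subseteq> span C" by (rule tangent_dim)
qed (use metric in \<open>simp_all add: semi_riemannian_metric_def linear_on_def\<close>)

section \<open>Fields through given vectors, orthogonal fields, dual frames\<close>

lemma metric_smooth [simp]: "VF X \<Longrightarrow> VF Y \<Longrightarrow> SF (\<lambda>p. g p (X p) (Y p))"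
  using metric by (simp add: semi_riemannian_metric_def)

text \<open>By the upper bound on the dimension, the independent values at \<open>p\<close> of the
  cut-off coordinate fields are a basis, and constant coefficients do the rest.\<close>

lemma ex_field_through:
  assumes "v \<in> T p"
  obtains X where "VF X" "X p = v"
proof -
  obtain B where B: "finite B" "card B = DIM('e)" "independent B" "\<forall>v\<in>B. \<exists>X. VF X \<and> X p = v"
    using ex_independent_fields[of p] by blast
  then obtain E where E: "\<And>b. b \<in> B \<Longrightarrow> VF (E b)" "\<And>b. b \<in> B \<Longrightarrow> E b p = b" by metis
  have "B \<subseteq> T p" using B(4) by (metis VF_tangent subsetI)
  then have "T p \<subseteq> span B" using independent_spans B by blast
  then obtain u where "v = (\<Sum>b\<in>B. u b *\<^sub>R b)" using assms by (auto simp: span_finite[OF B(1)])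
  then have "(\<lambda>q. \<Sum>b\<in>B. u b *\<^sub>R E b q) p = v" using E(2) by simp
  moreover have "VF (\<lambda>q. \<Sum>b\<in>B. u b *\<^sub>R E b q)"
    by (intro VF_sum VF_scale SF_const E)
  ultimately show ?thesis using that by blast
qed

lemma field_eqI:
  assumes "v \<in> T p" "w \<in> T p" "\<And>Z. VF Z \<Longrightarrow> g p v (Z p) = g p w (Z p)"
  shows "v = w"
  by (rule form_ext[OF assms(1,2)]) (metis assms(3) ex_field_through)

text \<open>Gram--Schmidt with the denominators cleared, so that the fields are orthogonal everywhere.\<close>

lemma ex_orthogonal_fields:
  assumes "finite B" "orthogonal_set p B"
  shows "\<exists>F. (\<forall>b\<in>B. VF (F b)) \<and> (\<forall>b\<in>B. \<exists>a. a \<noteq> 0 \<and> F b p = a *\<^sub>R b) \<and>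
    (\<forall>b\<in>B. \<forall>c\<in>B. b \<noteq> c \<longrightarrow> (\<forall>q. g q (F b q) (F c q) = 0))"
  using assms
proof (induction B)
  case (insert e B)
  have "orthogonal_set p B" using insert.prems by (auto simp: orthogonal_set_def)
  then obtain F where F: "\<And>b. b \<in> B \<Longrightarrow> VF (F b)" and Fp: "\<And>b. b \<in> B \<Longrightarrow> \<exists>a. a \<noteq> 0 \<and> F b p = a *\<^sub>R b"
    and orth: "\<And>b c q. b \<in> B \<Longrightarrow> c \<in> B \<Longrightarrow> b \<noteq> c \<Longrightarrow> g q (F b q) (F c q) = 0"
    using insert.IH by metis
  have e: "e \<in> T p" and BT: "B \<subseteq> T p" and eb: "\<And>b. b \<in> B \<Longrightarrow> g p e b = 0" and bb: "\<And>b. b \<in> B \<Longrightarrow> g p b b \<noteq> 0"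
    using insert.prems insert.hyps by (auto simp: orthogonal_set_def)
  obtain E where E: "VF E" "E p = e" using ex_field_through[OF e] .
  define n where "n = (\<lambda>b q. g q (F b q) (F b q))"
  have n: "SF (n b)" if "b \<in> B" for b unfolding n_def using F[OF that] by (intro metric_smooth)
  \<comment> \<open>Multiplied by \<open>n b\<close>, this is the product of all the
    \<open>n k\<close> times the inner product of \<open>E\<close> with \<open>F b\<close>. So
    \<open>H\<close> is orthogonal to each \<open>F b\<close> everywhere, even where some
    \<open>n k\<close> vanishes.\<close>
  define u where "u = (\<lambda>b q. (\<Prod>k\<in>B-{b}. n k q) * g q (E q) (F b q))"
  have u: "SF (u b)" if "b \<in> B" for b
    unfolding u_def using n F E that by (intro SF_mult SF_prod metric_smooth) auto
  define H where "H = (\<lambda>q. (\<Prod>b\<in>B. n b q) *\<^sub>R E q - (\<Sum>b\<in>B. u b q *\<^sub>R F b q))"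
  have H: "VF H" unfolding H_def using n u F E by (intro VF_diff' VF_scale VF_sum SF_prod) auto
  have Fq: "F b q \<in> T q" if "b \<in> B" for b q using F[OF that] by simp
  have Eq: "E q \<in> T q" for q using E by simp
  have HF: "g q (H q) (F c q) = 0" if c: "c \<in> B" for c q
  proof -
    have "g q (H q) (F c q) = (\<Prod>b\<in>B. n b q) * g q (E q) (F c q) - (\<Sum>b\<in>B. u b q * g q (F b q) (F c q))"
      unfolding H_def using c Fq Eq by (simp add: form_diff form_scale_left form_sum_left T_closed)
    also have "(\<Sum>b\<in>B. u b q * g q (F b q) (F c q)) = (\<Sum>b\<in>B. if b = c then u c q * n c q else 0)"
      using orth c by (intro sum.cong) (auto simp: n_def)
    also have "\<dots> = u c q * n c q" using c insert.hyps by simp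
    also have "\<dots> = (\<Prod>b\<in>B. n b q) * g q (E q) (F c q)"
      using prod.remove[OF insert.hyps(1) c, of "\<lambda>b. n b q"] by (simp add: u_def)
    finally show ?thesis by simp
  qed
  have npz: "n b p \<noteq> 0" if b: "b \<in> B" for b
  proof -
    obtain a where "a \<noteq> 0" "F b p = a *\<^sub>R b" using Fp[OF b] by blast
    then show ?thesis using bb[OF b] b BT by (auto simp: n_def form_scale form_scale_left subset_iff T_closed)
  qed
  \<comment> \<open>At \<open>p\<close> there is nothing to correct, since \<open>e\<close> is
    already orthogonal to \<open>B\<close>; \<open>H p\<close> is thus a nonzero multiple of
    \<open>e\<close>.\<close>
  have "u b p = 0" if b: "b \<in> B" for b
  proof -
    obtain a where "F b p = a *\<^sub>R b" using Fp[OF b] by blast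
    then show ?thesis using eb[OF b] b BT e by (auto simp: u_def E form_scale subset_iff)
  qed
  then have Hp: "H p = (\<Prod>b\<in>B. n b p) *\<^sub>R e" by (simp add: H_def E)
  define F' where "F' = F(e := H)"
  have F': "F' e = H" "\<And>b. b \<in> B \<Longrightarrow> F' b = F b" using insert.hyps by (auto simp: F'_def)
  have "\<forall>b\<in>insert e B. VF (F' b)" using F' F H by auto
  moreover have "\<forall>b\<in>insert e B. \<exists>a. a \<noteq> 0 \<and> F' b p = a *\<^sub>R b"
  proof -
    have "(\<Prod>b\<in>B. n b p) \<noteq> 0" using npz insert.hyps(1) by simp
    then show ?thesis using F' Fp Hp by (metis insertE)
  qed
  moreover have "g q (F' b q) (F' c q) = 0" if "b \<in> insert e B" "c \<in> insert e B" "b \<noteq> c" for b c q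
  proof -
    have "g q (F c q) (H q) = 0" if "c \<in> B" for c
      using HF[OF that, of q] form_sym[OF Fq[OF that] VF_tangent[OF H]] by simp
    then show ?thesis using that F' HF orth by auto
  qed
  ultimately show ?case by blast
qed auto

text \<open>\<open>B\<close> is merely an index set. \<open>G b\<close> plays the metric dual of
  \<open>F b\<close> with denominators cleared, which is what lets the identity hold globally; it
  carries information where \<open>w\<close> does not vanish.\<close>

definition dual_frame :: "'a \<Rightarrow> 'a tvec set \<Rightarrow> ('a tvec \<Rightarrow> 'a vfield) \<Rightarrow> ('a tvec \<Rightarrow> 'a vfield) \<Rightarrow> ('a \<Rightarrow> real) \<Rightarrow> bool"
  where "dual_frame p B F G w \<longleftrightarrow> finite B \<and> (\<forall>b\<in>B. VF (F b)) \<and> (\<forall>b\<in>B. VF (G b)) \<and> SF w \<and> w p \<noteq> 0 \<and>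
    (\<forall>q. \<forall>v\<in>T q. w q *\<^sub>R v = (\<Sum>b\<in>B. g q v (G b q) *\<^sub>R F b q))"

lemma dual_frameD:
  assumes "dual_frame p B F G w"
  shows "finite B" "\<And>b. b \<in> B \<Longrightarrow> VF (F b)" "\<And>b. b \<in> B \<Longrightarrow> VF (G b)" "SF w" "w p \<noteq> 0"
    "\<And>q v. v \<in> T q \<Longrightarrow> w q *\<^sub>R v = (\<Sum>b\<in>B. g q v (G b q) *\<^sub>R F b q)"
  using assms unfolding dual_frame_def by blast+

lemma ex_dual_frame: "\<exists>B F G w. dual_frame p B F G w"
proof -
  obtain B where B: "finite B" "orthonormal_set p B" "T p \<subseteq> span B" using ex_orthonormal_basis by blast
  have oB: "orthogonal_set p B" using orthonormal_imp_orthogonal[OF B(2)] .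
  obtain F where F: "\<And>b. b \<in> B \<Longrightarrow> VF (F b)" and Fp: "\<And>b. b \<in> B \<Longrightarrow> \<exists>a. a \<noteq> 0 \<and> F b p = a *\<^sub>R b"
    and orth: "\<And>b c q. b \<in> B \<Longrightarrow> c \<in> B \<Longrightarrow> b \<noteq> c \<Longrightarrow> g q (F b q) (F c q) = 0"
    using ex_orthogonal_fields[OF B(1) oB] by metis
  \<comment> \<open>The exact count is needed at points other than \<open>p\<close>: wherever all
    \<open>F b\<close> are non-null they span the tangent space there.\<close>
  have "card B = DIM('e)"
  proof -
    obtain E where E: "finite E" "card E = DIM('e)" "independent E" "\<forall>v\<in>E. \<exists>X. VF X \<and> X p = v"
      using ex_independent_fields[of p] by blast
    have "E \<subseteq> T p" using E(4) by (metis VF_tangent subsetI)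
    then have "card E \<le> card B" using independent_span_bound[OF B(1) E(3)] B(3) by blast
    moreover have "card B \<le> DIM('e)"
      using independent_card_le[where p=p, OF orthogonal_independent[OF oB]] B(2) by (auto simp: orthonormal_set_def)
    ultimately show ?thesis using E(2) by simp
  qed
  define n where "n = (\<lambda>b q. g q (F b q) (F b q))"
  have n: "SF (n b)" if "b \<in> B" for b unfolding n_def using F[OF that] by (intro metric_smooth)
  define W where "W = (\<lambda>q. \<Prod>b\<in>B. n b q)"
  \<comment> \<open>The additional factor \<open>W q\<close> makes both sides vanish at points where
    some \<open>F b\<close> is null and the expansion could fail; this is why \<open>w\<close>
    becomes the square of \<open>W\<close>.\<close>
  define G where "G = (\<lambda>b q. (W q * (\<Prod>k\<in>B-{b}. n k q)) *\<^sub>R F b q)"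
  have W: "SF W" unfolding W_def using n by (intro SF_prod)
  have Fq: "F b q \<in> T q" if "b \<in> B" for b q using F[OF that] by simp
  have exp: "(W q * W q) *\<^sub>R v = (\<Sum>b\<in>B. g q v (G b q) *\<^sub>R F b q)" if v: "v \<in> T q" for q v
  proof (cases "W q = 0")
    case True
    then show ?thesis using v by (simp add: G_def form_zero)
  next
    case False
    then have nz: "n b q \<noteq> 0" if "b \<in> B" for b using that B(1) by (auto simp: W_def)
    have inj: "inj_on (\<lambda>b. F b q) B"
    proof
      fix b c assume bc: "b \<in> B" "c \<in> B" "F b q = F c q"
      show "b = c"
      proof (rule ccontr)
        assume "b \<noteq> c"
        then have "g q (F b q) (F c q) = 0" using orth bc by blast
        then show False using nz[OF bc(1)] bc(3) by (simp add: n_def)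
      qed
    qed
    let ?S = "(\<lambda>b. F b q) ` B"
    have "g q (F b q) (F c q) = 0" if "b \<in> B" "c \<in> B" "F b q \<noteq> F c q" for b c
      using orth that by metis
    then have o: "orthogonal_set q ?S"
      using Fq nz by (auto simp: orthogonal_set_def n_def)
    have "T q \<subseteq> span ?S"
      by (rule independent_spans[OF orthogonal_independent[OF o]])
         (use Fq \<open>card B = DIM('e)\<close> in \<open>auto simp: card_image[OF inj]\<close>)
    then have "v = (\<Sum>c\<in>?S. (g q v c / g q c c) *\<^sub>R c)"
      using orthogonal_expansion[OF o _ _ v] B(1) by simp
    also have "\<dots> = (\<Sum>b\<in>B. (g q v (F b q) / n b q) *\<^sub>R F b q)"
      by (simp add: sum.reindex[OF inj] n_def)
    finally have "(W q * W q) *\<^sub>R v = (W q * W q) *\<^sub>R (\<Sum>b\<in>B. (g q v (F b q) / n b q) *\<^sub>R F b q)"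
      by (rule arg_cong)
    also have "\<dots> = (\<Sum>b\<in>B. (W q * W q * (g q v (F b q) / n b q)) *\<^sub>R F b q)"
      by (simp only: scaleR_sum_right scaleR_scaleR)
    also have "\<dots> = (\<Sum>b\<in>B. g q v (G b q) *\<^sub>R F b q)"
    proof (rule sum.cong[OF refl])
      fix b assume b: "b \<in> B"
      have "W q = n b q * (\<Prod>k\<in>B-{b}. n k q)" unfolding W_def by (rule prod.remove[OF B(1) b])
      then have "W q * W q * (g q v (F b q) / n b q) = g q v (G b q)"
        using nz[OF b] v Fq[OF b] by (simp add: G_def form_scale field_simps)
      then show "(W q * W q * (g q v (F b q) / n b q)) *\<^sub>R F b q = g q v (G b q) *\<^sub>R F b q" by simp
    qed
    finally show ?thesis .
  qed
  have G: "VF (G b)" if "b \<in> B" for b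
    unfolding G_def using that n W F by (intro VF_scale SF_mult SF_prod) auto
  have Wp: "W p * W p \<noteq> 0"
  proof -
    have "n b p \<noteq> 0" if b: "b \<in> B" for b
    proof -
      obtain a where "a \<noteq> 0" "F b p = a *\<^sub>R b" using Fp[OF b] by blast
      then show ?thesis using oB b
        by (auto simp: n_def orthogonal_set_def form_scale form_scale_left subset_iff T_closed)
    qed
    then show ?thesis using B(1) by (simp add: W_def)
  qed
  show ?thesis
    using B(1) F G SF_mult[OF W W] Wp exp
    unfolding dual_frame_def by (intro exI[of _ B] exI[of _ F] exI[of _ G] exI[of _ "\<lambda>q. W q * W q"]) simp
qed

section \<open>Tensoriality and metric duals\<close>

lemma linear_sum_fields:
  fixes \<omega> :: "'a vfield \<Rightarrow> real"
  assumes add: "\<And>X Y. VF X \<Longrightarrow> VF Y \<Longrightarrow> \<omega> (X + Y) = \<omega> X + \<omega> Y"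
    and scale: "\<And>f X. SF f \<Longrightarrow> VF X \<Longrightarrow> \<omega> (\<lambda>q. f q *\<^sub>R X q) = f p * \<omega> X"
    and "finite I" "\<And>i. i \<in> I \<Longrightarrow> SF (f i)" "\<And>i. i \<in> I \<Longrightarrow> VF (X i)"
  shows "\<omega> (\<lambda>q. \<Sum>i\<in>I. f i q *\<^sub>R X i q) = (\<Sum>i\<in>I. f i p * \<omega> (X i))"
  using assms(3-5)
proof (induction I)
  case empty
  have "\<omega> (\<lambda>q. 0) = 0" using scale[of "\<lambda>_. 0" "\<lambda>_. 0"] by simp
  then show ?case by (simp only: sum.empty)
next
  case (insert i I)
  let ?Y = "\<lambda>q. f i q *\<^sub>R X i q" and ?Z = "\<lambda>q. \<Sum>j\<in>I. f j q *\<^sub>R X j q"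
  have Y: "VF ?Y" and Z: "VF ?Z"
    using insert.prems by (auto intro!: VF_sum VF_scale)
  have "(\<lambda>q. \<Sum>j\<in>insert i I. f j q *\<^sub>R X j q) = ?Y + ?Z"
    unfolding func_plus[of ?Y ?Z] by (simp only: sum.insert[OF insert.hyps(1,2)])
  then have "\<omega> (\<lambda>q. \<Sum>j\<in>insert i I. f j q *\<^sub>R X j q) = \<omega> ?Y + \<omega> ?Z"
    by (simp only: add[OF Y Z])
  also have "\<omega> ?Y = f i p * \<omega> (X i)" using insert.prems by (intro scale) auto
  also have "\<omega> ?Z = (\<Sum>j\<in>I. f j p * \<omega> (X j))" using insert.prems by (intro insert.IH) auto
  finally show ?case by (simp only: sum.insert[OF insert.hyps(1,2)])
qed

text \<open>Multiplication by \<open>w\<close> turns any field \<open>Z\<close> into a combination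
  of the fixed fields \<open>F b\<close>, with coefficients whose values at \<open>p\<close> depend
  on \<open>Z p\<close> only; \<open>w p\<close> then cancels.\<close>

lemma tensorial_at:
  fixes \<omega> :: "'a vfield \<Rightarrow> real"
  assumes add: "\<And>X Y. VF X \<Longrightarrow> VF Y \<Longrightarrow> \<omega> (X + Y) = \<omega> X + \<omega> Y"
    and scale: "\<And>f X. SF f \<Longrightarrow> VF X \<Longrightarrow> \<omega> (\<lambda>q. f q *\<^sub>R X q) = f p * \<omega> X"
    and XY: "VF X" "VF Y" "X p = Y p"
  shows "\<omega> X = \<omega> Y"
proof -
  obtain B F G w where fr: "dual_frame p B F G w" using ex_dual_frame by blast
    note B = dual_frameD(1)[OF fr] and F = dual_frameD(2)[OF fr] and G = dual_frameD(3)[OF fr]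
      and w = dual_frameD(4,5)[OF fr] and exp = dual_frameD(6)[OF fr]
  have "w p * \<omega> Z = (\<Sum>b\<in>B. g p (Z p) (G b p) * \<omega> (F b))" if Z: "VF Z" for Z
  proof -
    have "w p * \<omega> Z = \<omega> (\<lambda>q. w q *\<^sub>R Z q)" by (rule scale[OF w(1) Z, symmetric])
    also have "\<dots> = \<omega> (\<lambda>q. \<Sum>b\<in>B. g q (Z q) (G b q) *\<^sub>R F b q)" by (simp only: exp[OF VF_tangent[OF Z]])
    also have "\<dots> = (\<Sum>b\<in>B. g p (Z p) (G b p) * \<omega> (F b))"
      by (rule linear_sum_fields[OF add scale B metric_smooth[OF Z G] F])
    finally show ?thesis .
  qed
  from this[OF XY(1)] this[OF XY(2)] have "w p * \<omega> X = w p * \<omega> Y" using XY(3) by simp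
  then show ?thesis using w(2) by simp
qed

text \<open>Near each point the combination \<open>H\<close> of the dual fields \<open>G b\<close>
  represents \<open>\<omega>\<close> up to the factor \<open>w\<close>. The representing vector is
  chosen pointwise; by nondegeneracy \<open>w\<close> times it is \<open>H\<close>, so
  \<open>SF_localI\<close> makes the choice smooth.\<close>

lemma riesz:
  fixes \<omega> :: "'a vfield \<Rightarrow> 'a \<Rightarrow> real"
  assumes add: "\<And>X Y p. VF X \<Longrightarrow> VF Y \<Longrightarrow> \<omega> (X + Y) p = \<omega> X p + \<omega> Y p"
    and scale: "\<And>f X p. SF f \<Longrightarrow> VF X \<Longrightarrow> \<omega> (\<lambda>q. f q *\<^sub>R X q) p = f p * \<omega> X p"
    and smooth: "\<And>X. VF X \<Longrightarrow> SF (\<omega> X)"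
  obtains V where "VF V" "\<And>Z p. VF Z \<Longrightarrow> g p (V p) (Z p) = \<omega> Z p"
proof -
  have key: "\<exists>w H. SF w \<and> w p \<noteq> 0 \<and> VF H \<and> (\<forall>Z q. VF Z \<longrightarrow> g q (H q) (Z q) = w q * \<omega> Z q)" for p
  proof -
    obtain B F G w where fr: "dual_frame p B F G w" using ex_dual_frame by blast
    note B = dual_frameD(1)[OF fr] and F = dual_frameD(2)[OF fr] and G = dual_frameD(3)[OF fr]
      and w = dual_frameD(4,5)[OF fr] and exp = dual_frameD(6)[OF fr]
    define H where "H = (\<lambda>q. \<Sum>b\<in>B. \<omega> (F b) q *\<^sub>R G b q)"
    have H: "VF H" unfolding H_def by (rule VF_sum, rule VF_scale[OF smooth[OF F] G])
    have "g q (H q) (Z q) = w q * \<omega> Z q" if Z: "VF Z" for Z q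
    proof -
      have "w q * \<omega> Z q = \<omega> (\<lambda>q. w q *\<^sub>R Z q) q" by (rule scale[OF w(1) Z, symmetric])
      also have "\<dots> = \<omega> (\<lambda>q. \<Sum>b\<in>B. g q (Z q) (G b q) *\<^sub>R F b q) q" by (simp only: exp[OF VF_tangent[OF Z]])
      also have "\<dots> = (\<Sum>b\<in>B. g q (Z q) (G b q) * \<omega> (F b) q)"
        by (rule linear_sum_fields[OF add scale B metric_smooth[OF Z G] F])
      also have "\<dots> = g q (H q) (Z q)"
      proof -
        have Gq: "G b q \<in> T q" if "b \<in> B" for b using G[OF that] by (rule VF_tangent)
        have "g q (H q) (Z q) = (\<Sum>b\<in>B. g q (\<omega> (F b) q *\<^sub>R G b q) (Z q))"
          unfolding H_def by (rule form_sum_left[OF VF_tangent[OF Z] T_closed(3)[OF Gq]])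
        also have "\<dots> = (\<Sum>b\<in>B. g q (Z q) (G b q) * \<omega> (F b) q)"
          by (rule sum.cong[OF refl])
             (simp only: form_scale_left[OF Gq VF_tangent[OF Z]] form_sym[OF VF_tangent[OF Z] Gq] mult.commute)
        finally show ?thesis by (rule sym)
      qed
      finally show ?thesis by simp
    qed
    then show ?thesis using w H by blast
  qed
  have "\<exists>v. v \<in> T p \<and> (\<forall>Z. VF Z \<longrightarrow> g p v (Z p) = \<omega> Z p)" for p
  proof -
    obtain w H where H: "SF w" "w p \<noteq> 0" "VF H" "\<And>Z q. VF Z \<Longrightarrow> g q (H q) (Z q) = w q * \<omega> Z q"
      using key[of p] by blast
    have "inverse (w p) *\<^sub>R H p \<in> T p" using H by (simp add: T_closed)
    moreover have "g p (inverse (w p) *\<^sub>R H p) (Z p) = \<omega> Z p" if "VF Z" for Z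
      using H(2,3) H(4)[OF that, of p] that by (simp add: form_scale_left)
    ultimately show ?thesis by blast
  qed
  then obtain V where V: "\<And>p. V p \<in> T p" "\<And>Z p. VF Z \<Longrightarrow> g p (V p) (Z p) = \<omega> Z p"
    using choice[of "\<lambda>p v. v \<in> T p \<and> (\<forall>Z. VF Z \<longrightarrow> g p v (Z p) = \<omega> Z p)"] by blast
  have "VF V"
  proof (rule VF_I[OF V(1)], rule SF_localI)
    fix f p assume f: "SF f"
    obtain w H where H: "SF w" "w p \<noteq> 0" "VF H" "\<And>Z q. VF Z \<Longrightarrow> g q (H q) (Z q) = w q * \<omega> Z q"
      using key[of p] by blast
    have "w q *\<^sub>R V q = H q" for q
    proof (rule field_eqI[where p=q])
      show "g q (w q *\<^sub>R V q) (Z q) = g q (H q) (Z q)" if Z: "VF Z" for Z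
        by (simp only: form_scale_left[OF V(1) VF_tangent[OF Z]] V(2)[OF Z] H(4)[OF Z])
    qed (rule T_closed V(1) VF_tangent[OF H(3)])+
    then have "w q * V q f = H q f" for q by (metis real_scaleR_def scaleR_fun_apply)
    then have "SF (\<lambda>q. w q * V q f)" using VF_smooth[OF H(3) f] by presburger
    then show "\<exists>w. SF w \<and> w p \<noteq> 0 \<and> SF (\<lambda>q. w q * V q f)" using H(1,2) by blast
  qed
  then show ?thesis using that V(2) by blast
qed

end

subsection \<open>The Levi-Civita connection\<close>

context smooth_manifold
begin

definition der :: "'a vfield \<Rightarrow> ('a \<Rightarrow> real) \<Rightarrow> 'a \<Rightarrow> real" where "der X f = (\<lambda>p. X p f)"

definition smul :: "('a \<Rightarrow> real) \<Rightarrow> 'a vfield \<Rightarrow> 'a vfield" where "smul f X = (\<lambda>p. f p *\<^sub>R X p)"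

lemma VF_smul [simp]: "SF f \<Longrightarrow> VF X \<Longrightarrow> VF (smul f X)"
  unfolding smul_def by (rule VF_scale)

lemma SF_der [simp]: "VF X \<Longrightarrow> SF f \<Longrightarrow> SF (der X f)"
  unfolding der_def by (rule VF_smooth)

lemma der_field:
  "der (X + Y) f = (\<lambda>q. der X f q + der Y f q)" "der (X - Y) f = (\<lambda>q. der X f q - der Y f q)"
  "der (- X) f = (\<lambda>q. - der X f q)" "der (smul h X) f = (\<lambda>q. h q * der X f q)"
  "der (lie_bracket X Y) f = (\<lambda>q. der X (der Y f) q - der Y (der X f) q)"
  by (simp_all add: der_def smul_def lie_bracket_def)

lemma der_fun:
  assumes "VF X"
  shows "SF f \<Longrightarrow> SF h \<Longrightarrow> der X (\<lambda>q. f q + h q) = (\<lambda>q. der X f q + der X h q)"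
    "SF f \<Longrightarrow> SF h \<Longrightarrow> der X (\<lambda>q. f q - h q) = (\<lambda>q. der X f q - der X h q)"
    "SF f \<Longrightarrow> der X (\<lambda>q. - f q) = (\<lambda>q. - der X f q)"
    "SF f \<Longrightarrow> SF h \<Longrightarrow> der X (\<lambda>q. f q * h q) = (\<lambda>q. der X f q * h q + f q * der X h q)"
    "der X (\<lambda>q. a) = (\<lambda>q. 0)"
  unfolding der_def fun_eq_iff
  using tangent_add[OF VF_tangent[OF assms]] tangent_diff[OF VF_tangent[OF assms]]
    tangent_minus[OF VF_tangent[OF assms]] tangent_mult[OF VF_tangent[OF assms]]
    tangent_const[OF VF_tangent[OF assms]] by blast+

lemma field_der_eqI:
  assumes "VF X" "VF Y" "\<And>f. SF f \<Longrightarrow> der X f = der Y f"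
  shows "X = Y"
proof (intro ext)
  fix p f
  show "X p f = Y p f"
  proof (cases "SF f")
    case True
    then show ?thesis using assms(3)[OF True] unfolding der_def by metis
  next
    case False
    then show ?thesis
      using tangent_nonsmooth[OF VF_tangent[OF assms(1)]] tangent_nonsmooth[OF VF_tangent[OF assms(2)]] by metis
  qed
qed

lemma lie_bracket_linear:
  assumes "VF X" "VF Y" "VF Z"
  shows "lie_bracket (X + Y) Z = lie_bracket X Z + lie_bracket Y Z"
    "lie_bracket X (Y + Z) = lie_bracket X Y + lie_bracket X Z"
  by (rule field_der_eqI; simp add: assms der_field der_fun fun_eq_iff)+

lemma lie_bracket_smul:
  assumes "VF X" "VF Y" "SF f"
  shows "lie_bracket X (smul f Y) = smul f (lie_bracket X Y) + smul (der X f) Y"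
    "lie_bracket (smul f X) Y = smul f (lie_bracket X Y) - smul (der Y f) X"
  by (rule field_der_eqI; simp add: assms der_field der_fun fun_eq_iff algebra_simps)+

lemma lie_bracket_antisym: "lie_bracket X Y = - lie_bracket Y X"
  by (simp add: lie_bracket_def fun_eq_iff)

lemma jacobi:
  assumes "VF X" "VF Y" "VF Z"
  shows "lie_bracket X (lie_bracket Y Z) = lie_bracket (lie_bracket X Y) Z + lie_bracket Y (lie_bracket X Z)"
  by (rule field_der_eqI) (simp_all add: assms der_field der_fun fun_eq_iff)

lemma smul_simps:
  "smul f X p = f p *\<^sub>R X p" "smul f (X + Y) = smul f X + smul f Y" "smul f (X - Y) = smul f X - smul f Y"
  "smul f (- X) = - smul f X"
  by (simp_all add: smul_def fun_eq_iff algebra_simps)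

end

context semi_riemannian
begin

definition ip :: "'a vfield \<Rightarrow> 'a vfield \<Rightarrow> 'a \<Rightarrow> real" where "ip X Y = (\<lambda>p. g p (X p) (Y p))"

lemma SF_ip [simp]: "VF X \<Longrightarrow> VF Y \<Longrightarrow> SF (ip X Y)"
  unfolding ip_def by (rule metric_smooth)

lemma ip_sym: "VF X \<Longrightarrow> VF Y \<Longrightarrow> ip X Y = ip Y X"
  unfolding ip_def fun_eq_iff by (blast intro: form_sym VF_tangent)

lemma ip_left:
  assumes "VF Z" "VF X"
  shows "VF Y \<Longrightarrow> ip (X + Y) Z = (\<lambda>q. ip X Z q + ip Y Z q)"
    "VF Y \<Longrightarrow> ip (X - Y) Z = (\<lambda>q. ip X Z q - ip Y Z q)"
    "ip (- X) Z = (\<lambda>q. - ip X Z q)" "ip (smul f X) Z = (\<lambda>q. f q * ip X Z q)"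
  using VF_tangent[OF assms(1)] VF_tangent[OF assms(2)]
  by (simp_all add: ip_def fun_eq_iff smul_def form_add_left form_diff form_minus form_scale_left)

lemma ip_right:
  assumes "VF Z" "VF X"
  shows "VF Y \<Longrightarrow> ip Z (X + Y) = (\<lambda>q. ip Z X q + ip Z Y q)"
    "VF Y \<Longrightarrow> ip Z (X - Y) = (\<lambda>q. ip Z X q - ip Z Y q)"
    "ip Z (- X) = (\<lambda>q. - ip Z X q)" "ip Z (smul f X) = (\<lambda>q. f q * ip Z X q)"
  using VF_tangent[OF assms(1)] VF_tangent[OF assms(2)]
  by (simp_all add: ip_def fun_eq_iff smul_def form_add form_diff form_minus form_scale)

lemma ip_eqI:
  assumes "VF X" "VF Y" "\<And>Z p. VF Z \<Longrightarrow> ip X Z p = ip Y Z p"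
  shows "X = Y"
proof
  show "X p = Y p" for p
    by (rule field_eqI[OF VF_tangent[OF assms(1)] VF_tangent[OF assms(2)]]) (use assms(3) in \<open>simp add: ip_def\<close>)
qed

definition koszul :: "'a vfield \<Rightarrow> 'a vfield \<Rightarrow> 'a vfield \<Rightarrow> 'a \<Rightarrow> real" where
  "koszul X Y Z = (\<lambda>p. (1/2) * (der X (ip Y Z) p + der Y (ip X Z) p - der Z (ip X Y) p +
     ip (lie_bracket X Y) Z p - ip (lie_bracket X Z) Y p - ip (lie_bracket Y Z) X p))"

text \<open>When \<open>Z\<close> is multiplied by \<open>f\<close>, the derivatives of
  \<open>f\<close> from the first two terms of \<open>koszul\<close> cancel those from the brackets
  with \<open>Z\<close>. So the expression is tensorial in \<open>Z\<close> and has a metric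
  dual.\<close>

lemma ex_nabla:
  assumes "VF X" "VF Y"
  shows "\<exists>V. VF V \<and> (\<forall>Z p. VF Z \<longrightarrow> ip V Z p = koszul X Y Z p)"
proof -
  have s: "SF (koszul X Y Z)" if "VF Z" for Z
    unfolding koszul_def using that assms
    by (intro SF_mult SF_const SF_diff SF_add SF_der SF_ip VF_lie_bracket)
  have a: "koszul X Y (Z + W) p = koszul X Y Z p + koszul X Y W p" if "VF Z" "VF W" for Z W p
    using that assms by (simp add: koszul_def ip_left ip_right der_field der_fun lie_bracket_linear algebra_simps)
  have m: "koszul X Y (smul f Z) p = f p * koszul X Y Z p" if "SF f" "VF Z" for Z f p
    using that assms ip_sym[of X Z] ip_sym[of Y Z]
    by (simp add: koszul_def ip_left ip_right der_field der_fun lie_bracket_smul algebra_simps)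
  show ?thesis
    by (rule riesz[of "koszul X Y", OF a m[unfolded smul_def] s]) (auto simp: ip_def)
qed

definition nabla :: "'a vfield \<Rightarrow> 'a vfield \<Rightarrow> 'a vfield" where
  "nabla X Y = (SOME V. VF V \<and> (\<forall>Z p. VF Z \<longrightarrow> ip V Z p = koszul X Y Z p))"

lemma nabla:
  assumes "VF X" "VF Y"
  shows "VF (nabla X Y)" "VF Z \<Longrightarrow> ip (nabla X Y) Z p = koszul X Y Z p"
  using someI_ex[OF ex_nabla[OF assms]] unfolding nabla_def by blast+

lemma nabla_metric:
  assumes "VF X" "VF Y" "VF Z"
  shows "der X (ip Y Z) p = ip (nabla X Y) Z p + ip Y (nabla X Z) p"
proof -
  have "ip Y (nabla X Z) p = koszul X Z Y p" using ip_sym[of Y "nabla X Z"] nabla assms by simp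
  then show ?thesis
    using assms ip_sym[of Z Y] ip_sym[of X Y] ip_sym[of X Z] lie_bracket_antisym[of Y Z] ip_left(3)[of X "lie_bracket Z Y"]
    by (simp add: nabla koszul_def) (simp add: field_simps)
qed

lemma nabla_torsion:
  assumes "VF X" "VF Y"
  shows "nabla X Y - nabla Y X = lie_bracket X Y"
proof (rule ip_eqI)
  fix Z p assume Z: "VF Z"
  show "ip (nabla X Y - nabla Y X) Z p = ip (lie_bracket X Y) Z p"
    using assms Z ip_sym[of Y X] lie_bracket_antisym[of Y X] ip_left(3)[of Z "lie_bracket X Y"]
    by (simp add: ip_left nabla koszul_def) (simp add: field_simps)
qed (use assms nabla in simp_all)

lemma nabla_linear:
  assumes "VF X" "VF Y" "VF Z"
  shows "nabla (X + Y) Z = nabla X Z + nabla Y Z" "nabla X (Y + Z) = nabla X Y + nabla X Z"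
proof -
  have "ip (nabla (X + Y) Z) W p = ip (nabla X Z + nabla Y Z) W p"
    "ip (nabla X (Y + Z)) W p = ip (nabla X Y + nabla X Z) W p" if "VF W" for W p
    using assms that
    by (simp_all add: ip_left ip_right nabla koszul_def lie_bracket_linear der_field der_fun algebra_simps)
  then show "nabla (X + Y) Z = nabla X Z + nabla Y Z" "nabla X (Y + Z) = nabla X Y + nabla X Z"
    using assms nabla by (auto intro!: ip_eqI)
qed

lemma nabla_smul:
  assumes "VF X" "VF Y" "SF f"
  shows "nabla (smul f X) Y = smul f (nabla X Y)"
    "nabla X (smul f Y) = smul (der X f) Y + smul f (nabla X Y)"
proof -
  have "ip (nabla (smul f X) Y) W p = ip (smul f (nabla X Y)) W p"
    "ip (nabla X (smul f Y)) W p = ip (smul (der X f) Y + smul f (nabla X Y)) W p" if "VF W" for W p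
    using assms that ip_sym[of Y X] ip_sym[of W X] ip_sym[of W Y]
    by (simp_all add: ip_left ip_right nabla koszul_def lie_bracket_smul der_field der_fun algebra_simps add_divide_distrib diff_divide_distrib)
  then show "nabla (smul f X) Y = smul f (nabla X Y)"
    "nabla X (smul f Y) = smul (der X f) Y + smul f (nabla X Y)"
    using assms nabla by (auto intro!: ip_eqI)
qed

lemma is_levi_civita_nabla: "is_levi_civita A g nabla"
proof -
  have *: "nabla (\<lambda>p. f p *\<^sub>R X p) Y = (\<lambda>p. f p *\<^sub>R nabla X Y p)"
    "nabla X (\<lambda>p. f p *\<^sub>R Y p) = (\<lambda>p. X p f *\<^sub>R Y p + f p *\<^sub>R nabla X Y p)"
    if "SF f" "VF X" "VF Y" for f X Y
    using nabla_smul[OF that(2,3,1)] unfolding smul_def der_def by (simp_all only: func_plus)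
  show ?thesis
    unfolding is_levi_civita_def
    by (intro conjI allI impI)
       (rule nabla nabla_linear nabla_torsion * nabla_metric[unfolded ip_def der_def]; assumption)+
qed

text \<open>\<open>nabla\<close> witnesses that the choice in \<open>levi_civita\<close> satisfies
  its axioms; from here on only these axioms are used.\<close>

definition D :: "'a vfield \<Rightarrow> 'a vfield \<Rightarrow> 'a vfield" where "D = levi_civita A g"

lemma is_levi_civita_D: "is_levi_civita A g D"
  unfolding D_def levi_civita_def by (rule someI[of "is_levi_civita A g", OF is_levi_civita_nabla])

lemmas levi_civita_conj = is_levi_civita_D[unfolded is_levi_civita_def]

lemma VF_D [simp]: "VF X \<Longrightarrow> VF Y \<Longrightarrow> VF (D X Y)"
  by (rule levi_civita_conj[THEN conjunct1, rule_format])

lemma D_add: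
  assumes "VF X" "VF Y" "VF Z"
  shows "D (X + Y) Z = D X Z + D Y Z" "D X (Y + Z) = D X Y + D X Z"
  using levi_civita_conj[THEN conjunct2, THEN conjunct1, rule_format, OF assms] by simp_all

lemma D_metric:
  assumes "VF X" "VF Y" "VF Z"
  shows "der X (ip Y Z) = (\<lambda>p. ip (D X Y) Z p + ip Y (D X Z) p)"
  using levi_civita_conj[THEN conjunct2, THEN conjunct1, rule_format, OF assms] by (simp add: der_def ip_def)

lemma D_smul:
  assumes "VF X" "VF Y" "SF f"
  shows "D (smul f X) Y = smul f (D X Y)"
    "D X (smul f Y) = smul (der X f) Y + smul f (D X Y)"
proof -
  note * = levi_civita_conj[THEN conjunct2, THEN conjunct2, THEN conjunct1, rule_format, OF assms(3,1,2)]
  show "D (smul f X) Y = smul f (D X Y)"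
    using *[THEN conjunct1] by (simp only: smul_def)
  show "D X (smul f Y) = smul (der X f) Y + smul f (D X Y)"
    using *[THEN conjunct2] by (simp only: smul_def der_def func_plus)
qed

lemma D_torsion: "VF X \<Longrightarrow> VF Y \<Longrightarrow> lie_bracket X Y = D X Y - D Y X"
  by (rule levi_civita_conj[THEN conjunct2, THEN conjunct2, THEN conjunct2, rule_format, symmetric])

lemma D_minus:
  assumes "VF X" "VF Y"
  shows "D (- X) Y = - D X Y" "D X (- Y) = - D X Y"
proof -
  have "- X = smul (\<lambda>_. -1) X" for X by (simp add: smul_def fun_eq_iff)
  then show "D (- X) Y = - D X Y" "D X (- Y) = - D X Y"
    using D_smul[OF assms SF_const[of "-1"]] assms(1)
    by (simp_all add: der_fun) (simp add: smul_def fun_eq_iff)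
qed

lemma D_diff:
  assumes "VF X" "VF Y" "VF Z"
  shows "D (X - Y) Z = D X Z - D Y Z" "D X (Y - Z) = D X Y - D X Z"
  using D_add[of X "- Y" Z] D_add[of X Y "- Z"] D_minus assms by simp_all

subsection \<open>Curvature\<close>

definition Rm :: "'a vfield \<Rightarrow> 'a vfield \<Rightarrow> 'a vfield \<Rightarrow> 'a vfield" where
  "Rm X Y Z = D X (D Y Z) - D Y (D X Z) - D (lie_bracket X Y) Z"

definition R :: "'a vfield \<Rightarrow> 'a vfield \<Rightarrow> 'a vfield \<Rightarrow> 'a vfield \<Rightarrow> 'a \<Rightarrow> real" where
  "R X Y Z W = ip (Rm Z W Y) X"

lemma R_curvature: "R X Y Z W p = curvature A g X Y Z W p"
  by (simp only: R_def Rm_def curvature_def curvature_op_def ip_def D_def Let_def)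

lemma VF_Rm [simp]: "VF X \<Longrightarrow> VF Y \<Longrightarrow> VF Z \<Longrightarrow> VF (Rm X Y Z)"
  unfolding Rm_def by (intro VF_diff VF_D VF_lie_bracket)

lemma Rm_antisym:
  assumes "VF X" "VF Y" "VF Z"
  shows "Rm X Y Z = - Rm Y X Z"
  using assms lie_bracket_antisym[of X Y] by (simp add: Rm_def D_minus)

lemma Rm_linear:
  assumes "VF X" "VF Y" "VF Z" "VF W"
  shows "Rm (X + Y) Z W = Rm X Z W + Rm Y Z W"
  using assms by (simp add: Rm_def D_add lie_bracket_linear)

lemma Rm_smul:
  assumes "VF X" "VF Y" "VF Z" "SF f"
  shows "Rm (smul f X) Y Z = smul f (Rm X Y Z)"
  using assms by (simp add: Rm_def D_add D_diff D_smul lie_bracket_smul smul_simps)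

lemma R_antisym_right:
  assumes "VF X" "VF Y" "VF Z" "VF W"
  shows "R X Y Z W p = - R X Y W Z p"
  using Rm_antisym[of Z W Y] assms by (simp add: R_def ip_left)

text \<open>Second derivatives of the function \<open>ip X Y\<close> commute up to the bracket.
  Expanding this with metric compatibility leaves the symmetric part of the curvature, which is
  therefore 0.\<close>

lemma R_antisym_left:
  assumes "VF X" "VF Y" "VF Z" "VF W"
  shows "R X Y Z W p = - R Y X Z W p"
proof -
  have "der (lie_bracket Z W) (ip X Y) p = der Z (der W (ip X Y)) p - der W (der Z (ip X Y)) p"
    by (simp add: der_field)
  then show ?thesis
    using assms ip_sym[of X "D Z (D W Y)"] ip_sym[of X "D W (D Z Y)"] ip_sym[of X "D (lie_bracket Z W) Y"]
    by (simp add: D_metric der_fun R_def Rm_def ip_left)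
qed

text \<open>Vanishing torsion turns the cyclic sum of second derivatives into the cyclic sum of
  double brackets, which is 0 by the Jacobi identity.\<close>

lemma bianchi:
  assumes "VF X" "VF Y" "VF Z"
  shows "Rm X Y Z + Rm Y Z X + Rm Z X Y = 0"
proof -
  have t: "D U V = D V U + lie_bracket U V" if "VF U" "VF V" for U V
    using D_torsion[OF that] by simp
  have "D X (D Y Z) = D X (D Z Y) + D X (lie_bracket Y Z)" 
    "D Y (D Z X) = D Y (D X Z) + D Y (lie_bracket Z X)"
    "D Z (D X Y) = D Z (D Y X) + D Z (lie_bracket X Y)"
    using t[of Y Z] t[of Z X] t[of X Y] assms by (simp_all add: D_add)
  then have "Rm X Y Z + Rm Y Z X + Rm Z X Y =
      (D X (lie_bracket Y Z) - D (lie_bracket Y Z) X) + (D Y (lie_bracket Z X) - D (lie_bracket Z X) Y)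
      + (D Z (lie_bracket X Y) - D (lie_bracket X Y) Z)"
    unfolding Rm_def by (simp add: algebra_simps)
  also have "\<dots> = lie_bracket X (lie_bracket Y Z) + lie_bracket Y (lie_bracket Z X) + lie_bracket Z (lie_bracket X Y)"
    using assms D_torsion by simp
  also have "lie_bracket Y (lie_bracket Z X) = - lie_bracket Y (lie_bracket X Z)"
    by (rule field_der_eqI) (simp_all add: assms der_field der_fun fun_eq_iff)
  also have "lie_bracket Z (lie_bracket X Y) = - lie_bracket (lie_bracket X Y) Z"
    by (rule lie_bracket_antisym)
  finally have "Rm X Y Z + Rm Y Z X + Rm Z X Y =
    (lie_bracket (lie_bracket X Y) Z + lie_bracket Y (lie_bracket X Z)) + - lie_bracket Y (lie_bracket X Z)
      + - lie_bracket (lie_bracket X Y) Z" unfolding jacobi[OF assms] .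
  moreover have "a + b + - b + - a = 0" for a b :: "'a vfield" by (simp add: fun_eq_iff)
  ultimately show ?thesis by (rule trans)
qed

lemma R_bianchi:
  assumes "VF X" "VF Y" "VF Z" "VF W"
  shows "R W Z X Y p + R W X Y Z p + R W Y Z X p = 0"
proof -
  have "ip (Rm X Y Z + Rm Y Z X + Rm Z X Y) W p = ip 0 W p" using bianchi[of X Y Z] assms by simp
  then show ?thesis using assms by (simp add: R_def ip_left) (simp add: ip_def form_zero)
qed

text \<open>The classical combination of four Bianchi sums, one for each omitted first argument, in
  which the antisymmetries cancel all other terms.\<close>

lemma R_pair_sym:
  assumes "VF X" "VF Y" "VF Z" "VF W"
  shows "R X Y Z W p = R Z W X Y p"
  using R_bianchi[of Y Z W X p] R_bianchi[of Z W X Y p] R_bianchi[of W X Y Z p] R_bianchi[of X Y Z W p]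
    R_antisym_left[of X Y Z W p] R_antisym_left[of X Z W Y p] R_antisym_left[of X W Y Z p]
    R_antisym_left[of Y Z W X p] R_antisym_left[of Y W X Z p] R_antisym_left[of Z W X Y p]
    R_antisym_right[of X Y Z W p] R_antisym_right[of X Z W Y p] R_antisym_right[of X W Y Z p]
    R_antisym_right[of Y Z W X p] R_antisym_right[of Y W X Z p] R_antisym_right[of Z W X Y p]
    R_antisym_right[of Y X Z W p] R_antisym_right[of Z X W Y p] R_antisym_right[of W X Y Z p]
    R_antisym_right[of Z Y W X p] R_antisym_right[of W Y X Z p] R_antisym_right[of W Z X Y p]
    assms
  by simp

lemma R_add:
  assumes "VF X" "VF X'" "VF Y" "VF Z" "VF W"
  shows "R (X + X') Y Z W p = R X Y Z W p + R X' Y Z W p"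
    "R Y (X + X') Z W p = R Y X Z W p + R Y X' Z W p"
    "R Y Z (X + X') W p = R Y Z X W p + R Y Z X' W p"
    "R Y Z W (X + X') p = R Y Z W X p + R Y Z W X' p"
proof -
  show 1: "R (X + X') Y Z W p = R X Y Z W p + R X' Y Z W p" using assms by (simp add: R_def ip_right)
  then show "R Y (X + X') Z W p = R Y X Z W p + R Y X' Z W p"
    using assms R_antisym_left[of Y _ Z W p] by simp
  show "R Y Z (X + X') W p = R Y Z X W p + R Y Z X' W p" using assms by (simp add: R_def Rm_linear ip_left)
  then show "R Y Z W (X + X') p = R Y Z W X p + R Y Z W X' p"
    using assms R_antisym_right[of Y Z W _ p] by simp
qed

lemma R_smul:
  assumes "SF f" "VF X" "VF Y" "VF Z" "VF W"
  shows "R (smul f X) Y Z W p = f p * R X Y Z W p" "R Y (smul f X) Z W p = f p * R Y X Z W p"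
    "R Y Z (smul f X) W p = f p * R Y Z X W p" "R Y Z W (smul f X) p = f p * R Y Z W X p"
proof -
  show 1: "R (smul f X) Y Z W p = f p * R X Y Z W p" using assms by (simp add: R_def ip_right)
  then show "R Y (smul f X) Z W p = f p * R Y X Z W p"
    using assms R_antisym_left[of Y _ Z W p] by simp
  show "R Y Z (smul f X) W p = f p * R Y Z X W p" using assms by (simp add: R_def Rm_smul ip_left)
  then show "R Y Z W (smul f X) p = f p * R Y Z W X p"
    using assms R_antisym_right[of Y Z W _ p] by simp
qed

text \<open>The arguments are exchanged one at a time. This is the uniqueness behind the definite
  description in \<open>curvature_at\<close>.\<close>

lemma R_cong:
  assumes "VF X" "VF Y" "VF Z" "VF W" "VF X'" "VF Y'" "VF Z'" "VF W'"
    and eq: "X p = X' p" "Y p = Y' p" "Z p = Z' p" "W p = W' p"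
  shows "R X Y Z W p = R X' Y' Z' W' p"
proof -
  have "R X Y Z W p = R X' Y Z W p"
    by (rule tensorial_at[of "\<lambda>X. R X Y Z W p", where p=p])
       (use assms in \<open>simp_all add: R_add R_smul[unfolded smul_def]\<close>)
  also have "\<dots> = R X' Y' Z W p"
    by (rule tensorial_at[of "\<lambda>Y. R X' Y Z W p", where p=p])
       (use assms in \<open>simp_all add: R_add R_smul[unfolded smul_def]\<close>)
  also have "\<dots> = R X' Y' Z' W p"
    by (rule tensorial_at[of "\<lambda>Z. R X' Y' Z W p", where p=p])
       (use assms in \<open>simp_all add: R_add R_smul[unfolded smul_def]\<close>)
  also have "\<dots> = R X' Y' Z' W' p"
    by (rule tensorial_at[of "\<lambda>W. R X' Y' Z' W p", where p=p])
       (use assms in \<open>simp_all add: R_add R_smul[unfolded smul_def]\<close>)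
  finally show ?thesis .
qed

lemma curvature_at_eq:
  assumes "VF X" "VF Y" "VF Z" "VF W"
  shows "curvature_at A g p (X p) (Y p) (Z p) (W p) = R X Y Z W p"
  unfolding curvature_at_def R_curvature[symmetric]
proof (rule the_equality)
  fix r
  assume "\<exists>X' Y' Z' W'. VF X' \<and> VF Y' \<and> VF Z' \<and> VF W' \<and>
      X' p = X p \<and> Y' p = Y p \<and> Z' p = Z p \<and> W' p = W p \<and> r = R X' Y' Z' W' p"
  then obtain X' Y' Z' W' where "VF X'" "VF Y'" "VF Z'" "VF W'"
    "X' p = X p" "Y' p = Y p" "Z' p = Z p" "W' p = W p" and r: "r = R X' Y' Z' W' p"
    by (elim exE conjE)
  then show "r = R X Y Z W p" unfolding r using assms by (intro R_cong)
qed (use assms in blast)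

end

subsection \<open>Indefinite S-manifolds\<close>

text \<open>Every \<open>v\<close> is a combination of the characteristic vectors minus
  \<open>\<phi> p (\<phi> p v)\<close>, so a basis of the image of \<phi> and the framing span
  together: 2n + s vectors at most.\<close>

lemma gff_tangent_dim:
  fixes A :: "('a::{t2_space,second_countable_topology}, 'e::euclidean_space) atlas"
  assumes gff: "gff_manifold n s A \<phi> \<xi> \<eta>" and n: "n \<ge> 1"
  shows "\<exists>C. finite C \<and> card C \<le> DIM('e) \<and> tangent_space A p \<subseteq> span C"
proof -
  obtain B where B: "\<phi> p ` tangent_space A p \<subseteq> span B" "card B = dim (\<phi> p ` tangent_space A p)"
    using basis_exists by metis
  have "card B = 2 * n" using B(2) gff by (simp add: gff_manifold_def)
  \<comment> \<open>An infinite set has cardinality 0, so a positive cardinality gives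
    finiteness.\<close>
  then have "finite B" using n by (intro card_ge_0_finite) simp
  let ?X = "(\<lambda>\<alpha>. \<xi> \<alpha> p) ` {1..s}"
  have "v \<in> span (B \<union> ?X)" if v: "v \<in> tangent_space A p" for v
  proof -
    have "\<phi> p v \<in> tangent_space A p"
      using gff v by (auto simp: gff_manifold_def tensor_field_1_1_def)
    then have "\<phi> p (\<phi> p v) \<in> span (B \<union> ?X)" using B(1) span_mono[of B "B \<union> ?X"] by blast
    moreover have "(\<Sum>\<alpha>\<in>{1..s}. \<eta> \<alpha> p v *\<^sub>R \<xi> \<alpha> p) \<in> span (B \<union> ?X)"
      by (intro span_sum span_scale span_base) auto
    ultimately have "(\<Sum>\<alpha>\<in>{1..s}. \<eta> \<alpha> p v *\<^sub>R \<xi> \<alpha> p) - \<phi> p (\<phi> p v) \<in> span (B \<union> ?X)"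
      by (intro span_diff)
    moreover have "(\<Sum>\<alpha>\<in>{1..s}. \<eta> \<alpha> p v *\<^sub>R \<xi> \<alpha> p) - \<phi> p (\<phi> p v) = v"
      using gff v by (simp add: gff_manifold_def)
    ultimately show ?thesis by (simp only:)
  qed
  moreover have "card (B \<union> ?X) \<le> DIM('e)"
    using card_Un_le[of B ?X] card_image_le[of "{1..s}" "\<lambda>\<alpha>. \<xi> \<alpha> p"] \<open>card B = 2 * n\<close> gff
    by (simp add: gff_manifold_def)
  ultimately show ?thesis using \<open>finite B\<close> by (intro exI[of _ "B \<union> ?X"]) auto
qed

locale S_manifold = semi_riemannian A g
  for A :: "('a::{t2_space,second_countable_topology}, 'e::euclidean_space) atlas"
    and g :: "'a \<Rightarrow> 'a tvec \<Rightarrow> 'a tvec \<Rightarrow> real" +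
  fixes n s :: nat and \<phi> :: "'a \<Rightarrow> 'a tvec \<Rightarrow> 'a tvec"
    and \<xi> :: "nat \<Rightarrow> 'a vfield" and \<eta> :: "nat \<Rightarrow> 'a \<Rightarrow> 'a tvec \<Rightarrow> real"
  assumes S: "indefinite_S_manifold n s A \<phi> \<xi> \<eta> g"
begin

lemma igff: "indefinite_gff_manifold n s A \<phi> \<xi> \<eta> g" and normal: "normal_gff s A \<phi> \<xi> \<eta>"
  and gff: "gff_manifold n s A \<phi> \<xi> \<eta>"
  using S by (auto simp: indefinite_S_manifold_def indefinite_gff_manifold_def)

lemma s_pos: "1 \<in> {1..s}" and dim_eq: "DIM('e) = 2 * n + s" and tensor: "tensor_field_1_1 A \<phi>"
  using gff by (simp_all add: gff_manifold_def)

text \<open>The paper's \<open>\<phi>\<close>, \<open>\<eta>\<^sup>\<alpha>\<close>, \<open>\<epsilon>\<^sub>\<alpha>\<close> and \<open>\<eta>\<close>-bar, acting on vector fields, are \<open>phi\<close>, \<open>et\<close>, \<open>ep\<close> and \<open>eb\<close>;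
  \<open>xb\<close> is the metric dual of \<open>\<eta>\<close>-bar.\<close>

definition phi :: "'a vfield \<Rightarrow> 'a vfield" where "phi X = (\<lambda>q. \<phi> q (X q))"
definition et :: "nat \<Rightarrow> 'a vfield \<Rightarrow> 'a \<Rightarrow> real" where "et \<alpha> X = (\<lambda>q. \<eta> \<alpha> q (X q))"
definition ep :: "nat \<Rightarrow> 'a \<Rightarrow> real" where "ep \<alpha> = ip (\<xi> \<alpha>) (\<xi> \<alpha>)"
definition vert :: "'a vfield \<Rightarrow> 'a vfield" where "vert X = (\<lambda>q. \<Sum>\<alpha>\<in>{1..s}. et \<alpha> X q *\<^sub>R \<xi> \<alpha> q)"
definition xb :: "'a vfield" where "xb = (\<lambda>q. \<Sum>\<alpha>\<in>{1..s}. \<xi> \<alpha> q)"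
definition eb :: "'a vfield \<Rightarrow> 'a \<Rightarrow> real" where "eb X = ip X xb"
definition E :: "'a \<Rightarrow> real" where "E = (\<lambda>q. \<Sum>\<alpha>\<in>{1..s}. ep \<alpha> q)"

lemma VF_xi [simp]: "\<alpha> \<in> {1..s} \<Longrightarrow> VF (\<xi> \<alpha>)"
  and one_form_eta: "\<alpha> \<in> {1..s} \<Longrightarrow> one_form A (\<eta> \<alpha>)"
  using gff by (simp_all add: gff_manifold_def)

lemma phi_linear_on: "linear_on (T p) (\<phi> p)"
  using tensor by (simp add: tensor_field_1_1_def)

lemma VF_phi [simp]: "VF X \<Longrightarrow> VF (phi X)"
  using tensor by (simp add: tensor_field_1_1_def phi_def)

lemma phi_linear:
  assumes "VF X"
  shows "VF Y \<Longrightarrow> phi (X + Y) = phi X + phi Y" "phi (smul f X) = smul f (phi X)"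
    "phi (- X) = - phi X" "VF Y \<Longrightarrow> phi (X - Y) = phi X - phi Y"
proof -
  have l: "\<phi> p (v + w) = \<phi> p v + \<phi> p w" "\<phi> p (a *\<^sub>R v) = a *\<^sub>R \<phi> p v" if "v \<in> T p" "w \<in> T p" for p v w a
    using phi_linear_on[of p] that by (simp_all add: linear_on_def)
  show 1: "phi (X + Y) = phi X + phi Y" if "VF Y" for Y using assms that by (intro ext[where 'a='a]) (simp add: phi_def l(1))
  have sm: "- Y = smul (\<lambda>_. -1) Y" for Y by (simp add: smul_def fun_eq_iff)
  have sc: "phi (smul f X) = smul f (phi X)" if "VF X" for f X
    using that by (intro ext[where 'a='a]) (simp only: phi_def smul_def l(2)[OF VF_tangent VF_tangent])
  then show "phi (smul f X) = smul f (phi X)" for f using assms by blast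
  from sc have m: "phi (- Y) = - phi Y" if "VF Y" for Y using sm that by metis
  show "phi (- X) = - phi X" using m assms .
  show "phi (X - Y) = phi X - phi Y" if "VF Y" for Y using 1[of "- Y"] m[OF that] that by simp
qed

lemma SF_et [simp]: "\<alpha> \<in> {1..s} \<Longrightarrow> VF X \<Longrightarrow> SF (et \<alpha> X)"
  using one_form_eta by (simp add: one_form_def et_def)

lemma et_linear:
  assumes "\<alpha> \<in> {1..s}" "VF X"
  shows "VF Y \<Longrightarrow> et \<alpha> (X + Y) = (\<lambda>q. et \<alpha> X q + et \<alpha> Y q)" "et \<alpha> (smul f X) = (\<lambda>q. f q * et \<alpha> X q)"
    "et \<alpha> (- X) = (\<lambda>q. - et \<alpha> X q)" "VF Y \<Longrightarrow> et \<alpha> (X - Y) = (\<lambda>q. et \<alpha> X q - et \<alpha> Y q)"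
proof -
  have l: "\<eta> \<alpha> p (v + w) = \<eta> \<alpha> p v + \<eta> \<alpha> p w" "\<eta> \<alpha> p (a *\<^sub>R v) = a * \<eta> \<alpha> p v" if "v \<in> T p" "w \<in> T p" for p v w a
    using one_form_eta[OF assms(1)] that by (simp_all add: linear_on_def one_form_def)
  have m: "\<eta> \<alpha> p (- v) = - \<eta> \<alpha> p v" if "v \<in> T p" for p v using l(2)[OF that that, of "-1"] by simp
  have d: "\<eta> \<alpha> p (v - w) = \<eta> \<alpha> p v - \<eta> \<alpha> p w" if "v \<in> T p" "w \<in> T p" for p v w
    using l(1)[OF that(1) T_closed(5)[OF that(2)]] m[OF that(2)] by simp
  show "VF Y \<Longrightarrow> et \<alpha> (X + Y) = (\<lambda>q. et \<alpha> X q + et \<alpha> Y q)" "et \<alpha> (smul f X) = (\<lambda>q. f q * et \<alpha> X q)"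
    "et \<alpha> (- X) = (\<lambda>q. - et \<alpha> X q)" "VF Y \<Longrightarrow> et \<alpha> (X - Y) = (\<lambda>q. et \<alpha> X q - et \<alpha> Y q)"
    using assms(2) by (simp_all add: et_def smul_def l(1) m d) (simp only: l(2)[OF VF_tangent VF_tangent])
qed

lemma VF_vert [simp]: "VF X \<Longrightarrow> VF (vert X)"
  unfolding vert_def by (intro VF_sum VF_scale SF_et VF_xi)

lemma VF_xb [simp]: "VF xb"
  unfolding xb_def by (intro VF_sum VF_xi)

lemma phi_phi: "VF X \<Longrightarrow> phi (phi X) = vert X - X"
proof
  fix q assume "VF X"
  then have "\<phi> q (\<phi> q (X q)) = - X q + (\<Sum>\<alpha>\<in>{1..s}. \<eta> \<alpha> q (X q) *\<^sub>R \<xi> \<alpha> q)"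
    using gff by (simp add: gff_manifold_def)
  then show "phi (phi X) q = (vert X - X) q" by (simp add: phi_def vert_def et_def)
qed

lemma phi_cube: "VF X \<Longrightarrow> phi (phi (phi X)) = - phi X"
proof
  fix q assume "VF X"
  then have "\<phi> q (\<phi> q (\<phi> q (X q))) + \<phi> q (X q) = 0"
    using gff VF_tangent[of X q] unfolding gff_manifold_def by blast
  then have "\<phi> q (\<phi> q (\<phi> q (X q))) = - \<phi> q (X q)" by (rule eq_neg_iff_add_eq_0[THEN iffD2])
  then show "phi (phi (phi X)) q = (- phi X) q" unfolding phi_def by (simp only: fun_Compl_def)
qed

lemma et_xi: "\<alpha> \<in> {1..s} \<Longrightarrow> \<beta> \<in> {1..s} \<Longrightarrow> et \<alpha> (\<xi> \<beta>) = (\<lambda>q. if \<alpha> = \<beta> then 1 else 0)"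
  using gff by (simp add: gff_manifold_def et_def fun_eq_iff)

lemma vert_xi: "\<alpha> \<in> {1..s} \<Longrightarrow> vert (\<xi> \<alpha>) = \<xi> \<alpha>"
proof
  fix q assume a: "\<alpha> \<in> {1..s}"
  have "vert (\<xi> \<alpha>) q = (\<Sum>\<beta>\<in>{1..s}. if \<beta> = \<alpha> then \<xi> \<alpha> q else 0)"
    unfolding vert_def by (rule sum.cong[OF refl]) (use a in \<open>simp only: et_xi split: if_split, simp\<close>)
  then show "vert (\<xi> \<alpha>) q = \<xi> \<alpha> q" using a by simp
qed

text \<open>The framing identity gives \<open>phi (phi (\<xi> \<alpha>)) = 0\<close>, and the cube
  relation returns \<open>phi (\<xi> \<alpha>)\<close> itself.\<close>

lemma phi_xi: "\<alpha> \<in> {1..s} \<Longrightarrow> phi (\<xi> \<alpha>) = 0"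
proof -
  assume a: "\<alpha> \<in> {1..s}"
  have z: "phi (phi (\<xi> \<alpha>)) = 0" using phi_phi[OF VF_xi[OF a]] vert_xi[OF a] by simp
  have "phi (phi (phi (\<xi> \<alpha>))) = phi (smul (\<lambda>_. 0) (\<xi> \<alpha>))" unfolding z by (simp add: smul_def func_zero)
  also have "\<dots> = 0" using phi_linear(2)[OF VF_xi[OF a], of "\<lambda>_. 0"] by (simp add: smul_def func_zero)
  finally show ?thesis using phi_cube[OF VF_xi[OF a]] by simp
qed

lemma et_sum:
  assumes "\<beta> \<in> {1..s}" "finite I" "\<And>i. i \<in> I \<Longrightarrow> SF (f i)" "\<And>i. i \<in> I \<Longrightarrow> VF (X i)"
  shows "et \<beta> (\<lambda>q. \<Sum>i\<in>I. f i q *\<^sub>R X i q) p = (\<Sum>i\<in>I. f i p * et \<beta> (X i) p)"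
  by (rule linear_sum_fields[of "\<lambda>X. et \<beta> X p", OF _ _ assms(2-4)])
     (use assms(1) in \<open>simp_all add: et_linear flip: smul_def\<close>)

lemma et_vert: "\<beta> \<in> {1..s} \<Longrightarrow> VF X \<Longrightarrow> et \<beta> (vert X) = et \<beta> X"
proof
  fix p assume b: "\<beta> \<in> {1..s}" and X: "VF X"
  have "et \<beta> (vert X) p = (\<Sum>\<alpha>\<in>{1..s}. et \<alpha> X p * et \<beta> (\<xi> \<alpha>) p)"
    unfolding vert_def by (rule et_sum[OF b]) (use X in simp_all)
  also have "\<dots> = (\<Sum>\<alpha>\<in>{1..s}. if \<alpha> = \<beta> then et \<beta> X p else 0)"
    by (rule sum.cong) (use b in \<open>auto simp: et_xi\<close>)
  finally show "et \<beta> (vert X) p = et \<beta> X p" using b by simp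
qed

text \<open>The cube relation says that \<open>phi X\<close> has no vertical part.\<close>

lemma et_phi: "\<beta> \<in> {1..s} \<Longrightarrow> VF X \<Longrightarrow> et \<beta> (phi X) = (\<lambda>q. 0)"
proof -
  assume b: "\<beta> \<in> {1..s}" and X: "VF X"
  have "vert (phi X) = 0" using phi_phi[of "phi X"] phi_cube[OF X] X by simp
  then have "et \<beta> (phi X) = et \<beta> (smul (\<lambda>_. 0) X)"
    using et_vert[OF b, of "phi X"] X by (simp add: smul_def func_zero)
  then show ?thesis using et_linear(2)[OF b X] by simp
qed

text \<open>As \<open>X = vert X - phi (phi X)\<close>, a field identity may be checked on its
  \<phi>-image and on its vertical coefficients separately.\<close>

lemma phi_et_eq_0:
  assumes "VF X" "phi X = 0" "\<And>\<alpha>. \<alpha> \<in> {1..s} \<Longrightarrow> et \<alpha> X = (\<lambda>q. 0)"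
  shows "X = 0"
proof -
  have "phi (0::'a vfield) = phi (smul (\<lambda>_. 0) X)" by (simp add: smul_def func_zero)
  then have "phi (phi X) = 0" using assms(1,2) phi_linear(2)[OF assms(1), of "\<lambda>_. 0"] by (simp add: smul_def func_zero)
  moreover have "vert X = 0"
  proof
    show "vert X q = 0 q" for q
      unfolding vert_def by (simp add: assms(3))
  qed
  ultimately show ?thesis using phi_phi[OF assms(1)] by simp
qed

lemma ep_cases: "\<alpha> \<in> {1..s} \<Longrightarrow> ep \<alpha> p = 1 \<or> ep \<alpha> p = -1"
  using igff by (auto simp: indefinite_gff_manifold_def ep_def eps_def ip_def)

lemma ep_square: "\<alpha> \<in> {1..s} \<Longrightarrow> ep \<alpha> p * ep \<alpha> p = 1"
  using ep_cases[of \<alpha> p] by auto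

lemma SF_ep [simp]: "\<alpha> \<in> {1..s} \<Longrightarrow> SF (ep \<alpha>)"
  unfolding ep_def by simp

text \<open>The signs are functions here. Differentiating
  \<open>ep \<alpha> q * ep \<alpha> q = 1\<close> gives the claim, because
  \<open>ep \<alpha>\<close> has no zeros.\<close>

lemma der_ep: "\<alpha> \<in> {1..s} \<Longrightarrow> VF X \<Longrightarrow> der X (ep \<alpha>) = (\<lambda>q. 0)"
proof
  fix p assume a: "\<alpha> \<in> {1..s}" and X: "VF X"
  have "der X (\<lambda>q. ep \<alpha> q * ep \<alpha> q) p = 0" by (simp only: ep_square[OF a] der_fun(5)[OF X])
  then have "2 * (ep \<alpha> p * der X (ep \<alpha>) p) = 0" using a X by (simp add: der_fun)
  then show "der X (ep \<alpha>) p = 0" using ep_cases[OF a, of p] by auto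
qed

lemma compat:
  assumes "VF X" "VF Y"
  shows "ip (phi X) (phi Y) p = ip X Y p - (\<Sum>\<alpha>\<in>{1..s}. ep \<alpha> p * (et \<alpha> X p * et \<alpha> Y p))"
  using igff assms by (simp add: indefinite_gff_manifold_def ip_def phi_def ep_def eps_def et_def mult.assoc)

lemma ip_zero: "VF X \<Longrightarrow> ip X 0 = (\<lambda>p. 0)" "VF X \<Longrightarrow> ip 0 X = (\<lambda>p. 0)"
  by (simp_all add: ip_def form_zero)

lemma ip_xi: "\<alpha> \<in> {1..s} \<Longrightarrow> VF X \<Longrightarrow> ip X (\<xi> \<alpha>) p = ep \<alpha> p * et \<alpha> X p"
proof -
  assume a: "\<alpha> \<in> {1..s}" and X: "VF X"
  have "(\<Sum>\<beta>\<in>{1..s}. ep \<beta> p * (et \<beta> X p * et \<beta> (\<xi> \<alpha>) p)) = (\<Sum>\<beta>\<in>{1..s}. if \<beta> = \<alpha> then ep \<alpha> p * et \<alpha> X p else 0)"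
    by (rule sum.cong) (use a in \<open>auto simp: et_xi\<close>)
  then show ?thesis using compat[OF X VF_xi[OF a], of p] a X by (simp add: phi_xi ip_zero)
qed

lemma et_ip: "\<alpha> \<in> {1..s} \<Longrightarrow> VF X \<Longrightarrow> et \<alpha> X = (\<lambda>p. ep \<alpha> p * ip X (\<xi> \<alpha>) p)"
  by (rule ext) (simp add: ip_xi ep_square flip: mult.assoc)

lemma ip_sum:
  assumes "VF Y" "finite I" "\<And>i. i \<in> I \<Longrightarrow> SF (f i)" "\<And>i. i \<in> I \<Longrightarrow> VF (X i)"
  shows "ip Y (\<lambda>q. \<Sum>i\<in>I. f i q *\<^sub>R X i q) p = (\<Sum>i\<in>I. f i p * ip Y (X i) p)"
  by (rule linear_sum_fields[of "\<lambda>X. ip Y X p", OF _ _ assms(2-4)])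
     (use assms(1) in \<open>simp_all add: ip_right flip: smul_def\<close>)

lemma ip_vert: "VF X \<Longrightarrow> VF Y \<Longrightarrow> ip Y (vert X) p = (\<Sum>\<alpha>\<in>{1..s}. ep \<alpha> p * (et \<alpha> X p * et \<alpha> Y p))"
proof -
  assume X: "VF X" and Y: "VF Y"
  have "ip Y (vert X) p = (\<Sum>\<alpha>\<in>{1..s}. et \<alpha> X p * ip Y (\<xi> \<alpha>) p)"
    unfolding vert_def by (rule ip_sum) (use X Y in simp_all)
  also have "\<dots> = (\<Sum>\<alpha>\<in>{1..s}. ep \<alpha> p * (et \<alpha> X p * et \<alpha> Y p))"
    by (rule sum.cong) (use Y in \<open>simp_all add: ip_xi mult_ac\<close>)
  finally show ?thesis .
qed

text \<open>Evaluate the inner product of \<open>phi X\<close> with \<open>phi (phi Y)\<close>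
  twice: by compatibility it is \<open>ip X (phi Y)\<close>, by the formula for the square of \<phi>
  it is \<open>- ip (phi X) Y\<close>.\<close>

lemma phi_skew:
  assumes "VF X" "VF Y"
  shows "ip (phi X) Y p = - ip X (phi Y) p"
proof -
  have "ip (phi X) (phi (phi Y)) p = ip X (phi Y) p"
    using compat[of X "phi Y" p] assms by (simp add: et_phi)
  moreover have "ip (phi X) (phi (phi Y)) p = - ip (phi X) Y p"
    using assms by (simp add: phi_phi ip_right ip_vert et_phi)
  ultimately show ?thesis by simp
qed

lemma eb_sum: "VF X \<Longrightarrow> eb X p = (\<Sum>\<alpha>\<in>{1..s}. ep \<alpha> p * et \<alpha> X p)"
proof -
  assume X: "VF X"
  have "eb X p = ip X (\<lambda>q. \<Sum>\<alpha>\<in>{1..s}. (\<lambda>_. 1) q *\<^sub>R \<xi> \<alpha> q) p" by (simp add: eb_def xb_def)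
  also have "\<dots> = (\<Sum>\<alpha>\<in>{1..s}. 1 * ip X (\<xi> \<alpha>) p)" by (rule ip_sum) (use X in simp_all)
  finally show ?thesis using X by (simp add: ip_xi)
qed

lemma eb_eta_bar: "VF X \<Longrightarrow> eta_bar s \<xi> \<eta> g p (X p) = eb X p"
  by (simp add: eb_sum eta_bar_def eps_def ep_def ip_def et_def)

lemma fundamental:
  assumes "\<alpha> \<in> {1..s}" "VF X" "VF Y"
  shows "2 * ip X (phi Y) p = der X (et \<alpha> Y) p - der Y (et \<alpha> X) p - et \<alpha> (lie_bracket X Y) p"
proof -
  have "fundamental_form \<phi> g X Y p = ext_deriv (\<eta> \<alpha>) X Y p"
    using S assms by (simp add: indefinite_S_manifold_def)
  then show ?thesis by (simp add: fundamental_form_def ext_deriv_def ip_def phi_def der_def et_def)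
qed

text \<open>All the exterior derivatives equal the fundamental form, so the vertical sum collapses
  to a multiple of \<open>xb\<close>.\<close>

lemma normality:
  assumes "VF X" "VF Y"
  shows "phi (phi (lie_bracket X Y)) + lie_bracket (phi X) (phi Y) - phi (lie_bracket (phi X) Y)
    - phi (lie_bracket X (phi Y)) + smul (\<lambda>q. 2 * ip X (phi Y) q) xb = 0"
proof
  fix p
  have e: "ext_deriv (\<eta> \<alpha>) X Y p = ip X (phi Y) p" if "\<alpha> \<in> {1..s}" for \<alpha>
    using S assms that by (simp add: indefinite_S_manifold_def fundamental_form_def ip_def phi_def)
  have "2 *\<^sub>R (\<Sum>\<alpha>\<in>{1..s}. ext_deriv (\<eta> \<alpha>) X Y p *\<^sub>R \<xi> \<alpha> p) = 2 *\<^sub>R (\<Sum>\<alpha>\<in>{1..s}. ip X (phi Y) p *\<^sub>R \<xi> \<alpha> p)"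
    by (rule arg_cong[of _ _ "\<lambda>v. 2 *\<^sub>R v"], rule sum.cong) (simp_all only: e)
  also have "\<dots> = smul (\<lambda>q. 2 * ip X (phi Y) q) xb p"
    by (simp only: smul_def xb_def scaleR_sum_right scaleR_scaleR)
  finally have "nijenhuis \<phi> X Y p + smul (\<lambda>q. 2 * ip X (phi Y) q) xb p = 0"
    using normal[unfolded normal_gff_def, rule_format, OF assms, of p] by (simp only:)
  then show "(phi (phi (lie_bracket X Y)) + lie_bracket (phi X) (phi Y) - phi (lie_bracket (phi X) Y)
    - phi (lie_bracket X (phi Y)) + smul (\<lambda>q. 2 * ip X (phi Y) q) xb) p = 0 p"
    unfolding nijenhuis_def Let_def phi_def by (simp only: plus_fun_apply fun_diff_def zero_fun_apply)
qed

subsection \<open>Killing property of the characteristic fields and the derivative of \<open>\<phi>\<close>\<close>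

lemma lie_zero: "VF X \<Longrightarrow> lie_bracket X 0 = 0" "VF X \<Longrightarrow> lie_bracket 0 X = 0"
proof -
  have z: "(0::'a vfield) = smul (\<lambda>_. 0) X" for X by (simp add: smul_def func_zero)
  show "lie_bracket X 0 = 0" if "VF X"
    using lie_bracket_smul(1)[OF that that SF_const[of 0]] der_fun(5)[OF that, of 0] unfolding z[of X]
    by (simp add: smul_def fun_eq_iff)
  then show "lie_bracket 0 X = 0" if "VF X" using that lie_bracket_antisym[of 0 X] by simp
qed

lemma phi_zero: "phi 0 = 0"
proof -
  have z: "(0::'a vfield) = smul (\<lambda>_. 0) 0" by (simp add: smul_def func_zero)
  have "phi (smul (\<lambda>_. 0) 0) = smul (\<lambda>_. 0) (phi 0)" by (rule phi_linear) simp
  then show ?thesis using z by (simp add: smul_def func_zero)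
qed

lemma ip_xi_phi: "\<alpha> \<in> {1..s} \<Longrightarrow> VF Y \<Longrightarrow> ip (\<xi> \<alpha>) (phi Y) p = 0"
  using phi_skew[of "\<xi> \<alpha>" Y p] by (simp add: phi_xi ip_zero)

text \<open>Contract \<open>fundamental\<close> with \<open>\<xi> \<alpha>\<close>: the fundamental
  form vanishes there and \<open>et \<beta> (\<xi> \<alpha>)\<close> is constant. Thus every \<eta>
  is invariant under the flow of every \<xi>.\<close>

lemma et_lie_xi:
  assumes "\<alpha> \<in> {1..s}" "\<beta> \<in> {1..s}" "VF Y"
  shows "et \<beta> (lie_bracket (\<xi> \<alpha>) Y) = der (\<xi> \<alpha>) (et \<beta> Y)"
proof
  fix p
  show "et \<beta> (lie_bracket (\<xi> \<alpha>) Y) p = der (\<xi> \<alpha>) (et \<beta> Y) p"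
    using fundamental[OF assms(2) VF_xi[OF assms(1)] assms(3), of p] ip_xi_phi[OF assms(1,3)] assms
    by (simp add: et_xi der_fun)
qed

text \<open>Normality with first argument \<open>\<xi> \<alpha>\<close> shows that \<phi> kills the
  difference \<open>?W\<close>; its vertical coefficients vanish by
  \<open>et_lie_xi\<close>.\<close>

lemma lie_xi_phi:
  assumes a: "\<alpha> \<in> {1..s}" and Y: "VF Y"
  shows "lie_bracket (\<xi> \<alpha>) (phi Y) = phi (lie_bracket (\<xi> \<alpha>) Y)"
proof -
  let ?W = "phi (lie_bracket (\<xi> \<alpha>) Y) - lie_bracket (\<xi> \<alpha>) (phi Y)"
  have z: "smul (\<lambda>q. 2 * ip (\<xi> \<alpha>) (phi Y) q) xb = 0"
    using ip_xi_phi[OF a Y] by (simp add: smul_def func_zero)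
  have W: "VF ?W" using a Y by simp
  have p0: "phi ?W = 0"
    using normality[of "\<xi> \<alpha>" Y] a Y z by (simp add: phi_xi lie_zero phi_zero phi_linear)
  have e0: "et \<beta> ?W = (\<lambda>q. 0)" if b: "\<beta> \<in> {1..s}" for \<beta>
    using a b Y by (simp add: et_linear et_phi et_lie_xi der_fun)
  have "?W = 0" by (rule phi_et_eq_0[OF W p0 e0])
  then show ?thesis by simp
qed

lemma fundamental_eq:
  assumes "\<alpha> \<in> {1..s}" "VF X" "VF Y"
  shows "(\<lambda>p. 2 * ip X (phi Y) p) = (\<lambda>p. der X (et \<alpha> Y) p - der Y (et \<alpha> X) p - et \<alpha> (lie_bracket X Y) p)"
  by (rule ext) (rule fundamental[OF assms])

lemma der_fundamental:
  assumes "\<alpha> \<in> {1..s}" "VF X" "VF Y" "VF Z"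
  shows "2 * der X (ip Y (phi Z)) p =
    der X (der Y (et \<alpha> Z)) p - der X (der Z (et \<alpha> Y)) p - der X (et \<alpha> (lie_bracket Y Z)) p"
proof -
  have "2 * der X (ip Y (phi Z)) p = der X (\<lambda>p. 2 * ip Y (phi Z) p) p" using assms by (simp add: der_fun)
  also have "\<dots> = der X (der Y (et \<alpha> Z)) p - der X (der Z (et \<alpha> Y)) p - der X (et \<alpha> (lie_bracket Y Z)) p"
    unfolding fundamental_eq[OF assms(1,3,4)] using assms by (simp add: der_fun)
  finally show ?thesis .
qed

text \<open>The fundamental form is an exterior derivative of an invariant form, and Lie derivatives
  commute with exterior derivatives; the Jacobi identity supplies the commutation.\<close>

lemma lie_xi_fundamental:
  assumes a: "\<alpha> \<in> {1..s}" and Y: "VF Y" and Z: "VF Z"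
  shows "der (\<xi> \<alpha>) (ip Y (phi Z)) p = ip (lie_bracket (\<xi> \<alpha>) Y) (phi Z) p + ip Y (phi (lie_bracket (\<xi> \<alpha>) Z)) p"
proof -
  let ?L = "lie_bracket (\<xi> \<alpha>)"
  note X = VF_xi[OF a]
  note der_fundamental[OF a X Y Z, of p]
  moreover have "der (\<xi> \<alpha>) (et \<alpha> (lie_bracket Y Z)) p = et \<alpha> (lie_bracket (?L Y) Z) p + et \<alpha> (lie_bracket Y (?L Z)) p"
    using fun_cong[OF et_lie_xi[OF a a VF_lie_bracket[OF Y Z]], of p] jacobi[OF X Y Z] a X Y Z
    by (simp add: et_linear)
  ultimately show ?thesis
    using fundamental[OF a VF_lie_bracket[OF X Y] Z, of p] fundamental[OF a Y VF_lie_bracket[OF X Z], of p]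
    using a X Y Z by (simp add: et_lie_xi der_field)
qed

text \<open>By \<open>dec\<close> the metric is built from the fundamental form, \<phi>, the signs
  and the \<eta>'s, each of which is invariant under \<open>\<xi> \<alpha>\<close>.\<close>

lemma killing_lie:
  assumes a: "\<alpha> \<in> {1..s}" and Y: "VF Y" and Z: "VF Z"
  shows "der (\<xi> \<alpha>) (ip Y Z) p = ip (lie_bracket (\<xi> \<alpha>) Y) Z p + ip Y (lie_bracket (\<xi> \<alpha>) Z) p"
proof -
  let ?L = "lie_bracket (\<xi> \<alpha>)"
  note X = VF_xi[OF a]
  have dec: "ip U V = (\<lambda>q. - ip U (phi (phi V)) q + (\<Sum>\<beta>\<in>{1..s}. ep \<beta> q * (et \<beta> U q * et \<beta> V q)))" if "VF U" "VF V" for U V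
    using that by (simp add: fun_eq_iff phi_phi ip_right ip_vert mult_ac)
  have SFI: "SF (\<lambda>q. \<Sum>\<beta>\<in>I. ep \<beta> q * (et \<beta> Y q * et \<beta> Z q))" if "I \<subseteq> {1..s}" for I
    using that Y Z by (intro SF_sum SF_mult SF_ep SF_et) auto
  have dI: "der (\<xi> \<alpha>) (\<lambda>q. \<Sum>\<beta>\<in>I. ep \<beta> q * (et \<beta> Y q * et \<beta> Z q)) p =
      (\<Sum>\<beta>\<in>I. ep \<beta> p * (et \<beta> (?L Y) p * et \<beta> Z p)) + (\<Sum>\<beta>\<in>I. ep \<beta> p * (et \<beta> Y p * et \<beta> (?L Z) p))"
    if "finite I" "I \<subseteq> {1..s}" for I
    using that
  proof (induction I)
    case empty
    then show ?case using der_fun(5)[OF X] by simp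
  next
    case (insert i I)
    then have i: "i \<in> {1..s}" and SI: "SF (\<lambda>q. \<Sum>\<beta>\<in>I. ep \<beta> q * (et \<beta> Y q * et \<beta> Z q))"
      using SFI[of I] by auto
    then show ?case using insert X Y Z a
      by (simp add: der_fun der_ep et_lie_xi algebra_simps del: One_nat_def)
  qed
  have "der (\<xi> \<alpha>) (ip Y Z) p = - der (\<xi> \<alpha>) (ip Y (phi (phi Z))) p
      + der (\<xi> \<alpha>) (\<lambda>q. \<Sum>\<beta>\<in>{1..s}. ep \<beta> q * (et \<beta> Y q * et \<beta> Z q)) p"
    unfolding dec[OF Y Z] using X Y Z SFI[OF order_refl] by (simp add: der_fun del: One_nat_def)
  also note dI[OF finite_atLeastAtMost order_refl]
  finally show ?thesis
    using dec[of "?L Y" Z] dec[of Y "?L Z"] lie_xi_fundamental[OF a Y VF_phi[OF Z], of p] lie_xi_phi[OF a Z] a X Y Z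
    by simp
qed

lemma killing:
  assumes a: "\<alpha> \<in> {1..s}" and Y: "VF Y" and Z: "VF Z"
  shows "ip (D Y (\<xi> \<alpha>)) Z p + ip Y (D Z (\<xi> \<alpha>)) p = 0"
  using killing_lie[OF a Y Z, of p] a Y Z D_torsion[of "\<xi> \<alpha>" Y] D_torsion[of "\<xi> \<alpha>" Z]
  by (simp add: D_metric ip_left ip_right)

text \<open>By \<open>killing\<close> the bilinear form \<open>ip (D Y (\<xi> \<alpha>)) Z\<close>
  is skew, so it is determined by the exterior derivative of the metric dual of
  \<open>\<xi> \<alpha>\<close>. That dual is \<open>ep \<alpha>\<close> times
  \<open>\<eta> \<alpha>\<close>, whence the sign factor.\<close>

lemma D_xi:
  assumes a: "\<alpha> \<in> {1..s}" and Y: "VF Y"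
  shows "D Y (\<xi> \<alpha>) = smul (\<lambda>q. - ep \<alpha> q) (phi Y)"
proof (rule ip_eqI)
  fix Z p assume Z: "VF Z"
  note X = VF_xi[OF a]
  have "2 * ip Y (phi Z) p = ep \<alpha> p * (ip Z (D Y (\<xi> \<alpha>)) p - ip Y (D Z (\<xi> \<alpha>)) p)"
    using fundamental[OF a Y Z, of p] a X Y Z D_torsion[OF Y Z]
    by (simp add: et_ip der_fun der_ep D_metric ip_left algebra_simps)
  also have "ip Z (D Y (\<xi> \<alpha>)) p - ip Y (D Z (\<xi> \<alpha>)) p = 2 * ip (D Y (\<xi> \<alpha>)) Z p"
    using killing[OF a Y Z, of p] ip_sym[of Z "D Y (\<xi> \<alpha>)"] X Y Z by simp
  finally have "ip Y (phi Z) p = ep \<alpha> p * ip (D Y (\<xi> \<alpha>)) Z p" by simp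
  then have "ep \<alpha> p * ip Y (phi Z) p = ip (D Y (\<xi> \<alpha>)) Z p"
    using ep_square[OF a, of p] by (simp flip: mult.assoc)
  then show "ip (D Y (\<xi> \<alpha>)) Z p = ip (smul (\<lambda>q. - ep \<alpha> q) (phi Y)) Z p"
    using phi_skew[OF Y Z, of p] Y Z by (simp add: ip_left)
qed (use a Y in simp_all)

lemma D_zero: "VF X \<Longrightarrow> D X 0 = 0"
  using D_diff(2)[of X X X] by simp

lemma D_sum:
  assumes X: "VF X" and "finite I" "\<And>i. i \<in> I \<Longrightarrow> VF (V i)"
  shows "D X (\<lambda>q. \<Sum>i\<in>I. V i q) = (\<lambda>q. \<Sum>i\<in>I. D X (V i) q)"
  using assms(2,3)
proof (induction I)
  case empty
  then show ?case using D_zero[OF X] by (simp only: sum.empty func_zero)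
next
  case (insert i I)
  have "(\<lambda>q. \<Sum>j\<in>insert i I. V j q) = V i + (\<lambda>q. \<Sum>j\<in>I. V j q)"
    unfolding func_plus[of "V i"] by (simp only: sum.insert[OF insert.hyps(1,2)])
  moreover have "VF (\<lambda>q. \<Sum>j\<in>I. V j q)" using insert.prems by (intro VF_sum) auto
  ultimately have "D X (\<lambda>q. \<Sum>j\<in>insert i I. V j q) = D X (V i) + (\<lambda>q. \<Sum>j\<in>I. D X (V j) q)"
    using insert X by (simp only: D_add insertI1 insertI2)
  then show ?case unfolding func_plus[of "D X (V i)"] by (simp only: sum.insert[OF insert.hyps(1,2)])
qed

lemma D_xb:
  assumes "VF Y"
  shows "D Y xb = smul (\<lambda>q. - E q) (phi Y)"
proof
  fix q
  have "D Y xb q = (\<Sum>\<alpha>\<in>{1..s}. D Y (\<xi> \<alpha>) q)"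
    unfolding xb_def using D_sum[OF assms, of "{1..s}" \<xi>] by simp
  also have "\<dots> = (\<Sum>\<alpha>\<in>{1..s}. (- ep \<alpha> q) *\<^sub>R phi Y q)"
    by (rule sum.cong[OF refl]) (simp only: D_xi[OF _ assms] smul_def)
  also have "\<dots> = smul (\<lambda>q. - E q) (phi Y) q"
    unfolding smul_def E_def by (simp only: sum_negf flip: scaleR_sum_left)
  finally show "D Y xb q = smul (\<lambda>q. - E q) (phi Y) q" .
qed

section \<open>The covariant derivative of \<phi>\<close>

definition Dphi :: "'a vfield \<Rightarrow> 'a vfield \<Rightarrow> 'a vfield" where
  "Dphi X Z = D X (phi Z) - phi (D X Z)"

lemma VF_Dphi [simp]: "VF X \<Longrightarrow> VF Z \<Longrightarrow> VF (Dphi X Z)"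
  by (simp add: Dphi_def)

lemma Dphi_linear:
  assumes "VF X" "VF Y" "VF Z"
  shows "Dphi (X + Y) Z = Dphi X Z + Dphi Y Z" "SF f \<Longrightarrow> Dphi (smul f X) Z = smul f (Dphi X Z)"
    "Dphi (X - Y) Z = Dphi X Z - Dphi Y Z"
  using assms by (simp_all add: Dphi_def D_add D_diff D_smul phi_linear smul_simps)

lemma Dphi_skew:
  assumes "VF X" "VF Y" "VF Z"
  shows "ip Y (Dphi X Z) p = - ip Z (Dphi X Y) p"
proof -
  have "ip Y (phi Z) = (\<lambda>q. - ip Z (phi Y) q)"
    using phi_skew[OF assms(2,3)] ip_sym[of Z "phi Y"] assms by (auto simp: fun_eq_iff)
  then have "der X (ip Y (phi Z)) p = - der X (ip Z (phi Y)) p" using assms by (simp add: der_fun)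
  then have "ip (D X Y) (phi Z) p + ip Y (D X (phi Z)) p = - (ip (D X Z) (phi Y) p + ip Z (D X (phi Y)) p)"
    using assms by (simp add: D_metric)
  moreover have "ip (D X Y) (phi Z) p = - ip Z (phi (D X Y)) p" "ip (D X Z) (phi Y) p = - ip Y (phi (D X Z)) p"
    using phi_skew[of "D X Y" Z p] phi_skew[of "D X Z" Y p] ip_sym[of Z "phi (D X Y)"] ip_sym[of Y "phi (D X Z)"] assms
    by simp_all
  ultimately show ?thesis using assms by (simp add: Dphi_def ip_right)
qed

text \<open>Closedness of the fundamental form, which is exact: its potential is
  \<open>\<eta> 1\<close>, available because s is positive.\<close>

lemma fundamental_closed:
  assumes X: "VF X" and Y: "VF Y" and Z: "VF Z"
  shows "der X (ip Y (phi Z)) p + der Y (ip Z (phi X)) p + der Z (ip X (phi Y)) p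
    = ip (lie_bracket X Y) (phi Z) p + ip (lie_bracket Y Z) (phi X) p + ip (lie_bracket Z X) (phi Y) p"
proof -
  note a = s_pos
  note 1 = der_fundamental[OF a, where p=p]
  have 2: "2 * ip (lie_bracket U V) (phi W) p =
      der U (der V (et 1 W)) p - der V (der U (et 1 W)) p - der W (et 1 (lie_bracket U V)) p - et 1 (lie_bracket (lie_bracket U V) W) p"
    if "VF U" "VF V" "VF W" for U V W
    using fundamental[OF a VF_lie_bracket[OF that(1,2)] that(3), of p] by (simp add: der_field)
  have "lie_bracket (lie_bracket X Y) Z + lie_bracket (lie_bracket Y Z) X + lie_bracket (lie_bracket Z X) Y = smul (\<lambda>_. 0) X"
    by (rule field_der_eqI) (simp_all add: assms der_field der_fun fun_eq_iff)
  then have "et 1 (lie_bracket (lie_bracket X Y) Z + lie_bracket (lie_bracket Y Z) X + lie_bracket (lie_bracket Z X) Y) p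
      = et 1 (smul (\<lambda>_. 0) X) p" by (simp only:)
  then have "et 1 (lie_bracket (lie_bracket X Y) Z) p + et 1 (lie_bracket (lie_bracket Y Z) X) p
      + et 1 (lie_bracket (lie_bracket Z X) Y) p = 0"
    using a X Y Z by (simp add: et_linear del: One_nat_def)
  then show ?thesis
    using 1[OF X Y Z] 1[OF Y Z X] 1[OF Z X Y] 2[OF X Y Z] 2[OF Y Z X] 2[OF Z X Y] by linarith
qed

text \<open>Closedness once more, written with the torsion-free connection: the terms containing
  derivatives of the fields cancel.\<close>

lemma Dphi_cyclic:
  assumes X: "VF X" and Y: "VF Y" and Z: "VF Z"
  shows "ip Y (Dphi X Z) p + ip Z (Dphi Y X) p + ip X (Dphi Z Y) p = 0"
proof -
  have d: "der U (ip V (phi W)) p = ip (D U V) (phi W) p - ip (D U W) (phi V) p + ip V (Dphi U W) p"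
    if "VF U" "VF V" "VF W" for U V W
    using that phi_skew[of "D U W" V p] ip_sym[of V "phi (D U W)"] by (simp add: D_metric Dphi_def ip_right)
  have l: "ip (lie_bracket U V) (phi W) p = ip (D U V) (phi W) p - ip (D V U) (phi W) p"
    if "VF U" "VF V" "VF W" for U V W
    using that by (simp add: D_torsion ip_left)
  show ?thesis
    using fundamental_closed[OF assms, of p] d[OF X Y Z] d[OF Y Z X] d[OF Z X Y] l[OF X Y Z] l[OF Y Z X] l[OF Z X Y]
    by linarith
qed

lemma normality_Dphi:
  assumes Y: "VF Y" and Z: "VF Z"
  shows "Dphi (phi Y) Z - Dphi (phi Z) Y + phi (Dphi Z Y) - phi (Dphi Y Z) + smul (\<lambda>q. 2 * ip Y (phi Z) q) xb = 0"
  using normality[OF Y Z] Y Z by (simp add: D_torsion Dphi_def phi_linear algebra_simps)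

text \<open>With \<open>d\<Phi> = 0\<close> (cyclicity), normality expresses \<open>2 T - S\<close>, where \<open>T(X,Y,Z)\<close> is the left-hand side
  and \<open>S\<close> its cyclic sum; summing cyclically gives \<open>S\<close> and then \<open>T\<close>.\<close>

lemma Dphi_phi:
  assumes X: "VF X" and Y: "VF Y" and Z: "VF Z"
  shows "ip Y (Dphi (phi X) Z) p = ip Z (phi X) p * eb Y p + ip X (phi Y) p * eb Z p"
proof -
  \<comment> \<open>Pair the normality identity with \<open>U\<close>. Skewness of \<phi> moves its
    two outer applications to \<open>phi U\<close>, and \<open>Dphi_cyclic\<close> then brings
    \<open>phi U\<close> into the direction of differentiation.\<close>
  have star: "ip V (Dphi (phi U) W) p + ip U (Dphi (phi V) W) p - ip U (Dphi (phi W) V) p + 2 * ip V (phi W) p * eb U p = 0"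
    if U: "VF U" and V: "VF V" and W: "VF W" for U V W
  proof -
    have "ip U (Dphi (phi V) W - Dphi (phi W) V + phi (Dphi W V) - phi (Dphi V W) + smul (\<lambda>q. 2 * ip V (phi W) q) xb) p = 0"
      unfolding normality_Dphi[OF V W] using U by (simp add: ip_zero)
    then show ?thesis
      using U V W Dphi_cyclic[OF V VF_phi[OF U] W, of p] phi_skew[of U "Dphi W V" p] phi_skew[of U "Dphi V W" p]
        Dphi_skew[OF VF_phi[OF U] W V, of p] Dphi_skew[OF W VF_phi[OF U] V, of p]
      by (simp add: ip_right eb_def)
  qed
  have Ph: "ip U (phi V) p = - ip V (phi U) p" if "VF U" "VF V" for U V
    using that phi_skew[of U V p] ip_sym[of V "phi U"] by simp
  show ?thesis
    using star[OF X Y Z] star[OF Y Z X] star[OF Z X Y]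
      Dphi_skew[OF VF_phi[OF X] Y Z, of p] Dphi_skew[OF VF_phi[OF Y] Z X, of p] Dphi_skew[OF VF_phi[OF Z] X Y, of p]
      Ph[OF X Y] Ph[OF Y Z] Ph[OF Z X]
    by (simp add: algebra_simps)
qed

text \<open>Write the brackets in \<open>lie_xi_phi\<close> through the connection; by
  \<open>D_xi\<close> both sides contain the same multiple of \<open>phi (phi Z)\<close>.\<close>

lemma Dphi_xi: "\<alpha> \<in> {1..s} \<Longrightarrow> VF Z \<Longrightarrow> Dphi (\<xi> \<alpha>) Z = 0"
  using lie_xi_phi[of \<alpha> Z] by (simp add: D_torsion Dphi_def phi_linear D_xi algebra_simps)

lemma Dphi_vert: "VF X \<Longrightarrow> VF Y \<Longrightarrow> VF Z \<Longrightarrow> ip Y (Dphi (vert X) Z) p = 0"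
proof -
  assume X: "VF X" and Y: "VF Y" and Z: "VF Z"
  have "ip Y (Dphi (vert X) Z) p = (\<Sum>\<alpha>\<in>{1..s}. et \<alpha> X p * ip Y (Dphi (\<xi> \<alpha>) Z) p)"
    unfolding vert_def
    by (rule linear_sum_fields[of "\<lambda>X. ip Y (Dphi X Z) p"])
       (use X Y Z in \<open>simp_all add: Dphi_linear ip_right flip: smul_def\<close>)
  then show ?thesis using Y Z by (simp add: Dphi_xi ip_zero)
qed

text \<open>Vertical directions contribute nothing, so \<open>X\<close> may be replaced by
  \<open>- phi (phi X)\<close> and \<open>Dphi_phi\<close> applied to \<open>phi X\<close>. In
  vector form, \<open>Dphi X Z\<close> is \<open>G X Z\<close> times \<open>xb\<close> plus
  \<open>eb Z\<close> times \<open>phi (phi X)\<close>.\<close>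

lemma Dphi_eq:
  assumes X: "VF X" and Y: "VF Y" and Z: "VF Z"
  shows "ip Y (Dphi X Z) p = ip (phi X) (phi Z) p * eb Y p - ip (phi X) (phi Y) p * eb Z p"
proof -
  have "Dphi (phi (phi X)) Z = Dphi (vert X) Z - Dphi X Z"
    using X Z by (simp add: phi_phi Dphi_linear)
  then have "ip Y (Dphi X Z) p = - ip Y (Dphi (phi (phi X)) Z) p"
    using X Y Z by (simp add: ip_right Dphi_vert)
  then show ?thesis
    using Dphi_phi[OF VF_phi[OF X] Y Z, of p] phi_skew[of Z "phi X" p] ip_sym[of "phi Z" "phi X"] X Z by simp
qed

subsection \<open>Curvature of S-manifolds\<close>

abbreviation G :: "'a vfield \<Rightarrow> 'a vfield \<Rightarrow> 'a \<Rightarrow> real" where "G X Y \<equiv> ip (phi X) (phi Y)"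

lemma G_sym: "VF X \<Longrightarrow> VF Y \<Longrightarrow> G X Y = G Y X"
  using ip_sym[of "phi X" "phi Y"] by simp

lemma SF_E [simp]: "SF E"
  unfolding E_def by (intro SF_sum SF_ep)

text \<open>By \<open>D_xi\<close> and \<open>der_ep\<close>, curvature applied to
  \<open>\<xi> \<alpha>\<close> is the antisymmetrized derivative of \<phi> up to sign, which
  \<open>Dphi_eq\<close> evaluates.\<close>

lemma R_xi:
  assumes a: "\<alpha> \<in> {1..s}" and W: "VF W" and X: "VF X" and Y: "VF Y"
  shows "R W (\<xi> \<alpha>) X Y p = ep \<alpha> p * (G W X p * eb Y p - G W Y p * eb X p)"
proof -
  have SFm: "SF (\<lambda>q. - ep \<alpha> q)" using a by simp
  have d: "D U (smul (\<lambda>q. - ep \<alpha> q) V) = smul (\<lambda>q. - ep \<alpha> q) (D U V)" if U: "VF U" and V: "VF V" for U V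
  proof -
    have "der U (\<lambda>q. - ep \<alpha> q) = (\<lambda>q. 0)" using a U by (simp add: der_fun der_ep)
    then have "D U (smul (\<lambda>q. - ep \<alpha> q) V) = smul (\<lambda>q. 0) V + smul (\<lambda>q. - ep \<alpha> q) (D U V)"
      using D_smul(2)[OF U V SFm] by simp
    moreover have "smul (\<lambda>q. 0) V = 0" by (simp add: smul_def func_zero)
    ultimately show ?thesis by simp
  qed
  have "Rm X Y (\<xi> \<alpha>) = smul (\<lambda>q. - ep \<alpha> q) (Dphi X Y - Dphi Y X)"
    using a X Y D_torsion[OF X Y]
    by (simp add: Rm_def D_xi d Dphi_def phi_linear smul_simps)
  then have "R W (\<xi> \<alpha>) X Y p = - ep \<alpha> p * (ip W (Dphi X Y) p - ip W (Dphi Y X) p)"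
    using a W X Y ip_sym[of "Dphi X Y" W] ip_sym[of "Dphi Y X" W] by (simp add: R_def ip_left)
  then show ?thesis using W X Y G_sym[OF X Y] G_sym[OF X W] G_sym[OF Y W] by (simp add: Dphi_eq algebra_simps)
qed

lemma R_vert:
  assumes V: "VF V" and W: "VF W" and X: "VF X" and Y: "VF Y"
  shows "R W (vert V) X Y p = eb V p * (G W X p * eb Y p - G W Y p * eb X p)"
proof -
  have "R W (vert V) X Y p = (\<Sum>\<alpha>\<in>{1..s}. et \<alpha> V p * R W (\<xi> \<alpha>) X Y p)"
    unfolding vert_def
    by (rule linear_sum_fields[of "\<lambda>V. R W V X Y p"])
       (use V W X Y in \<open>simp_all add: R_add R_smul flip: smul_def\<close>)
  also have "\<dots> = (\<Sum>\<alpha>\<in>{1..s}. (ep \<alpha> p * et \<alpha> V p) * (G W X p * eb Y p - G W Y p * eb X p))"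
    by (rule sum.cong) (use W X Y in \<open>simp_all add: R_xi\<close>)
  finally show ?thesis using V by (simp add: eb_sum sum_distrib_right)
qed

section \<open>Horizontal fields and the Kaehler part of the curvature\<close>

definition hor :: "'a vfield \<Rightarrow> 'a vfield" where "hor X = X - vert X"

lemma VF_hor [simp]: "VF X \<Longrightarrow> VF (hor X)" by (simp add: hor_def)

lemma hor_phi: "VF X \<Longrightarrow> hor X = - phi (phi X)"
  by (simp add: hor_def phi_phi)

lemma eb_linear:
  assumes "VF X" "VF Y"
  shows "eb (X + Y) p = eb X p + eb Y p" "eb (X - Y) p = eb X p - eb Y p"
  using assms by (simp_all add: eb_def ip_left)

lemma phi_vert: "VF X \<Longrightarrow> phi (vert X) = 0"
proof -
  assume X: "VF X"
  have "vert X = phi (phi X) + X" using phi_phi[OF X] by simp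
  then have "phi (vert X) = phi (phi (phi X)) + phi X" using X by (simp add: phi_linear)
  then show ?thesis using phi_cube[OF X] by simp
qed

lemma phi_hor: "VF X \<Longrightarrow> phi (hor X) = phi X"
  by (simp add: hor_def phi_linear phi_vert)

text \<open>These are the sections of the image of \<phi>: \<open>horiz_phi_phi\<close> gives one
  inclusion and \<open>horiz_phi\<close> the other.\<close>

definition horiz :: "'a vfield \<Rightarrow> bool" where
  "horiz X \<longleftrightarrow> VF X \<and> (\<forall>\<alpha>\<in>{1..s}. et \<alpha> X = (\<lambda>q. 0))"

lemma horizD [simp]: "horiz X \<Longrightarrow> VF X"
  by (simp add: horiz_def)

lemma horiz_hor: "VF X \<Longrightarrow> horiz (hor X)"
  by (simp add: horiz_def hor_def et_linear et_vert)

lemma horiz_phi: "VF X \<Longrightarrow> horiz (phi X)"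
  by (simp add: horiz_def et_phi)

lemma horiz_linear:
  "horiz X \<Longrightarrow> horiz Y \<Longrightarrow> horiz (X + Y)" "horiz X \<Longrightarrow> horiz Y \<Longrightarrow> horiz (X - Y)"
  "SF f \<Longrightarrow> horiz X \<Longrightarrow> horiz (smul f X)"
  by (simp_all add: horiz_def et_linear)

lemma horiz_phi_phi: "horiz X \<Longrightarrow> phi (phi X) = - X"
proof -
  assume X: "horiz X"
  have "vert X = 0"
  proof
    show "vert X q = 0 q" for q using X by (simp add: horiz_def vert_def)
  qed
  then show ?thesis using X phi_phi[of X] by simp
qed

lemma horiz_eb: "horiz X \<Longrightarrow> eb X = (\<lambda>q. 0)"
  by (simp add: fun_eq_iff eb_sum) (simp add: horiz_def)

lemma horiz_G: "VF X \<Longrightarrow> horiz Y \<Longrightarrow> G X Y = ip X Y"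
proof
  fix p assume "VF X" "horiz Y"
  then show "G X Y p = ip X Y p" using phi_skew[of X "phi Y" p] by (simp add: horiz_phi_phi ip_right)
qed

lemma ip_hor: "VF X \<Longrightarrow> VF Y \<Longrightarrow> ip (hor X) Y p = G X Y p"
  using phi_skew[of "phi X" Y p] by (simp add: hor_phi ip_left)

text \<open>Covariant differentiation leaves the horizontal distribution. Differentiating
  \<open>eb Z = 0\<close> measures the defect through \<open>D_xb\<close>; this is how
  \<open>E\<close> enters the horizontal curvature.\<close>

lemma eb_D:
  assumes X: "VF X" and Z: "horiz Z"
  shows "eb (D X Z) p = E p * ip Z (phi X) p"
proof -
  have "der X (eb Z) p = 0" using horiz_eb[OF Z] der_fun(5)[OF X] by simp
  then show ?thesis using X Z by (simp add: eb_def D_metric D_xb ip_right)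
qed

text \<open>The commutator of curvature with \<phi> is an antisymmetrized second derivative of
  \<phi>. On horizontal arguments \<open>Dphi\<close> has vertical values, so pairing with a
  horizontal \<open>W\<close> retains only terms from \<open>eb_D\<close>, all with the factor
  \<open>E\<close>.\<close>

lemma ricci_identity_phi:
  assumes X: "VF X" and Y: "VF Y" and Z: "horiz Z" and W: "horiz W"
  shows "R W (phi Z) Y X p + R (phi W) Z Y X p =
    E p * (ip Z (phi Y) p * ip X W p - ip Z (phi X) p * ip Y W p
      - ip X Z p * ip W (phi Y) p + ip Y Z p * ip W (phi X) p)"
proof -
  let ?L = "lie_bracket Y X"
  note VZ = horizD[OF Z] and VW = horizD[OF W]
  have eq: "Rm Y X (phi Z) - phi (Rm Y X Z) =
      Dphi Y (D X Z) + D Y (Dphi X Z) - Dphi X (D Y Z) - D X (Dphi Y Z) - Dphi ?L Z"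
    using X Y VZ by (simp add: Rm_def Dphi_def phi_linear D_diff)
  have 1: "ip W (Dphi U (D V Z)) p = - ip U W p * (E p * ip Z (phi V) p)" if "VF U" "VF V" for U V
    using that VW VZ by (simp add: Dphi_eq horiz_G[OF _ W] horiz_eb[OF W] eb_D[OF _ Z])
  have 2: "ip W (D U (Dphi V Z)) p = - ip V Z p * (E p * ip W (phi U) p)" if U: "VF U" and V: "VF V" for U V
  proof -
    have "ip W (Dphi V Z) = (\<lambda>q. 0)"
      using V VZ VW by (simp add: fun_eq_iff Dphi_eq horiz_eb[OF W] horiz_eb[OF Z])
    then have "der U (ip W (Dphi V Z)) p = 0" using der_fun(5)[OF U] by simp
    then have "ip W (D U (Dphi V Z)) p = - ip (D U W) (Dphi V Z) p"
      using U V VZ VW by (simp add: D_metric)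
    then show ?thesis
      using U V VZ VW by (simp add: Dphi_eq horiz_G[OF _ Z] horiz_eb[OF Z] eb_D[OF _ W])
  qed
  have 3: "ip W (Dphi ?L Z) p = 0"
    using X Y VZ VW by (simp add: Dphi_eq horiz_eb[OF W] horiz_eb[OF Z])
  have "ip W (Rm Y X (phi Z) - phi (Rm Y X Z)) p =
      - ip Y W p * (E p * ip Z (phi X) p) - ip X Z p * (E p * ip W (phi Y) p)
      + ip X W p * (E p * ip Z (phi Y) p) + ip Y Z p * (E p * ip W (phi X) p)"
    unfolding eq using X Y VZ VW 3 by (simp add: ip_right 1 2)
  moreover have "ip W (Rm Y X (phi Z) - phi (Rm Y X Z)) p = R W (phi Z) Y X p + R (phi W) Z Y X p"
    using X Y VZ VW phi_skew[of W "Rm Y X Z" p] ip_sym[of W "Rm Y X (phi Z)"] ip_sym[of "phi W" "Rm Y X Z"]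
    by (simp add: R_def ip_right)
  ultimately show ?thesis by (simp add: algebra_simps)
qed

text \<open>Subtracting the curvature tensor of constant curvature \<open>E\<close> leaves a tensor of Kaehler type on the
  horizontal distribution.\<close>

definition K :: "'a \<Rightarrow> 'a vfield \<Rightarrow> 'a vfield \<Rightarrow> 'a vfield \<Rightarrow> 'a vfield \<Rightarrow> real" where
  "K p X Y Z W = R X Y Z W p - E p * (ip X Z p * ip Y W p - ip X W p * ip Y Z p)"

lemma K_symmetries:
  assumes "VF X" "VF Y" "VF Z" "VF W"
  shows "K p X Y Z W = - K p Y X Z W" "K p X Y Z W = - K p X Y W Z" "K p X Y Z W = K p Z W X Y"
    "K p X Y Z W + K p X Z W Y + K p X W Y Z = 0"
proof -
  note s = ip_sym[OF assms(1,2)] ip_sym[OF assms(1,3)] ip_sym[OF assms(1,4)] ip_sym[OF assms(2,3)]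
    ip_sym[OF assms(2,4)] ip_sym[OF assms(3,4)]
  show "K p X Y Z W = - K p Y X Z W" "K p X Y Z W = - K p X Y W Z"
    using R_antisym_left[of X Y Z W p] R_antisym_right[of X Y Z W p] assms by (simp_all add: K_def algebra_simps)
  show "K p X Y Z W = K p Z W X Y"
    using R_pair_sym[of X Y Z W p] assms s by (simp add: K_def algebra_simps)
  show "K p X Y Z W + K p X Z W Y + K p X W Y Z = 0"
    using R_bianchi[of Z W Y X p] assms s by (simp add: K_def algebra_simps)
qed

lemma K_minus:
  assumes "VF X" "VF Y" "VF Z" "VF W"
  shows "K p (- X) Y Z W = - K p X Y Z W" "K p X (- Y) Z W = - K p X Y Z W"
    "K p X Y (- Z) W = - K p X Y Z W" "K p X Y Z (- W) = - K p X Y Z W"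
proof -
  have m: "- V = smul (\<lambda>_. -1) V" for V by (simp add: smul_def fun_eq_iff)
  show "K p (- X) Y Z W = - K p X Y Z W" "K p X (- Y) Z W = - K p X Y Z W"
    "K p X Y (- Z) W = - K p X Y Z W" "K p X Y Z (- W) = - K p X Y Z W"
    unfolding m K_def using assms by (simp_all add: R_smul ip_left ip_right algebra_simps)
qed

text \<open>The right-hand side of \<open>ricci_identity_phi\<close> is exactly the failure of the
  constant curvature term in \<open>K\<close> to be invariant under \<phi>.\<close>

lemma K_kaehler:
  assumes X: "horiz X" and Y: "horiz Y" and Z: "VF Z" and W: "VF W"
  shows "K p (phi X) (phi Y) Z W = K p X Y Z W"
proof -
  have "R (phi (phi X)) Y Z W p = - R X Y Z W p"
  proof -
    have "phi (phi X) = smul (\<lambda>_. -1) X" using horiz_phi_phi[OF X] by (simp add: smul_def fun_eq_iff)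
    then show ?thesis using X Y Z W by (simp add: R_smul)
  qed
  then show ?thesis
    using ricci_identity_phi[OF W Z Y horiz_phi[OF horizD[OF X]], of p]
      horiz_G[OF Z X] horiz_G[OF W X] G_sym[OF Z horizD[OF X]] G_sym[OF W horizD[OF X]] ip_sym[of X Z] ip_sym[of X W]
      ip_sym[of Y Z] ip_sym[of Y W] phi_skew[of X Z p] phi_skew[of X W p] phi_skew[of Y Z p] phi_skew[of Y W p]
      ip_sym[of W "phi X"] ip_sym[of Z "phi X"] X Y Z W
    by (simp add: K_def algebra_simps)
qed

end

section \<open>Pointwise constant \<phi>-sectional curvature\<close>

locale constant_phi_curvature = S_manifold A g n s \<phi> \<xi> \<eta>
  for A :: "('a::{t2_space,second_countable_topology}, 'e::euclidean_space) atlas"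
    and g :: "'a \<Rightarrow> 'a tvec \<Rightarrow> 'a tvec \<Rightarrow> real"
    and n s :: nat and \<phi> :: "'a \<Rightarrow> 'a tvec \<Rightarrow> 'a tvec"
    and \<xi> :: "nat \<Rightarrow> 'a vfield" and \<eta> :: "nat \<Rightarrow> 'a \<Rightarrow> 'a tvec \<Rightarrow> real" +
  fixes c :: "'a \<Rightarrow> real"
  assumes c: "pointwise_constant_phi_sectional_curvature A \<phi> g c"
begin

lemma horiz_ip_phi: "horiz X \<Longrightarrow> ip X (phi X) p = 0"
  using phi_skew[of X X p] ip_sym[of X "phi X"] by simp

lemma phi_curvature_nonnull:
  assumes X: "horiz X" and nz: "ip X X p \<noteq> 0"
  shows "R X (phi X) X (phi X) p = c p * (ip X X p)\<^sup>2"
proof -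
  \<comment> \<open>A constant scale taken from the value at \<open>p\<close>: \<open>Y\<close> is a
    unit vector at \<open>p\<close> only, and the root raises no question of smoothness.\<close>
  define r where "r = inverse (sqrt \<bar>ip X X p\<bar>)"
  define Y where "Y = smul (\<lambda>_. r) X"
  have r: "r * r * \<bar>ip X X p\<bar> = 1" "r \<noteq> 0"
    using nz real_sqrt_mult_self[of "\<bar>ip X X p\<bar>"] by (simp_all add: r_def field_simps)
  have Y: "horiz Y" unfolding Y_def using X by (simp add: horiz_linear)
  have YY: "ip Y Y p = r * r * ip X X p" using X by (simp add: Y_def ip_left ip_right)
  then have Y1: "ip Y Y p \<in> {1, -1}" using r(1) by (cases "ip X X p > 0") auto
  have pY: "(phi Y) p = \<phi> p (Y p)" by (simp add: phi_def)
  have "Y p = \<phi> p (- phi Y p)"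
  proof -
    have "Y = phi (- phi Y)" using horiz_phi_phi[OF Y] Y by (simp add: phi_linear)
    then have "Y p = phi (- phi Y) p" by (rule arg_cong)
    then show ?thesis by (simp add: phi_def)
  qed
  moreover have "- phi Y p \<in> T p" using Y by (intro T_closed VF_tangent VF_phi horizD)
  ultimately have "Y p \<in> \<phi> p ` T p" by (rule image_eqI)
  from c[unfolded pointwise_constant_phi_sectional_curvature_def, rule_format, OF this]
  have "sectional_curvature A g p (Y p) (phi Y p) = c p"
    using Y1 unfolding pY ip_def by blast
  moreover have "sectional_curvature A g p (Y p) (phi Y p) = R Y (phi Y) Y (phi Y) p"
  proof -
    \<comment> \<open>\<open>Y\<close> and \<open>phi Y\<close> are orthogonal of equal square 1 or
      -1, so the denominator of the sectional curvature is 1 for either sign.\<close>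
    have "ip Y Y p * ip (phi Y) (phi Y) p - (ip Y (phi Y) p)\<^sup>2 = 1"
      using Y Y1 horiz_G[of Y Y] horiz_ip_phi[OF Y] by auto
    then have "g p (Y p) (Y p) * g p (phi Y p) (phi Y p) - (g p (Y p) (phi Y p))\<^sup>2 = 1"
      by (simp add: ip_def)
    then show ?thesis
      using curvature_at_eq[of Y "phi Y" Y "phi Y" p] Y by (simp add: sectional_curvature_def)
  qed
  moreover have "R Y (phi Y) Y (phi Y) p = r * r * r * r * R X (phi X) X (phi X) p"
    unfolding Y_def using X by (simp add: phi_linear R_smul)
  ultimately have "r * r * r * r * R X (phi X) X (phi X) p = c p" by simp
  moreover have "r * r * r * r * (ip X X p)\<^sup>2 = 1"
  proof -
    have "r * r * r * r * (ip X X p)\<^sup>2 = (r * r * \<bar>ip X X p\<bar>) * (r * r * \<bar>ip X X p\<bar>)"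
      by (simp add: power2_eq_square)
    then show ?thesis using r(1) by simp
  qed
  ultimately have "r * r * r * r * R X (phi X) X (phi X) p = r * r * r * r * (c p * (ip X X p)\<^sup>2)"
    by (metis mult.commute mult.left_neutral mult.assoc)
  then show ?thesis using r(2) by simp
qed

text \<open>A null vector \<open>X\<close> is a limit of non-null vectors \<open>X + t Y\<close>, and both sides are polynomial in \<open>t\<close>.\<close>

lemma phi_curvature:
  assumes X: "horiz X"
  shows "R X (phi X) X (phi X) p = c p * (ip X X p)\<^sup>2"
proof (cases "ip X X p \<noteq> 0 \<or> X p = 0")
  case True
  then show ?thesis
  proof
    assume z: "X p = 0"
    then have "ip (Rm X (phi X) (phi X)) X p = 0" "ip X X p = 0"
      using X by (simp_all add: ip_def form_zero)
    then show ?thesis by (simp add: R_def)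
  qed (rule phi_curvature_nonnull[OF X])
next
  case False
  then have null: "ip X X p = 0" and "X p \<noteq> 0" by auto
  then obtain v where v: "v \<in> T p" "g p (X p) v \<noteq> 0" using nondeg[of "X p" p] X by (metis VF_tangent horizD)
  obtain V where V: "VF V" "V p = v" using ex_field_through[OF v(1)] .
  define Y where "Y = hor V"
  have Y: "horiz Y" unfolding Y_def by (rule horiz_hor[OF V(1)])
  have "ip Y X p = ip V X p" unfolding Y_def using V X by (simp add: ip_hor horiz_G)
  moreover have "ip X Y p = ip Y X p" "ip V X p = ip X V p"
    using ip_sym[OF horizD[OF X] horizD[OF Y]] ip_sym[OF V(1) horizD[OF X]] by simp_all
  ultimately have "ip X Y p = ip X V p" by simp
  then have m: "ip X Y p \<noteq> 0" using v(2) V(2) by (simp add: ip_def)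
  let ?Z = "\<lambda>t. X + smul (\<lambda>_. t) Y"
  let ?F = "\<lambda>t. R (?Z t) (phi (?Z t)) (?Z t) (phi (?Z t)) p - c p * (ip (?Z t) (?Z t) p)\<^sup>2"
  \<comment> \<open>The square of \<open>?Z t\<close> is \<open>t\<close> times \<open>?N t\<close>,
    and \<open>?N 0\<close> is nonzero, so \<open>?Z t\<close> is non-null for all small nonzero
    \<open>t\<close>.\<close>
  let ?N = "\<lambda>t. 2 * ip X Y p + t * ip Y Y p"
  have Z: "horiz (?Z t)" for t using X Y by (simp add: horiz_linear)
  have N: "ip (?Z t) (?Z t) p = t * ?N t" for t
    using X Y null ip_sym[of X Y] by (simp add: ip_left ip_right algebra_simps)
  have "isCont ?F 0"
    using X Y by (simp add: phi_linear R_add R_smul ip_left ip_right)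
  then have F0: "?F \<midarrow>0\<rightarrow> ?F 0" by (simp only: isCont_def)
  have "isCont ?N 0" by simp
  then have "?N \<midarrow>0\<rightarrow> ?N 0" by (simp only: isCont_def)
  moreover have "?N 0 \<noteq> 0" using m by simp
  ultimately have "eventually (\<lambda>t. ?N t \<noteq> 0) (at 0)" by (rule tendsto_imp_eventually_ne)
  then have "eventually (\<lambda>t. ?F t = 0) (at 0)"
    unfolding eventually_at_filter
    by eventually_elim (use phi_curvature_nonnull[OF Z] N in auto)
  then have "?F \<midarrow>0\<rightarrow> 0" by (rule tendsto_eventually)
  with F0 have "?F 0 = 0" by (rule LIM_unique)
  moreover have "?Z 0 = X" by (simp add: smul_def fun_eq_iff)
  ultimately show ?thesis by (simp only:)
qed

text \<open>The part of degree two in each argument of the quartic identity: adding its instances at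
  \<open>X + Y\<close> and \<open>X - Y\<close> kills the odd terms, and those at \<open>X\<close>
  and \<open>Y\<close> remove the pure ones.\<close>

lemma phi_curvature_polarized:
  assumes X: "horiz X" and Y: "horiz Y"
  shows "R X (phi X) Y (phi Y) p + R Y (phi Y) X (phi X) p + R X (phi Y) X (phi Y) p + R Y (phi X) Y (phi X) p
    + R X (phi Y) Y (phi X) p + R Y (phi X) X (phi Y) p
    = c p * (2 * ip X X p * ip Y Y p + 4 * (ip X Y p)\<^sup>2)"
proof -
  have m: "X - Y = X + smul (\<lambda>_. -1) Y" by (simp add: smul_def fun_eq_iff)
  have "R (X + Y) (phi (X + Y)) (X + Y) (phi (X + Y)) p + R (X - Y) (phi (X - Y)) (X - Y) (phi (X - Y)) p
      = c p * (ip (X + Y) (X + Y) p)\<^sup>2 + c p * (ip (X - Y) (X - Y) p)\<^sup>2"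
    using phi_curvature[OF horiz_linear(1)[OF X Y]] phi_curvature[OF horiz_linear(2)[OF X Y]] by simp
  moreover have "ip (X + Y) (X + Y) p = ip X X p + 2 * ip X Y p + ip Y Y p"
    "ip (X - Y) (X - Y) p = ip X X p - 2 * ip X Y p + ip Y Y p"
    using X Y ip_sym[of Y X] by (simp_all add: ip_left ip_right)
  ultimately show ?thesis
    unfolding m using X Y phi_curvature[OF X, of p] phi_curvature[OF Y, of p]
    by (simp add: phi_linear R_add R_smul algebra_simps power2_eq_square)
qed

text \<open>\<open>K\<close> has holomorphic sectional curvature c - E. The Kaehler symmetries and
  the Bianchi identity reduce the six terms of the polarized identity to the two unknowns of
  \<open>key\<close>.\<close>

lemma horizontal_sectional:
  assumes X: "horiz X" and Y: "horiz Y"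
  shows "K p X Y X Y = (c p - E p) / 4 * (ip X X p * ip Y Y p - (ip X Y p)\<^sup>2 + 3 * (ip X (phi Y) p)\<^sup>2)"
proof -
  have key: "2 * K p U V U V + 6 * K p U (phi V) U (phi V) = (c p - E p) * (2 * ip U U p * ip V V p + 4 * (ip U V p)\<^sup>2)"
    if U: "horiz U" and V: "horiz V" for U V
  proof -
    note VU = horizD[OF U] and VV = horizD[OF V]
    note i = horiz_ip_phi[OF U, of p] horiz_ip_phi[OF V, of p]
      horiz_G[OF VU V] horiz_G[OF VV U] horiz_G[OF VU U] horiz_G[OF VV V]
      phi_skew[OF VU VV, of p] phi_skew[OF VV VU, of p] phi_skew[OF VU VU, of p] phi_skew[OF VV VV, of p]
      ip_sym[OF VV VU] ip_sym[OF VV VF_phi[OF VU]] ip_sym[OF VU VF_phi[OF VV]]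
    have kk: "K p U V' (phi W) (phi Z) = K p U V' W Z" if "VF V'" "horiz W" "horiz Z" for V' W Z
      using that VU K_kaehler[of W Z U V' p] K_symmetries(3)[of U V' "phi W" "phi Z" p] K_symmetries(3)[of U V' W Z p] by simp
    have k1: "K p V (phi U) V (phi U) = K p U (phi V) U (phi V)"
    proof -
      have "K p (phi V) (phi (phi U)) V (phi U) = K p V (phi U) V (phi U)"
        using U V by (intro K_kaehler horiz_phi) simp_all
      moreover have "K p (phi V) U (phi V) (phi (phi U)) = K p (phi V) U V (phi U)"
        using U V K_kaehler[of V "phi U" "phi V" U p] K_symmetries(3)[of "phi V" U "phi V" "phi (phi U)" p]
          K_symmetries(3)[of "phi V" U V "phi U" p] by (simp add: horiz_phi)
      ultimately have "K p V (phi U) V (phi U) = K p (phi V) U (phi V) U"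
        using U V by (simp add: horiz_phi_phi K_minus)
      then show ?thesis
        using U V K_symmetries(1)[of "phi V" U "phi V" U p] K_symmetries(2)[of U "phi V" "phi V" U p] by simp
    qed
    have k2: "K p U (phi V) V (phi U) = K p U (phi V) U (phi V)"
      using kk[OF VF_phi[OF VV] V horiz_phi[OF VU]] U V
        K_symmetries(2)[of U "phi V" "phi V" U p]
      by (simp add: horiz_phi_phi K_minus)
    have k3: "K p V (phi U) U (phi V) = K p U (phi V) V (phi U)"
      using K_symmetries(3)[of V "phi U" U "phi V" p] U V by simp
    have k4: "K p V (phi V) U (phi U) = K p U (phi U) V (phi V)"
      using K_symmetries(3)[of V "phi V" U "phi U" p] U V by simp
    have k5: "K p U (phi U) V (phi V) = K p U V U V + K p U (phi V) U (phi V)"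
    proof -
      have "K p U (phi U) V (phi V) + K p U V (phi V) (phi U) + K p U (phi V) (phi U) V = 0"
        using K_symmetries(4)[of U "phi U" V "phi V" p] U V by simp
      moreover have "K p U V (phi V) (phi U) = - K p U V U V"
        using kk[OF VV V U] K_symmetries(2)[of U V V U p] U V by simp
      moreover have "K p U (phi V) (phi U) V = - K p U (phi V) V (phi U)"
        using K_symmetries(2)[of U "phi V" "phi U" V p] U V by simp
      ultimately show ?thesis using k2 by simp
    qed
    have "K p U (phi U) V (phi V) + K p V (phi V) U (phi U) + K p U (phi V) U (phi V) + K p V (phi U) V (phi U)
        + K p U (phi V) V (phi U) + K p V (phi U) U (phi V)
        = (c p - E p) * (2 * ip U U p * ip V V p + 4 * (ip U V p)\<^sup>2)"
      using phi_curvature_polarized[OF U V, of p] i U V by (simp add: K_def algebra_simps power2_eq_square)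
    then show ?thesis using k1 k2 k3 k4 k5 by simp
  qed
  \<comment> \<open>With \<open>V\<close> taken as \<open>Y\<close> and as \<open>phi Y\<close>,
    \<open>key\<close> gives two linear equations in the same unknowns; three times the second minus
    the first isolates \<open>K p X Y X Y\<close>.\<close>
  have "K p X (phi (phi Y)) X (phi (phi Y)) = K p X Y X Y"
    using X Y by (simp add: horiz_phi_phi K_minus)
  then have "2 * K p X (phi Y) X (phi Y) + 6 * K p X Y X Y = (c p - E p) * (2 * ip X X p * ip Y Y p + 4 * (ip X (phi Y) p)\<^sup>2)"
    using key[OF X horiz_phi[OF horizD[OF Y]]] horiz_G[OF horizD[OF Y] Y] by simp
  moreover have "k = d / 4 * (x - m + 3 * w)"
    if "2 * k + 6 * l = d * (2 * x + 4 * m)" "2 * l + 6 * k = d * (2 * x + 4 * w)" for k l d x m w :: real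
  proof -
    have "16 * k = 3 * (2 * l + 6 * k) - (2 * k + 6 * l)" by simp
    also have "\<dots> = 4 * (d * (x - m + 3 * w))" unfolding that by (simp add: algebra_simps)
    finally show ?thesis by simp
  qed
  ultimately show ?thesis using key[OF X Y] by (simp only: mult.assoc)
qed

text \<open>The curvature components with a vertical argument are those of \<open>P\<close>.\<close>

definition P :: "'a \<Rightarrow> 'a vfield \<Rightarrow> 'a vfield \<Rightarrow> 'a vfield \<Rightarrow> 'a vfield \<Rightarrow> real" where
  "P p X Y Z W = G X Z p * eb Y p * eb W p + G Y W p * eb X p * eb Z p
    - G X W p * eb Y p * eb Z p - G Y Z p * eb X p * eb W p"

text \<open>The difference of \<open>R\<close> and \<open>P\<close> kills vertical arguments, so all
  arguments may be projected, and \<open>P\<close> vanishes on horizontal ones.\<close>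

lemma R_minus_P_hor:
  assumes X: "VF X" and Y: "VF Y"
  shows "R X Y X Y p = R (hor X) (hor Y) (hor X) (hor Y) p + P p X Y X Y"
proof -
  define Q where "Q = (\<lambda>X Y Z W. R X Y Z W p - P p X Y Z W)"
  \<comment> \<open>Besides projecting the second argument, this swaps both pairs, so that a
    repeated use projects the other one; \<open>pair\<close> then exposes the remaining two.\<close>
  have step: "Q U V Z W = Q (hor V) U W Z" if "VF U" "VF V" "VF Z" "VF W" for U V Z W
  proof -
    have "R U V Z W p = R U (hor V + vert V) Z W p" by (simp add: hor_def)
    also have "\<dots> = R U (hor V) Z W p + R U (vert V) Z W p" using that by (intro R_add) simp_all
    finally have r: "R U V Z W p = R (hor V) U W Z p + eb V p * (G U Z p * eb W p - G U W p * eb Z p)"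
      using that R_vert[of V U Z W p] R_antisym_left[of U "hor V" Z W p] R_antisym_right[of "hor V" U Z W p] by simp
    have "eb (hor V) p = 0" using horiz_eb[OF horiz_hor[OF that(2)]] by simp
    then show ?thesis using that r G_sym[of V Z] G_sym[of V W] by (simp add: Q_def P_def phi_hor algebra_simps)
  qed
  have pair: "Q U V Z W = Q Z W U V" if "VF U" "VF V" "VF Z" "VF W" for U V Z W
    using that R_pair_sym[of U V Z W p] G_sym[of U Z] G_sym[of V W] G_sym[of U W] G_sym[of V Z]
    by (simp add: Q_def P_def algebra_simps)
  have "Q X Y X Y = Q (hor Y) X Y X" by (rule step) (use X Y in simp_all)
  also have "\<dots> = Q (hor X) (hor Y) X Y" by (rule step) (use X Y in simp_all)
  also have "\<dots> = Q X Y (hor X) (hor Y)" by (rule pair) (use X Y in simp_all)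
  also have "\<dots> = Q (hor Y) X (hor Y) (hor X)" by (rule step) (use X Y in simp_all)
  also have "\<dots> = Q (hor X) (hor Y) (hor X) (hor Y)" by (rule step) (use X Y in simp_all)
  also have "\<dots> = R (hor X) (hor Y) (hor X) (hor Y) p"
    using horiz_eb[OF horiz_hor[OF X]] horiz_eb[OF horiz_hor[OF Y]] by (simp add: Q_def P_def)
  finally show ?thesis by (simp add: Q_def)
qed

text \<open>On the horizontal parts, the Kaehler coefficient (c - E)/4 and the curvature
  \<open>E\<close> subtracted in \<open>K\<close> add up to (c + 3E)/4; \<open>P\<close> supplies
  the terms with \<open>eb\<close>.\<close>

lemma curvature_formula:
  assumes X: "VF X" and Y: "VF Y"
  shows "R X Y X Y p = (c p + 3 * E p) / 4 * (G X X p * G Y Y p - (G X Y p)\<^sup>2)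
    + 3 * (c p - E p) / 4 * (ip X (phi Y) p)\<^sup>2
    + G X X p * (eb Y p)\<^sup>2 + G Y Y p * (eb X p)\<^sup>2 - 2 * G X Y p * eb X p * eb Y p"
proof -
  note hX = horiz_hor[OF X] and hY = horiz_hor[OF Y]
  have i: "ip (hor U) (hor V) p = G U V p" if "VF U" "VF V" for U V
    using that by (simp add: ip_hor phi_hor)
  have w: "ip (hor X) (phi (hor Y)) p = ip X (phi Y) p"
  proof -
    have "ip (hor X) (phi Y) p = - ip X (phi (phi (phi Y))) p"
      unfolding ip_hor[OF X VF_phi[OF Y]] using X Y by (intro phi_skew) simp_all
    also have "\<dots> = ip X (phi Y) p" unfolding phi_cube[OF Y] using X Y by (simp add: ip_right)
    finally show ?thesis unfolding phi_hor[OF Y] .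
  qed
  define S where "S = G X X p * G Y Y p - (G X Y p)\<^sup>2"
  have 1: "R (hor X) (hor Y) (hor X) (hor Y) p = K p (hor X) (hor Y) (hor X) (hor Y) + E p * S"
    by (simp only: K_def i[OF X X] i[OF Y Y] i[OF X Y] i[OF Y X] G_sym[OF Y X] S_def power2_eq_square)
  have 2: "K p (hor X) (hor Y) (hor X) (hor Y) = (c p - E p) / 4 * (S + 3 * (ip X (phi Y) p)\<^sup>2)"
    unfolding horizontal_sectional[OF hX hY] by (simp only: i[OF X X] i[OF Y Y] i[OF X Y] w S_def)
  have 3: "P p X Y X Y = G X X p * (eb Y p)\<^sup>2 + G Y Y p * (eb X p)\<^sup>2 - 2 * G X Y p * eb X p * eb Y p"
    unfolding P_def G_sym[OF Y X] by (simp add: power2_eq_square)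
  have 4: "(x - y) / 4 * (z + 3 * w) + y * z = (x + 3 * y) / 4 * z + 3 * (x - y) / 4 * w" for x y z w :: real
    by (simp add: field_simps)
  show ?thesis
    unfolding R_minus_P_hor[OF X Y] 1 2 3 4 S_def[symmetric] by simp
qed

subsection \<open>The Ricci tensor\<close>

text \<open>With d = (c + 3E)/4 and f = 3(c - E)/4, this is (2n - 1) d + f + E, the coefficient left
  by the trace of \<open>curvature_formula\<close>.\<close>

definition h :: "'a \<Rightarrow> real" where
  "h = (\<lambda>p. (1/2) * (real (n + 1) * c p + (3 * real n - 1) * E p))"

lemma orthonormal_card:
  assumes B: "orthonormal_basis A g p B"
  shows "orthonormal_set p B" "finite B" "T p \<subseteq> span B" "card B = DIM('e)"
proof -
  show o: "orthonormal_set p B" and f: "finite B" and sp: "T p \<subseteq> span B"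
    using B by (simp_all add: orthonormal_basis_def orthonormal_set_def)
  obtain C where C: "finite C" "card C = DIM('e)" "independent C" "\<forall>v\<in>C. \<exists>X. VF X \<and> X p = v"
    using ex_independent_fields[of p] by blast
  have "C \<subseteq> T p" using C(4) by (metis VF_tangent subsetI)
  then have "card C \<le> card B" using independent_span_bound[OF f C(3)] sp by blast
  moreover have "card B \<le> DIM('e)"
    using independent_card_le[where p=p, OF orthogonal_independent[OF orthonormal_imp_orthogonal[OF o]]] o
    by (auto simp: orthonormal_set_def)
  ultimately show "card B = DIM('e)" using C(2) by simp
qed

lemma trace_square:
  assumes B: "orthonormal_basis A g p B" and F: "\<And>b. b \<in> B \<Longrightarrow> VF (F b)" "\<And>b. b \<in> B \<Longrightarrow> F b p = b"
    and X: "VF X" and Y: "VF Y"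
  shows "(\<Sum>b\<in>B. g p b b * (ip X (F b) p * ip Y (F b) p)) = ip X Y p"
proof -
  have "(\<Sum>b\<in>B. g p b b * (ip X (F b) p * ip Y (F b) p)) = (\<Sum>b\<in>B. g p b b * (g p (X p) b * g p (Y p) b))"
    by (rule sum.cong) (use F in \<open>simp_all add: ip_def\<close>)
  then show ?thesis
    using parseval[OF orthonormal_card(2,1,3)[OF B] VF_tangent[OF X] VF_tangent[OF Y]] by (simp add: ip_def)
qed

text \<open>The metric has trace 2n + s, the size of the basis, and each of the s subtracted squares
  has trace 1.\<close>

lemma trace_G:
  assumes B: "orthonormal_basis A g p B" and F: "\<And>b. b \<in> B \<Longrightarrow> VF (F b)" "\<And>b. b \<in> B \<Longrightarrow> F b p = b"
  shows "(\<Sum>b\<in>B. g p b b * G (F b) (F b) p) = 2 * real n"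
proof -
  have t: "(\<Sum>b\<in>B. g p b b * (ep \<alpha> p * (et \<alpha> (F b) p * et \<alpha> (F b) p))) = 1" if a: "\<alpha> \<in> {1..s}" for \<alpha>
  proof -
    have "et \<alpha> (F b) p * et \<alpha> (F b) p = ip (\<xi> \<alpha>) (F b) p * ip (\<xi> \<alpha>) (F b) p" if b: "b \<in> B" for b
    proof -
      have "et \<alpha> (F b) p = ep \<alpha> p * ip (\<xi> \<alpha>) (F b) p"
        using et_ip[OF a F(1)[OF b]] ip_sym[OF F(1)[OF b] VF_xi[OF a]] by simp
      then show ?thesis using ep_cases[OF a, of p] by auto
    qed
    then have "(\<Sum>b\<in>B. g p b b * (ep \<alpha> p * (et \<alpha> (F b) p * et \<alpha> (F b) p)))
        = (\<Sum>b\<in>B. ep \<alpha> p * (g p b b * (ip (\<xi> \<alpha>) (F b) p * ip (\<xi> \<alpha>) (F b) p)))"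
      by (intro sum.cong) simp_all
    also have "\<dots> = ep \<alpha> p * ip (\<xi> \<alpha>) (\<xi> \<alpha>) p"
      using trace_square[OF B F VF_xi[OF a] VF_xi[OF a]] by (simp flip: sum_distrib_left)
    finally show ?thesis using ep_square[OF a] by (simp add: ep_def)
  qed
  have sq: "g p b b * g p b b = 1" if "b \<in> B" for b
    using orthonormal_card(1)[OF B] that by (auto simp: orthonormal_set_def)
  have "(\<Sum>b\<in>B. g p b b * G (F b) (F b) p)
      = (\<Sum>b\<in>B. 1 - (\<Sum>\<alpha>\<in>{1..s}. g p b b * (ep \<alpha> p * (et \<alpha> (F b) p * et \<alpha> (F b) p))))"
  proof (rule sum.cong[OF refl])
    fix b assume b: "b \<in> B"
    have "ip (F b) (F b) p = g p b b" using F(2)[OF b] by (simp add: ip_def)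
    then show "g p b b * G (F b) (F b) p =
        1 - (\<Sum>\<alpha>\<in>{1..s}. g p b b * (ep \<alpha> p * (et \<alpha> (F b) p * et \<alpha> (F b) p)))"
      using sq[OF b] by (simp add: compat[OF F(1)[OF b] F(1)[OF b]] right_diff_distrib sum_distrib_left)
  qed
  also have "\<dots> = real (card B) - (\<Sum>\<alpha>\<in>{1..s}. \<Sum>b\<in>B. g p b b * (ep \<alpha> p * (et \<alpha> (F b) p * et \<alpha> (F b) p)))"
    by (subst sum.swap) (simp add: sum_subtractf)
  also have "\<dots> = real (card B) - real s" by (simp add: t del: One_nat_def)
  finally show ?thesis using orthonormal_card(4)[OF B] dim_eq by simp
qed

lemma eb_xb: "eb xb p = E p"
proof -
  have "et \<beta> xb p = 1" if b: "\<beta> \<in> {1..s}" for \<beta>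
  proof -
    have "et \<beta> xb p = et \<beta> (\<lambda>q. \<Sum>\<alpha>\<in>{1..s}. (\<lambda>_. 1) q *\<^sub>R \<xi> \<alpha> q) p" by (simp add: xb_def)
    also have "\<dots> = (\<Sum>\<alpha>\<in>{1..s}. 1 * et \<beta> (\<xi> \<alpha>) p)" by (rule et_sum[OF b]) simp_all
    also have "\<dots> = (\<Sum>\<alpha>\<in>{1..s}. if \<alpha> = \<beta> then 1 else 0)"
      by (rule sum.cong) (use b in \<open>auto simp: et_xi\<close>)
    finally show ?thesis using b by simp
  qed
  then show ?thesis by (simp add: eb_sum E_def del: One_nat_def)
qed

text \<open>Apart from \<open>trace_G\<close>, each trace is one of products of linear forms in the
  basis vectors, represented by \<open>hor X\<close>, \<open>phi X\<close> and \<open>xb\<close>;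
  Parseval's identity evaluates it, and the mixed one vanishes as \<open>hor X\<close> is orthogonal
  to \<open>xb\<close>.\<close>

lemma ricci_diagonal:
  assumes B: "orthonormal_basis A g p B" and F: "\<And>b. b \<in> B \<Longrightarrow> VF (F b)" "\<And>b. b \<in> B \<Longrightarrow> F b p = b"
    and X: "VF X"
  shows "(\<Sum>b\<in>B. g p b b * R X (F b) X (F b) p) = h p * G X X p + 2 * real n * (eb X p)\<^sup>2"
proof -
  note tr = trace_square[OF B F]
  have G: "G X (F b) p = ip (hor X) (F b) p" if "b \<in> B" for b
    using ip_hor[OF X F(1)[OF that], of p] by simp
  have w: "(ip X (phi (F b)) p)\<^sup>2 = ip (phi X) (F b) p * ip (phi X) (F b) p" if "b \<in> B" for b
    using phi_skew[OF X F(1)[OF that], of p] by (simp add: power2_eq_square)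
  have e: "eb (F b) p = ip xb (F b) p" if "b \<in> B" for b
    using ip_sym[OF F(1)[OF that] VF_xb] by (simp add: eb_def)
  have t1: "(\<Sum>b\<in>B. g p b b * (G X (F b) p)\<^sup>2) = G X X p"
    using tr[of "hor X" "hor X"] X ip_hor[OF X VF_hor[OF X], of p]
    by (simp add: G power2_eq_square phi_hor cong: sum.cong)
  have t2: "(\<Sum>b\<in>B. g p b b * (ip X (phi (F b)) p)\<^sup>2) = G X X p"
    using tr[of "phi X" "phi X"] X by (simp add: w cong: sum.cong)
  have t3: "(\<Sum>b\<in>B. g p b b * (eb (F b) p)\<^sup>2) = E p"
    using tr[of xb xb] eb_xb by (simp add: e power2_eq_square cong: sum.cong) (simp add: eb_def)
  have t4: "(\<Sum>b\<in>B. g p b b * (G X (F b) p * eb (F b) p)) = 0"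
    using tr[of "hor X" xb] X horiz_eb[OF horiz_hor[OF X]] by (simp add: G e cong: sum.cong) (simp add: eb_def fun_eq_iff)
  let ?d = "(c p + 3 * E p) / 4" and ?f = "3 * (c p - E p) / 4"
  have "(\<Sum>b\<in>B. g p b b * R X (F b) X (F b) p) =
      (\<Sum>b\<in>B. (?d * G X X p + (eb X p)\<^sup>2) * (g p b b * G (F b) (F b) p) - ?d * (g p b b * (G X (F b) p)\<^sup>2)
        + ?f * (g p b b * (ip X (phi (F b)) p)\<^sup>2) + G X X p * (g p b b * (eb (F b) p)\<^sup>2)
        - 2 * eb X p * (g p b b * (G X (F b) p * eb (F b) p)))"
    by (rule sum.cong[OF refl]) (simp only: curvature_formula[OF X F(1)], simp add: algebra_simps)
  also have "\<dots> = (?d * G X X p + (eb X p)\<^sup>2) * (2 * real n) - ?d * G X X p + ?f * G X X p + G X X p * E p"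
    by (simp only: sum.distrib sum_subtractf sum_distrib_left[symmetric] t1 t2 t3 t4 trace_G[OF B F] mult_zero_right diff_0_right)
  also have "\<dots> = h p * G X X p + 2 * real n * (eb X p)\<^sup>2"
    by (simp add: h_def field_simps)
  finally show ?thesis .
qed

text \<open>Polarization of \<open>ricci_diagonal\<close>, the trace being symmetric by pair
  symmetry. The value does not mention \<open>B\<close>, which is what the description in
  \<open>ricci_at\<close> needs.\<close>

lemma ricci_trace:
  assumes B: "orthonormal_basis A g p B" and X: "VF X" and Y: "VF Y"
  shows "(\<Sum>b\<in>B. g p b b * curvature_at A g p (X p) b (Y p) b) = h p * G X Y p + 2 * real n * (eb X p * eb Y p)"
proof -
  have "\<exists>Z. VF Z \<and> Z p = b" if "b \<in> B" for b
    using ex_field_through[of b p] that B by (metis orthonormal_basis_def subsetD)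
  then obtain F where F: "\<And>b. b \<in> B \<Longrightarrow> VF (F b)" "\<And>b. b \<in> B \<Longrightarrow> F b p = b" by metis
  let ?r = "\<lambda>X Y. \<Sum>b\<in>B. g p b b * R X (F b) Y (F b) p"
  have "?r (X + Y) (X + Y) = ?r X X + ?r X Y + ?r Y X + ?r Y Y"
    unfolding sum.distrib[symmetric]
    by (rule sum.cong[OF refl]) (simp add: R_add F(1) X Y algebra_simps)
  moreover have "?r Y X = ?r X Y"
    by (rule sum.cong[OF refl]) (simp add: R_pair_sym[OF Y F(1) X F(1)])
  moreover have "G (X + Y) (X + Y) p = G X X p + 2 * G X Y p + G Y Y p"
    using X Y G_sym[OF Y X] by (simp add: phi_linear ip_left ip_right)
  ultimately have "2 * ?r X Y = 2 * (h p * G X Y p + 2 * real n * (eb X p * eb Y p))"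
    using ricci_diagonal[OF B F VF_add[OF X Y]] ricci_diagonal[OF B F X] ricci_diagonal[OF B F Y]
    by (simp add: eb_linear[OF X Y] power2_eq_square algebra_simps)
  moreover have "(\<Sum>b\<in>B. g p b b * curvature_at A g p (X p) b (Y p) b) = ?r X Y"
  proof (rule sum.cong[OF refl])
    fix b assume b: "b \<in> B"
    show "g p b b * curvature_at A g p (X p) b (Y p) b = g p b b * R X (F b) Y (F b) p"
      using curvature_at_eq[OF X F(1)[OF b] Y F(1)[OF b], of p] F(2)[OF b] by simp
  qed
  ultimately show ?thesis by simp
qed

lemma ricci_formula:
  assumes X: "VF X" and Y: "VF Y"
  shows "ricci_at A g p (X p) (Y p) = h p * G X Y p + 2 * real n * (eb X p * eb Y p)"
  unfolding ricci_at_def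
proof (rule the_equality)
  obtain B where "finite B" "orthonormal_set p B" "T p \<subseteq> span B" using ex_orthonormal_basis by blast
  then have "orthonormal_basis A g p B" by (simp add: orthonormal_basis_def orthonormal_set_def)
  then show "\<exists>B. orthonormal_basis A g p B \<and> h p * G X Y p + 2 * real n * (eb X p * eb Y p) =
      (\<Sum>b\<in>B. g p b b * curvature_at A g p (X p) b (Y p) b)"
    using ricci_trace[OF _ X Y, of p B] by (intro exI[of _ B]) simp
next
  fix r assume "\<exists>B. orthonormal_basis A g p B \<and> r = (\<Sum>b\<in>B. g p b b * curvature_at A g p (X p) b (Y p) b)"
  then show "r = h p * G X Y p + 2 * real n * (eb X p * eb Y p)"
    by (elim exE conjE) (simp only: ricci_trace[OF _ X Y])
qed

lemma eta_Einstein: "smooth_fun A c \<Longrightarrow> eta_Einstein s A \<phi> \<xi> \<eta> g"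
  unfolding eta_Einstein_def
proof (intro exI conjI allI impI)
  assume "SF c"
  then show "SF h" unfolding h_def by (intro SF_mult SF_add SF_const SF_E)
  show "SF (\<lambda>_. 2 * real n)" by simp
  fix X Y p assume X: "VF X" and Y: "VF Y"
  show "ricci_at A g p (X p) (Y p) = h p * g p (\<phi> p (X p)) (\<phi> p (Y p)) +
      2 * real n * eta_bar s \<xi> \<eta> g p (X p) * eta_bar s \<xi> \<eta> g p (Y p)"
    using ricci_formula[OF X Y, of p] eb_eta_bar[OF X, of p] eb_eta_bar[OF Y, of p]
    by (simp add: ip_def phi_def)
qed

end

theorem theorem3p1:
  fixes A :: "('a::{t2_space,second_countable_topology}, 'e::euclidean_space) atlas"
    and \<phi> :: "'a \<Rightarrow> 'a tvec \<Rightarrow> 'a tvec"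
    and \<xi> :: "nat \<Rightarrow> 'a vfield"
    and \<eta> :: "nat \<Rightarrow> 'a \<Rightarrow> 'a tvec \<Rightarrow> real"
    and g :: "'a \<Rightarrow> 'a tvec \<Rightarrow> 'a tvec \<Rightarrow> real"
    and c :: "'a \<Rightarrow> real"
    and n s :: nat
  assumes "n \<ge> 2" and "s \<ge> 1"
    and "indefinite_S_manifold n s A \<phi> \<xi> \<eta> g"
    and "smooth_fun A c"
    and "pointwise_constant_phi_sectional_curvature A \<phi> g c"
  shows "eta_Einstein s A \<phi> \<xi> \<eta> g"
proof -
  have igff: "indefinite_gff_manifold n s A \<phi> \<xi> \<eta> g"
    using assms(3) by (simp add: indefinite_S_manifold_def)
  then have gff: "gff_manifold n s A \<phi> \<xi> \<eta>" and metric: "semi_riemannian_metric A g"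
    by (simp_all add: indefinite_gff_manifold_def)
  have manifold: "connected_smooth_manifold A" using gff by (simp add: gff_manifold_def)
  have dim: "\<exists>C. finite C \<and> card C \<le> DIM('e) \<and> tangent_space A p \<subseteq> span C" for p
    using gff_tangent_dim[OF gff] assms(1) by simp
  interpret constant_phi_curvature A g n s \<phi> \<xi> \<eta> c
    by unfold_locales (fact manifold metric dim assms)+
  show ?thesis by (rule eta_Einstein[OF assms(4)])
qed

end
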